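(* Let $c_1,c_2,\beta_1,\beta_2>0$ and let $V:\mathbb{R}\to\mathbb{R}$ be a measurable potential satisfying $$c_1(|x|+1)^{\beta_1}\le V(x)\le c_2(|x|+1)^{\beta_2}\qquad\text{for all }x\in\mathbb{R}.$$ Let $H=-\partial_x^2+V(x)$, and let $\omega\subset\mathbb{R}$ be a measurable set with Lebesgue measure $|\omega|>0$. Then there exists a constant $C$ depending only on $\beta_1,\beta_2,c_1,c_2,\omega$ such that for every $\lambda>0$ $$\|\phi\|_{L^2(\mathbb{R})}\le e^{C\lambda^{\frac{1}{\beta_1}+\frac{\beta_2}{2\beta_1}}\log(\lambda+1)}\|\phi\|_{L^2(\omega)}\qquad\text{for all }\phi\in Ran(P_\lambda(H)).$$
   Context: Since $V(x)\to+\infty$ as $|x|\to\infty$, the self-adjoint operator $H=-\partial_x^2+V$ on $L^2(\mathbb{R})$ has discrete spectrum, with eigenvalues $\lambda_0\le\lambda_1\le\dots\to\infty$ (counted with multiplicity) and eigenfunctions $\phi_k$ forming an orthonormal basis of $L^2(\mathbb{R})$. $Ran(P_\lambda(H))$ denotes the linear span of the eigenfunctions $\phi_k$ with $\lambda_k\le\lambda$. *)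

theory Defs
  imports "HOL-Analysis.Analysis" "HOL-Library.Function_Algebras"
begin

text \<open>Elements of L2 are represented by functions, without passing to almost-everywhere classes;
  the operator below does not depend on the choice of representatives.\<close>

definition L2_fun :: "(real \<Rightarrow> complex) set" where
  "L2_fun = {u \<in> borel_measurable lebesgue. integrable lebesgue (\<lambda>x. (cmod (u x))\<^sup>2)}"

definition L2_norm_on :: "real set \<Rightarrow> (real \<Rightarrow> complex) \<Rightarrow> real" where
  "L2_norm_on A u = sqrt (LINT x:A|lebesgue. (cmod (u x))\<^sup>2)"

text \<open>The function u is locally absolutely continuous, with derivative v almost everywhere.\<close>

definition loc_abs_cont_deriv :: "(real \<Rightarrow> complex) \<Rightarrow> (real \<Rightarrow> complex) \<Rightarrow> bool" where
  "loc_abs_cont_deriv u v \<longleftrightarrow>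
     (\<forall>a b. a \<le> b \<longrightarrow> set_integrable lebesgue {a..b} v \<and>
        u b - u a = (LINT x:{a..b}|lebesgue. v x))"

text \<open>The graph of H = -d^2/dx^2 + V with its maximal domain: u lies in the domain iff u and u'
  are locally absolutely continuous (after choosing the continuous representative) and
  u, -u'' + V u lie in L2. For V locally bounded and bounded below, both endpoints are in the
  limit-point case, so this operator is self-adjoint; it is the only self-adjoint realization, and
  it coincides with the one given by the closed quadratic form of u'^2 + V u^2.\<close>

definition schrodinger_op ::
  "(real \<Rightarrow> real) \<Rightarrow> (real \<Rightarrow> complex) \<Rightarrow> (real \<Rightarrow> complex) \<Rightarrow> bool" where
  "schrodinger_op V u f \<longleftrightarrow> u \<in> L2_fun \<and> f \<in> L2_fun \<and>
     (\<exists>u0 u1 u2. (AE x in lebesgue. u x = u0 x) \<and>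
        loc_abs_cont_deriv u0 u1 \<and> loc_abs_cont_deriv u1 u2 \<and>
        (AE x in lebesgue. f x = - u2 x + complex_of_real (V x) * u x))"

definition eigenfunction :: "(real \<Rightarrow> real) \<Rightarrow> real \<Rightarrow> (real \<Rightarrow> complex) \<Rightarrow> bool" where
  "eigenfunction V \<mu> \<phi> \<longleftrightarrow>
     \<not> (AE x in lebesgue. \<phi> x = 0) \<and>
     schrodinger_op V \<phi> (\<lambda>x. complex_of_real \<mu> * \<phi> x)"

global_interpretation cfun: vector_space "\<lambda>(c::complex) (f::real \<Rightarrow> complex) x. c * f x"
  defines cfun_span = cfun.span
  by unfold_locales (auto simp: fun_eq_iff algebra_simps)

text \<open>The span of all eigenfunctions with eigenvalue at most E. Since an orthonormal eigenbasis
  contains a basis of each (finite-dimensional) eigenspace, this is the span of the members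
  of any such basis with eigenvalue at most E, i.e. the range of the spectral projection.\<close>

definition spectral_range :: "(real \<Rightarrow> real) \<Rightarrow> real \<Rightarrow> (real \<Rightarrow> complex) set" where
  "spectral_range V E = cfun_span {\<phi>. \<exists>\<mu>\<le>E. eigenfunction V \<mu> \<phi>}"

end

(*
Let psi be a real finite sum of eigenfunctions with eigenvalues at most E, and let w be the positive
solution of w'' = V w with w(0) = 1, w'(0) = 0. The functions (-H)^j psi / w and the Wronskians of
(-H)^j psi and w form one sequence u_0, u_1, u_2, ... in which u_j' equals w^(-2) u_(j+1) for even j
and w^2 u_(j+1) for odd j. So Rolle's theorem and Taylor-type estimates apply although V is merely
measurable, and 1 <= w <= exp(M r) on [-r, r] when V <= M^2 there.

Smallness of all u_j with j <= n at a single point propagates to [-r, r], because u_n is a priori of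
size E^(n/2). With r of order E^(1/beta1) half of the mass lies in [-r, r], which gives two things
for n of order E^(1/beta1 + beta2/(2 beta1)). First, psi and each (-H)^j psi have only polynomially
many (in E) zeros in a fixed interval: a cluster of n zeros would, by Rolle, make the function too
small everywhere. Second, if psi is small on many separated points of omega, then the mean value
theorem makes u_1 small at all of these points, except for boundedly many per zero of u_2, and so on
up to u_n. A single point survives all steps, where |u_j| <= sigma^j eta for all j <= n with sigma
polynomial in E. Propagation from this point bounds the norm of psi by (e sigma)^n eta, and sigma^n
accounts for the logarithm in the exponent.
*)
theory Submission imports Defs begin

section \<open>Interlaced Rolle chains\<close>

lemma exp_growth_right:
  fixes g g' :: "real \<Rightarrow> real"
  assumes "0 \<le> d"
    and der: "\<And>s. 0 \<le> s \<Longrightarrow> s \<le> d \<Longrightarrow> (g has_real_derivative g' s) (at s)"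
    and bnd: "\<And>s. 0 \<le> s \<Longrightarrow> s \<le> d \<Longrightarrow> \<bar>g' s\<bar> \<le> D * c * exp (c * s)"
  shows "\<bar>g d - g 0\<bar> \<le> D * (exp (c * d) - 1)"
proof -
  have "D * exp (c * 0) - g 0 \<le> D * exp (c * d) - g d"
  proof (rule DERIV_nonneg_imp_nondecreasing[OF \<open>0 \<le> d\<close>])
    fix s assume s: "0 \<le> s" "s \<le> d"
    have "((\<lambda>s. D * exp (c * s) - g s) has_real_derivative D * (exp (c * s) * c) - g' s) (at s)"
      using der[OF s] by (auto intro!: derivative_eq_intros)
    moreover have "0 \<le> D * (exp (c * s) * c) - g' s"
      using bnd[OF s] by (auto simp: algebra_simps abs_le_iff)
    ultimately show "\<exists>y. ((\<lambda>s. D * exp (c * s) - g s) has_real_derivative y) (at s) \<and> 0 \<le> y" by blast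
  qed
  moreover have "D * exp (c * 0) + g 0 \<le> D * exp (c * d) + g d"
  proof (rule DERIV_nonneg_imp_nondecreasing[OF \<open>0 \<le> d\<close>])
    fix s assume s: "0 \<le> s" "s \<le> d"
    have "((\<lambda>s. D * exp (c * s) + g s) has_real_derivative D * (exp (c * s) * c) + g' s) (at s)"
      using der[OF s] by (auto intro!: derivative_eq_intros)
    moreover have "0 \<le> D * (exp (c * s) * c) + g' s"
      using bnd[OF s] by (auto simp: algebra_simps abs_le_iff)
    ultimately show "\<exists>y. ((\<lambda>s. D * exp (c * s) + g s) has_real_derivative y) (at s) \<and> 0 \<le> y" by blast
  qed
  ultimately show ?thesis by (auto simp: algebra_simps abs_le_iff)
qed

lemma exp_growth_bound:
  fixes f f' :: "real \<Rightarrow> real"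
  assumes der: "\<And>t. t \<in> closed_segment y x \<Longrightarrow> (f has_real_derivative f' t) (at t)"
    and bnd: "\<And>t. t \<in> closed_segment y x \<Longrightarrow> \<bar>f' t\<bar> \<le> D * c * exp (c * \<bar>t - y\<bar>)"
  shows "\<bar>f x - f y\<bar> \<le> D * (exp (c * \<bar>x - y\<bar>) - 1)"
proof -
  define e :: real where "e = (if y \<le> x then 1 else -1)"
  have seg: "y + e * s \<in> closed_segment y x" if "0 \<le> s" "s \<le> \<bar>x - y\<bar>" for s
    using that by (auto simp: e_def closed_segment_eq_real_ivl)
  have "\<bar>f (y + e * \<bar>x - y\<bar>) - f (y + e * 0)\<bar> \<le> D * (exp (c * \<bar>x - y\<bar>) - 1)"
  proof (rule exp_growth_right[where g = "\<lambda>s. f (y + e * s)" and g' = "\<lambda>s. f' (y + e * s) * e"])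
    fix s assume s: "0 \<le> s" "s \<le> \<bar>x - y\<bar>"
    show "((\<lambda>s. f (y + e * s)) has_real_derivative f' (y + e * s) * e) (at s)"
      by (rule DERIV_chain2[where f = f and g = "\<lambda>s. y + e * s", OF der[OF seg[OF s]]])
        (auto intro!: derivative_eq_intros)
    have "\<bar>y + e * s - y\<bar> = s" "\<bar>e\<bar> = 1" using s by (auto simp: e_def)
    then show "\<bar>f' (y + e * s) * e\<bar> \<le> D * c * exp (c * s)"
      using bnd[OF seg[OF s]] by (simp add: abs_mult)
  qed simp
  moreover have "y + e * \<bar>x - y\<bar> = x" by (auto simp: e_def)
  ultimately show ?thesis by simp
qed

text \<open>The bound \<open>Max Z\<close> in place of \<open>b\<close> carries the induction: the
  zeros obtained from all points but the largest stay at or below the second largest, so the one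
  found in the last gap is new.\<close>

lemma Rolle_finite:
  fixes f f' :: "real \<Rightarrow> real"
  assumes "finite Z" "card Z = Suc p" "Z \<subseteq> {a..b}" "\<And>z. z \<in> Z \<Longrightarrow> f z = 0"
    and der: "\<And>x. x \<in> {a..b} \<Longrightarrow> (f has_real_derivative f' x) (at x)"
  shows "\<exists>Z'. finite Z' \<and> card Z' = p \<and> Z' \<subseteq> {a..Max Z} \<and> (\<forall>z\<in>Z'. f' z = 0)"
  using assms(1-4)
proof (induction p arbitrary: Z)
  case 0
  then show ?case by (intro exI[of _ "{}"]) auto
next
  case (Suc p)
  define m where "m = Max Z"
  define Z0 where "Z0 = Z - {m}"
  have ne: "Z \<noteq> {}" using Suc.prems by auto
  have mZ: "m \<in> Z" unfolding m_def using Suc.prems ne by auto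
  have cZ0: "card Z0 = Suc p" using Suc.prems mZ by (simp add: Z0_def)
  have ne0: "Z0 \<noteq> {}" "finite Z0" using cZ0 by (auto intro: card_ge_0_finite)
  obtain Z' where Z': "finite Z'" "card Z' = p" "Z' \<subseteq> {a..Max Z0}" "\<forall>z\<in>Z'. f' z = 0"
    using Suc.IH[of Z0] Suc.prems cZ0 ne0 by (auto simp: Z0_def)
  have m0: "Max Z0 \<in> Z0" using ne0 by auto
  have lt: "Max Z0 < m"
  proof -
    have "Max Z0 \<le> m" unfolding m_def using m0 Suc.prems by (intro Max_ge) (auto simp: Z0_def)
    moreover have "Max Z0 \<noteq> m" using m0 by (auto simp: Z0_def)
    ultimately show ?thesis by simp
  qed
  have sub: "{Max Z0..m} \<subseteq> {a..b}" using Suc.prems(3) m0 mZ by (auto simp: Z0_def)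
  have "\<exists>l z. z > Max Z0 \<and> z < m \<and> (f has_real_derivative l) (at z) \<and> f m - f (Max Z0) = (m - Max Z0) * l"
  proof (rule MVT[OF lt])
    show "continuous_on {Max Z0..m} f"
      using der sub by (intro DERIV_continuous_on[where D = f']) (auto intro: has_field_derivative_at_within)
    show "\<And>x. \<lbrakk>Max Z0 < x; x < m\<rbrakk> \<Longrightarrow> f differentiable (at x)"
      using der sub real_differentiable_def by (metis atLeastAtMost_iff less_imp_le subsetD)
  qed
  then obtain l z where z: "z > Max Z0" "z < m" "(f has_real_derivative l) (at z)"
    "f m - f (Max Z0) = (m - Max Z0) * l" by blast
  have "f m = 0" "f (Max Z0) = 0" using Suc.prems(4) mZ m0 by (auto simp: Z0_def)
  with z lt have "l = 0" by simp
  moreover have "z \<in> {a..b}" using sub z by auto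
  ultimately have fz: "f' z = 0" using DERIV_unique[OF der z(3)] by simp
  have za: "a \<le> z" using sub z \<open>z \<in> {a..b}\<close> by auto
  have zn: "z \<notin> Z'" using Z'(3) z by auto
  show ?case
  proof (intro exI[of _ "insert z Z'"] conjI)
    show "card (insert z Z') = Suc p" using Z' zn by simp
    show "insert z Z' \<subseteq> {a..Max Z}" using Z'(3) z za lt unfolding m_def[symmetric] by force
  qed (use Z' fz in auto)
qed

lemma cluster_pigeonhole:
  fixes Z :: "real set"
  assumes "finite Z" "Z \<subseteq> {-A..A}" "0 < A" "0 < q" "(q + 1) * n \<le> card Z" "0 < n"
  shows "\<exists>a b. -A \<le> a \<and> a \<le> b \<and> b \<le> A \<and> b - a \<le> 2 * A / real q \<and> n \<le> card (Z \<inter> {a..b})"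
proof -
  \<comment> \<open>Points are sorted into cells of length 2A/q. The end point A gets the index q,
    hence q + 1 cells, and points sharing a cell are at most 2A/q apart.\<close>
  define g where "g z = nat \<lfloor>(z + A) * real q / (2 * A)\<rfloor>" for z
  have gq: "g z \<in> {..q}" if "z \<in> Z" for z
  proof -
    have "(z + A) * real q \<le> (2 * A) * real q" using that assms by (intro mult_right_mono) auto
    then have "(z + A) * real q / (2 * A) \<le> real q" using assms by (simp add: field_simps)
    then have "\<lfloor>(z + A) * real q / (2 * A)\<rfloor> \<le> int q" by linarith
    then show ?thesis by (simp add: g_def)
  qed
  have "\<exists>i\<in>{..q}. n \<le> card (Z \<inter> g -` {i})"
  proof (rule ccontr)
    assume "\<not> ?thesis"
    then have lt: "card (Z \<inter> g -` {i}) < n" if "i \<in> {..q}" for i using that by force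
    have "card Z = card (\<Union>i\<in>{..q}. Z \<inter> g -` {i})" using gq by (intro arg_cong[of _ _ card]) auto
    also have "\<dots> \<le> (\<Sum>i\<in>{..q}. card (Z \<inter> g -` {i}))" by (rule card_UN_le) simp
    also have "\<dots> < (\<Sum>i\<in>{..q}. n)" using lt by (intro sum_strict_mono) auto
    also have "\<dots> = (q + 1) * n" by simp
    finally show False using assms by simp
  qed
  then obtain i where i: "i \<le> q" "n \<le> card (Z \<inter> g -` {i})" by auto
  let ?Y = "Z \<inter> g -` {i}"
  have fY: "finite ?Y" using assms(1) by simp
  have ne: "?Y \<noteq> {}"
  proof
    assume "?Y = {}"
    then have "card ?Y = 0" by (simp only: card.empty)
    then show False using i(2) assms(6) by simp
  qed
  define a b where "a = Min ?Y" and "b = Max ?Y"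
  have ab: "a \<in> ?Y" "b \<in> ?Y" unfolding a_def b_def using Min_in[OF fY ne] Max_in[OF fY ne] .
  have "b - a \<le> 2 * A / real q"
  proof -
    have f: "0 \<le> (z + A) * real q / (2 * A)" if "z \<in> Z" for z using that assms by auto
    have gz: "int (g z) = \<lfloor>(z + A) * real q / (2 * A)\<rfloor>" if "z \<in> Z" for z
      unfolding g_def by (rule nat_0_le) (simp only: zero_le_floor f[OF that])
    have "g a = i" "g b = i" "a \<in> Z" "b \<in> Z" using ab by auto
    then have "\<lfloor>(a + A) * real q / (2 * A)\<rfloor> = int i" "\<lfloor>(b + A) * real q / (2 * A)\<rfloor> = int i"
      using gz by metis+
    then have "(b + A) * real q / (2 * A) - (a + A) * real q / (2 * A) \<le> 1" by linarith
    then have "(b - a) * (real q / (2 * A)) \<le> 1" by (simp add: algebra_simps add_divide_distrib diff_divide_distrib)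
    then show ?thesis using assms(3,4) by (simp add: pos_le_divide_eq field_simps)
  qed
  moreover have "?Y \<subseteq> Z \<inter> {a..b}" using Min_le[OF fY] Max_ge[OF fY] unfolding a_def b_def by auto
  then have "n \<le> card (Z \<inter> {a..b})" using i(2) assms(1) card_mono[of "Z \<inter> {a..b}" ?Y] by auto
  moreover have "a \<le> b" unfolding b_def using Max_ge[OF fY ab(1)] .
  moreover have "-A \<le> a" "b \<le> A" using ab assms by auto
  ultimately show ?thesis by blast
qed

section \<open>Chains with alternating weights: growth, zeros, surviving points\<close>

text \<open>The weights come from the factorization of f'' - V f as w^(-1) (w^2 (f/w)')'. The
  condition \<open>w_segment\<close> expresses growth of w away from the origin: on a path from
  [-A,A] to x, w never exceeds K times its final value.\<close>

locale weighted_chain =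
  fixes w :: "real \<Rightarrow> real" and u :: "nat \<Rightarrow> real \<Rightarrow> real" and r A K :: real
  assumes A_pos: "0 < A" and A_le: "A \<le> r" and K_ge: "1 \<le> K"
    and w_ge: "\<And>x. \<bar>x\<bar> \<le> r \<Longrightarrow> 1 \<le> w x"
    and w_le: "\<And>x. \<bar>x\<bar> \<le> A \<Longrightarrow> w x \<le> K"
    and w_segment: "\<And>x y t. \<bar>y\<bar> \<le> A \<Longrightarrow> \<bar>x\<bar> \<le> r \<Longrightarrow> t \<in> closed_segment y x \<Longrightarrow> w t \<le> K * w x"
    and deriv: "\<And>j x. \<bar>x\<bar> \<le> r \<Longrightarrow>
      (u j has_real_derivative (if even j then 1 / (w x)\<^sup>2 else (w x)\<^sup>2) * u (Suc j) x) (at x)"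
begin

lemma abs_segment: "\<bar>y\<bar> \<le> r \<Longrightarrow> \<bar>x\<bar> \<le> r \<Longrightarrow> t \<in> closed_segment y x \<Longrightarrow> \<bar>t\<bar> \<le> (r::real)"
  by (auto simp: closed_segment_eq_real_ivl split: if_splits)

text \<open>A Taylor estimate in closed form, by downward induction on j. With c = tau K^2,
  integrating a bound tau^(j+1) exp(c d) at distance d from y yields tau^j (exp(c d) - 1), and the
  -1 leaves exactly the room needed for the value at y.\<close>

lemma growth:
  assumes y: "\<bar>y\<bar> \<le> A" and B: "0 \<le> B" and \<tau>: "0 \<le> \<tau>" and n: "even n"
    and at_y: "\<And>j. j \<le> n \<Longrightarrow> \<bar>u j y\<bar> \<le> B * \<tau> ^ j"
    and top: "\<And>x. \<bar>x\<bar> \<le> r \<Longrightarrow> \<bar>u n x\<bar> \<le> B * \<tau> ^ n"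
    and x: "\<bar>x\<bar> \<le> r"
  shows "\<bar>u 0 x\<bar> \<le> B * exp (\<tau> * K\<^sup>2 * \<bar>x - y\<bar>)"
proof -
  let ?c = "\<tau> * K\<^sup>2"
  \<comment> \<open>Odd levels are allowed the extra size w(x)^2. It accommodates the weight w(t)^2
    <= K^2 w(x)^2 at odd levels and is cancelled by w^(-2) one level below.\<close>
  let ?q = "\<lambda>j x. if even j then 1 else (w x)\<^sup>2"
  have K2: "1 \<le> K\<^sup>2" using K_ge by simp
  have yr: "\<bar>y\<bar> \<le> r" using y A_le by simp
  have "\<forall>x. \<bar>x\<bar> \<le> r \<longrightarrow> \<bar>u j x\<bar> \<le> B * \<tau> ^ j * exp (?c * \<bar>x - y\<bar>) * ?q j x" if "j \<le> n" for j
    using that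
  proof (induction rule: inc_induct)
    case base
    show ?case
    proof (intro allI impI)
      fix x assume "\<bar>x\<bar> \<le> r"
      then have "\<bar>u n x\<bar> \<le> B * \<tau> ^ n * 1" using top by simp
      also have "\<dots> \<le> B * \<tau> ^ n * exp (?c * \<bar>x - y\<bar>)"
        using B \<tau> by (intro mult_left_mono) auto
      finally show "\<bar>u n x\<bar> \<le> B * \<tau> ^ n * exp (?c * \<bar>x - y\<bar>) * ?q n x" using n by simp
    qed
  next
    case (step j)
    show ?case
    proof (intro allI impI)
      fix x assume x: "\<bar>x\<bar> \<le> r"
      have w1: "1 \<le> w x" using w_ge x by auto
      have q1: "1 \<le> (w x)\<^sup>2" using w1 by simp
      have Bt: "0 \<le> B * \<tau> ^ j" using B \<tau> by simp
      have "\<bar>u j x - u j y\<bar> \<le> (B * \<tau> ^ j * ?q j x) * (exp (?c * \<bar>x - y\<bar>) - 1)"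
      proof (rule exp_growth_bound)
        fix t assume t: "t \<in> closed_segment y x"
        have tr: "\<bar>t\<bar> \<le> r" using abs_segment[OF yr x t] .
        show "(u j has_real_derivative (if even j then 1 / (w t)\<^sup>2 else (w t)\<^sup>2) * u (Suc j) t) (at t)"
          by (rule deriv[OF tr])
        have IH: "\<bar>u (Suc j) t\<bar> \<le> B * \<tau> ^ Suc j * exp (?c * \<bar>t - y\<bar>) * ?q (Suc j) t"
          using step.IH tr by blast
        have wt: "1 \<le> w t" using w_ge tr by auto
        let ?e = "B * \<tau> ^ Suc j * exp (?c * \<bar>t - y\<bar>)"
        have e0: "0 \<le> ?e" using B \<tau> by simp
        show "\<bar>(if even j then 1 / (w t)\<^sup>2 else (w t)\<^sup>2) * u (Suc j) t\<bar>
            \<le> B * \<tau> ^ j * ?q j x * (?c) * exp (?c * \<bar>t - y\<bar>)"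
        proof (cases "even j")
          case True
          have "\<bar>1 / (w t)\<^sup>2 * u (Suc j) t\<bar> \<le> ?e"
            using IH True wt by (simp add: abs_mult field_simps)
          also have "\<dots> \<le> ?e * K\<^sup>2" using e0 K2 mult_left_mono[of 1 "K\<^sup>2" ?e] by simp
          finally show ?thesis using True by (simp add: mult_ac)
        next
          case False
          have "\<bar>(w t)\<^sup>2 * u (Suc j) t\<bar> \<le> (w t)\<^sup>2 * ?e"
            using IH False by (simp add: abs_mult mult_left_mono)
          also have "\<dots> \<le> (K * w x)\<^sup>2 * ?e"
            using e0 w_segment[OF y x t] wt by (intro mult_right_mono power_mono) auto
          finally show ?thesis using False by (simp add: power_mult_distrib mult_ac)
        qed
      qed
      moreover have "\<bar>u j y\<bar> \<le> B * \<tau> ^ j * ?q j x"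
      proof -
        have "\<bar>u j y\<bar> \<le> B * \<tau> ^ j * 1" using at_y[of j] step by simp
        also have "\<dots> \<le> B * \<tau> ^ j * ?q j x" using Bt q1 by (intro mult_left_mono) auto
        finally show ?thesis .
      qed
      ultimately have "\<bar>u j x\<bar> \<le> (B * \<tau> ^ j * ?q j x) * exp (?c * \<bar>x - y\<bar>)"
        by (simp add: algebra_simps)
      then show "\<bar>u j x\<bar> \<le> B * \<tau> ^ j * exp (?c * \<bar>x - y\<bar>) * ?q j x" by (simp add: mult_ac)
    qed
  qed
  from this[of 0] x show ?thesis by auto
qed

lemma deriv_zero_iff:
  "\<bar>x\<bar> \<le> r \<Longrightarrow> (if even j then 1 / (w x)\<^sup>2 else (w x)\<^sup>2) * u (Suc j) x = 0 \<longleftrightarrow> u (Suc j) x = 0"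
  using w_ge[of x] by auto

lemma deriv_factor_le:
  assumes "\<bar>x\<bar> \<le> A"
  shows "\<bar>(if even j then 1 / (w x)\<^sup>2 else (w x)\<^sup>2) * u (Suc j) x\<bar> \<le> K\<^sup>2 * \<bar>u (Suc j) x\<bar>"
    and "\<bar>u (Suc j) x\<bar> \<le> K\<^sup>2 * \<bar>(if even j then 1 / (w x)\<^sup>2 else (w x)\<^sup>2) * u (Suc j) x\<bar>"
proof -
  have w: "1 \<le> w x" "w x \<le> K" using assms w_ge w_le A_le by auto
  have K2: "1 \<le> K\<^sup>2" "(w x)\<^sup>2 \<le> K\<^sup>2" "1 \<le> (w x)\<^sup>2" using K_ge w by (auto intro: power_mono)
  let ?f = "if even j then 1 / (w x)\<^sup>2 else (w x)\<^sup>2"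
  have "0 < (w x)\<^sup>2" using K2(3) by linarith
  then have "1 / (w x)\<^sup>2 \<le> 1" using K2(3) by (simp only: divide_le_eq_1_pos)
  then have "?f \<le> K\<^sup>2" using K2 by auto
  moreover have f0: "0 \<le> ?f" by simp
  ultimately show "\<bar>?f * u (Suc j) x\<bar> \<le> K\<^sup>2 * \<bar>u (Suc j) x\<bar>"
    by (simp add: abs_mult mult_right_mono del: if_split)
  have "1 \<le> K\<^sup>2 * ?f"
  proof (cases "even j")
    case True
    have "1 \<le> K\<^sup>2 / (w x)\<^sup>2" using K2 by (subst le_divide_eq_1_pos) linarith+
    with True show ?thesis by simp
  next
    case False
    have "1 * 1 \<le> K\<^sup>2 * (w x)\<^sup>2" using K2 by (intro mult_mono) auto
    then show ?thesis using False by simp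
  qed
  then have "1 * \<bar>u (Suc j) x\<bar> \<le> (K\<^sup>2 * ?f) * \<bar>u (Suc j) x\<bar>" by (intro mult_right_mono) auto
  then show "\<bar>u (Suc j) x\<bar> \<le> K\<^sup>2 * \<bar>?f * u (Suc j) x\<bar>" using f0 by (simp add: abs_mult mult_ac del: if_split)
qed

lemma zeros_step:
  assumes "finite Z" "card Z = Suc p" "Z \<subseteq> {a..b}" "-r \<le> a" "b \<le> r" "\<And>z. z \<in> Z \<Longrightarrow> u j z = 0"
  shows "\<exists>Z'. finite Z' \<and> card Z' = p \<and> Z' \<subseteq> {a..b} \<and> (\<forall>z\<in>Z'. u (Suc j) z = 0)"
proof -
  let ?f = "\<lambda>x. (if even j then 1 / (w x)\<^sup>2 else (w x)\<^sup>2) * u (Suc j) x"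
  have rng: "\<bar>x\<bar> \<le> r" if "x \<in> {a..b}" for x using that assms(4,5) by auto
  have "\<exists>Z'. finite Z' \<and> card Z' = p \<and> Z' \<subseteq> {a..Max Z} \<and> (\<forall>z\<in>Z'. ?f z = 0)"
    by (rule Rolle_finite[OF assms(1,2,3,6)]) (use deriv rng in blast)+
  then obtain Z' where Z': "finite Z'" "card Z' = p" "Z' \<subseteq> {a..Max Z}" "\<forall>z\<in>Z'. ?f z = 0"
    by blast
  have "Max Z \<in> Z" using assms(1,2) by (intro Max_in) auto
  then have "Max Z \<le> b" using assms(3) by auto
  then have sub: "Z' \<subseteq> {a..b}" using Z'(3) by force
  have "u (Suc j) z = 0" if "z \<in> Z'" for z
    using deriv_zero_iff[OF rng] Z'(4) that sub by blast
  with Z' sub show ?thesis by blast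
qed

lemma zeros_iterate:
  assumes "finite Z" "card Z = n" "Z \<subseteq> {a..b}" "-r \<le> a" "b \<le> r" "\<And>z. z \<in> Z \<Longrightarrow> u 0 z = 0" "j \<le> n"
  shows "\<exists>Z'. finite Z' \<and> card Z' = n - j \<and> Z' \<subseteq> {a..b} \<and> (\<forall>z\<in>Z'. u j z = 0)"
  using assms(7)
proof (induction j)
  case 0
  then show ?case using assms by auto
next
  case (Suc j)
  then obtain Z' where Z': "finite Z'" "card Z' = Suc (n - Suc j)" "Z' \<subseteq> {a..b}" "\<forall>z\<in>Z'. u j z = 0"
    by (auto simp: Suc_diff_Suc)
  from zeros_step[OF Z'(1,2,3) assms(4,5)] Z'(4) show ?case by blast
qed

text \<open>By Rolle's theorem every function up to the n-th one vanishes somewhere in the short interval, so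
  integrating down from the n-th one yields the hypotheses of the growth lemma at its endpoint.\<close>

lemma clustered_zeros_small:
  assumes Z: "finite Z" "n \<le> card Z" "Z \<subseteq> {a..b}" "-A \<le> a" "b \<le> A" "\<And>z. z \<in> Z \<Longrightarrow> u 0 z = 0"
    and len: "(b - a) * K\<^sup>2 * \<tau> \<le> 1" and ab: "a \<le> b" and \<tau>: "0 < \<tau>" and n: "even n" and B: "0 \<le> B"
    and top: "\<And>x. \<bar>x\<bar> \<le> r \<Longrightarrow> \<bar>u n x\<bar> \<le> B * \<tau> ^ n"
    and x: "\<bar>x\<bar> \<le> r"
  shows "\<bar>u 0 x\<bar> \<le> B * exp (\<tau> * K\<^sup>2 * (2 * r))"
proof -
  obtain Z0 where Z0: "Z0 \<subseteq> Z" "card Z0 = n" "finite Z0"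
    using obtain_subset_with_card_n[OF Z(2)] by metis
  have "\<forall>x\<in>{a..b}. \<bar>u j x\<bar> \<le> B * \<tau> ^ j" if "j \<le> n" for j
    using that
  proof (induction rule: inc_induct)
    case base
    then show ?case using top Z(4,5) A_le by auto
  next
    case (step j)
    have "\<exists>Z'. finite Z' \<and> card Z' = n - j \<and> Z' \<subseteq> {a..b} \<and> (\<forall>z\<in>Z'. u j z = 0)"
      by (rule zeros_iterate[OF Z0(3,2)]) (use Z0 Z A_le step in auto)
    then obtain Z' where Z': "card Z' = n - j" "Z' \<subseteq> {a..b}" "\<forall>z\<in>Z'. u j z = 0" by blast
    then have "Z' \<noteq> {}" using step by auto
    then obtain z where z: "z \<in> {a..b}" "u j z = 0" using Z' by blast
    show ?case
    proof
      fix x assume x: "x \<in> {a..b}"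
      have "norm (u j x - u j z) \<le> (K\<^sup>2 * (B * \<tau> ^ Suc j)) * norm (x - z)"
      proof (rule field_differentiable_bound)
        show "convex {a..b}" by simp
        fix t assume t: "t \<in> {a..b}"
        then have tA: "\<bar>t\<bar> \<le> A" using Z by auto
        show "(u j has_field_derivative (if even j then 1 / (w t)\<^sup>2 else (w t)\<^sup>2) * u (Suc j) t) (at t within {a..b})"
          using deriv[of t j] tA A_le by (auto intro: has_field_derivative_at_within)
        have "\<bar>(if even j then 1 / (w t)\<^sup>2 else (w t)\<^sup>2) * u (Suc j) t\<bar> \<le> K\<^sup>2 * \<bar>u (Suc j) t\<bar>"
          using deriv_factor_le(1)[OF tA] .
        also have "\<dots> \<le> K\<^sup>2 * (B * \<tau> ^ Suc j)" using step.IH t by (intro mult_left_mono) auto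
        finally show "norm ((if even j then 1 / (w t)\<^sup>2 else (w t)\<^sup>2) * u (Suc j) t) \<le> K\<^sup>2 * (B * \<tau> ^ Suc j)"
          by simp
      qed (use x z in auto)
      then have "\<bar>u j x\<bar> \<le> (K\<^sup>2 * (B * \<tau> ^ Suc j)) * \<bar>x - z\<bar>" using z by simp
      also have "\<dots> \<le> (K\<^sup>2 * (B * \<tau> ^ Suc j)) * (b - a)"
        using x z B \<tau> by (intro mult_left_mono) auto
      \<comment> \<open>One integration gains the length of the interval and costs K^2;
        \<open>len\<close> makes the product at most 1/tau, which is one power of tau per
        level.\<close>
      also have "\<dots> = (B * \<tau> ^ j) * ((b - a) * K\<^sup>2 * \<tau>)" by simp
      also have "\<dots> \<le> (B * \<tau> ^ j) * 1" using len B \<tau> by (intro mult_left_mono) auto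
      finally show "\<bar>u j x\<bar> \<le> B * \<tau> ^ j" by simp
    qed
  qed
  then have "\<bar>u 0 x\<bar> \<le> B * exp (\<tau> * K\<^sup>2 * \<bar>x - a\<bar>)"
    using ab Z(4,5) by (intro growth[of a B \<tau> n x]) (use B \<tau> n top x in auto)
  also have "\<dots> \<le> B * exp (\<tau> * K\<^sup>2 * (2 * r))"
  proof -
    have "\<bar>x - a\<bar> \<le> 2 * r" using x ab Z(4,5) A_le by auto
    then have "\<tau> * K\<^sup>2 * \<bar>x - a\<bar> \<le> \<tau> * K\<^sup>2 * (2 * r)" using \<tau> by (intro mult_left_mono) auto
    then show ?thesis using B by (intro mult_left_mono) auto
  qed
  finally show ?thesis .
qed

text \<open>The loss 2 K^2 / s per level is the sigma of the final bound: 2/s comes from the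
  difference quotient, K^2 from dividing out the weight.\<close>

lemma small_between:
  assumes "\<bar>x\<bar> \<le> A" "\<bar>y\<bar> \<le> A" "s \<le> y - x" "0 < s" "\<bar>u j x\<bar> \<le> \<eta>" "\<bar>u j y\<bar> \<le> \<eta>"
  shows "\<exists>z. x < z \<and> z < y \<and> \<bar>u (Suc j) z\<bar> \<le> 2 * K\<^sup>2 / s * \<eta>"
proof -
  let ?f = "\<lambda>x. (if even j then 1 / (w x)\<^sup>2 else (w x)\<^sup>2) * u (Suc j) x"
  have rng: "\<bar>t\<bar> \<le> A" if "x \<le> t" "t \<le> y" for t using that assms(1,2) by auto
  have xy: "x < y" using assms by auto
  have "\<exists>z>x. z < y \<and> u j y - u j x = (y - x) * ?f z"
    by (rule MVT2[OF xy]) (rule deriv[OF order_trans[OF rng A_le]])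
  then obtain z where z: "x < z" "z < y" "u j y - u j x = (y - x) * ?f z" by blast
  have "\<bar>u j y - u j x\<bar> \<le> 2 * \<eta>" using assms(5,6) by linarith
  then have a: "(y - x) * \<bar>?f z\<bar> \<le> 2 * \<eta>" using z xy by (simp add: abs_mult)
  have "s * \<bar>?f z\<bar> \<le> (y - x) * \<bar>?f z\<bar>" using assms(3) by (intro mult_right_mono) auto
  with a have "\<bar>?f z\<bar> \<le> 2 * \<eta> / s" using assms(4) by (simp add: field_simps)
  then have "K\<^sup>2 * \<bar>?f z\<bar> \<le> K\<^sup>2 * (2 * \<eta> / s)" by (intro mult_left_mono) auto
  then have "\<bar>u (Suc j) z\<bar> \<le> K\<^sup>2 * (2 * \<eta> / s)" using deriv_factor_le(2)[OF rng, of z j] z by linarith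
  then show ?thesis using z by (intro exI[of _ z]) (auto simp: field_simps)
qed

lemma zero_between:
  assumes "\<bar>a\<bar> \<le> A" "\<bar>b\<bar> \<le> A" "a < x" "x < b"
    "\<bar>u j a\<bar> \<le> T" "\<bar>u j b\<bar> \<le> T" "T < \<bar>u j x\<bar>"
  shows "\<exists>z. a < z \<and> z < b \<and> u (Suc j) z = 0"
proof -
  let ?f = "\<lambda>x. (if even j then 1 / (w x)\<^sup>2 else (w x)\<^sup>2) * u (Suc j) x"
  have rng: "\<bar>t\<bar> \<le> r" if "t \<in> {a..b}" for t using that assms(1,2) A_le by auto
  have "continuous_on {a..b} (u j)"
    by (rule DERIV_continuous_on[where D = ?f])
      (rule has_field_derivative_at_within[OF deriv[OF rng]])
  then have "continuous_on {a..b} (\<lambda>t. \<bar>u j t\<bar>)" by (intro continuous_intros)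
  moreover have "{a..b} \<noteq> {}" using assms by auto
  ultimately obtain z where z: "z \<in> {a..b}" "\<And>t. t \<in> {a..b} \<Longrightarrow> \<bar>u j t\<bar> \<le> \<bar>u j z\<bar>"
    using continuous_attains_sup[OF compact_Icc] by blast
  have zT: "T < \<bar>u j z\<bar>" using z(2)[of x] assms by auto
  then have zab: "a < z" "z < b" using z(1) assms by (force simp: less_le)+
  \<comment> \<open>The square has its maximum at the same point as the absolute value and is
    differentiable there; as u_j does not vanish at that point, the derivative of u_j must.\<close>
  have d: "((\<lambda>t. (u j t)\<^sup>2) has_real_derivative 2 * u j z * ?f z) (at z)"
    using deriv[OF rng[OF z(1)], of j] by (auto intro!: derivative_eq_intros simp del: if_split)
  have "2 * u j z * ?f z = 0"
  proof (rule DERIV_local_max[OF d, of "min (z - a) (b - z)"])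
    show "0 < min (z - a) (b - z)" using zab by simp
    show "\<forall>y. \<bar>z - y\<bar> < min (z - a) (b - z) \<longrightarrow> (u j y)\<^sup>2 \<le> (u j z)\<^sup>2"
    proof (intro allI impI)
      fix y assume "\<bar>z - y\<bar> < min (z - a) (b - z)"
      then have "y \<in> {a..b}" by (auto simp: abs_less_iff)
      then show "(u j y)\<^sup>2 \<le> (u j z)\<^sup>2" using z(2) by (simp flip: abs_le_square_iff)
    qed
  qed
  moreover have "u j z \<noteq> 0" using zT assms(5) by auto
  ultimately have "?f z = 0" by simp
  then show ?thesis using deriv_zero_iff[OF rng[OF z(1)], of j] zab by blast
qed

text \<open>Between consecutive points of G the mean value theorem gives small values of the next function;
  a point of G where that function is large then forces a zero of the one after it.\<close>

lemma separated_step: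
  assumes G: "finite G" "G \<subseteq> {-A..A}" and s: "0 < s"
    and sep: "\<And>x y. x \<in> G \<Longrightarrow> y \<in> G \<Longrightarrow> x < y \<Longrightarrow> s \<le> y - x"
    and small: "\<And>x. x \<in> G \<Longrightarrow> \<bar>u j x\<bar> \<le> \<eta>"
    and zeros: "\<And>Z. finite Z \<Longrightarrow> Z \<subseteq> {-A..A} \<Longrightarrow> (\<forall>z\<in>Z. u (Suc (Suc j)) z = 0) \<Longrightarrow> card Z \<le> k"
  shows "card G \<le> card {x \<in> G. \<bar>u (Suc j) x\<bar> \<le> 2 * K\<^sup>2 / s * \<eta>} + (k + 2)"
proof -
  let ?T = "2 * K\<^sup>2 / s * \<eta>"
  have rng: "\<bar>x\<bar> \<le> A" if "x \<in> G" for x using G(2) that by (auto simp: abs_le_iff)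
  define nx where "nx x = Min {y \<in> G. x < y}" for x
  define pv where "pv x = Max {y \<in> G. y < x}" for x
  \<comment> \<open>The two extreme points of G have a neighbour on one side only and are given up;
    they account for the 2 in k + 2.\<close>
  define In where "In = {x \<in> G. ?T < \<bar>u (Suc j) x\<bar>} - {Min G, Max G}"
  have nx: "nx x \<in> G" "x < nx x" "\<And>y. y \<in> G \<Longrightarrow> x < y \<Longrightarrow> nx x \<le> y" if "x \<in> G" "x \<noteq> Max G" for x
  proof -
    have "x < Max G" using that(2) Max_ge[OF G(1) that(1)] by linarith
    moreover have "Max G \<in> G" using that G by (intro Max_in) auto
    ultimately have ne: "{y \<in> G. x < y} \<noteq> {}" by auto
    have fin: "finite {y \<in> G. x < y}" using G by simp
    from Min_in[OF fin ne] show "nx x \<in> G" "x < nx x" by (auto simp: nx_def)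
    show "\<And>y. y \<in> G \<Longrightarrow> x < y \<Longrightarrow> nx x \<le> y" using fin by (auto simp: nx_def)
  qed
  have pv: "pv x \<in> G" "pv x < x" "\<And>y. y \<in> G \<Longrightarrow> y < x \<Longrightarrow> y \<le> pv x" if "x \<in> G" "x \<noteq> Min G" for x
  proof -
    have "Min G < x" using that(2) Min_le[OF G(1) that(1)] by linarith
    moreover have "Min G \<in> G" using that G by (intro Min_in) auto
    ultimately have ne: "{y \<in> G. y < x} \<noteq> {}" by auto
    have fin: "finite {y \<in> G. y < x}" using G by simp
    from Max_in[OF fin ne] show "pv x \<in> G" "pv x < x" by (auto simp: pv_def)
    show "\<And>y. y \<in> G \<Longrightarrow> y < x \<Longrightarrow> y \<le> pv x" using fin by (auto simp: pv_def)
  qed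
  have "\<forall>x\<in>G - {Max G}. \<exists>z. x < z \<and> z < nx x \<and> \<bar>u (Suc j) z\<bar> \<le> ?T"
  proof
    fix x assume x: "x \<in> G - {Max G}"
    then have n: "nx x \<in> G" "x < nx x" using nx by auto
    show "\<exists>z. x < z \<and> z < nx x \<and> \<bar>u (Suc j) z\<bar> \<le> ?T"
      by (rule small_between) (use x n s rng sep small in auto)
  qed
  then obtain \<xi> where \<xi>: "\<And>x. x \<in> G - {Max G} \<Longrightarrow> x < \<xi> x \<and> \<xi> x < nx x \<and> \<bar>u (Suc j) (\<xi> x)\<bar> \<le> ?T"
    by metis
  have pvM: "pv x \<in> G - {Max G}" if "x \<in> In" for x
    using pv[of x] that G(1) Max_ge[of G x] by (fastforce simp: In_def)
  have \<xi>A: "\<bar>\<xi> x\<bar> \<le> A" if "x \<in> G - {Max G}" for x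
    using \<xi>[OF that] nx[of x] that rng[of x] rng[of "nx x"] by auto
  have nxpv: "nx (pv x) \<le> x" if "x \<in> In" for x
    using nx(3)[of "pv x" x] pvM[OF that] pv(2)[of x] that by (auto simp: In_def)
  have "\<forall>x\<in>In. \<exists>z. \<xi> (pv x) < z \<and> z < \<xi> x \<and> u (Suc (Suc j)) z = 0"
  proof
    fix x assume x: "x \<in> In"
    then have x1: "x \<in> G - {Max G}" by (auto simp: In_def)
    show "\<exists>z. \<xi> (pv x) < z \<and> z < \<xi> x \<and> u (Suc (Suc j)) z = 0"
    proof (rule zero_between[where x = x])
      show "\<xi> (pv x) < x" using \<xi>[OF pvM[OF x]] nxpv[OF x] by auto
      show "?T < \<bar>u (Suc j) x\<bar>" using x by (auto simp: In_def)
    qed (use \<xi>[OF pvM[OF x]] \<xi>[OF x1] \<xi>A[OF pvM[OF x]] \<xi>A[OF x1] in auto)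
  qed
  then obtain \<zeta> where \<zeta>: "\<And>x. x \<in> In \<Longrightarrow> \<xi> (pv x) < \<zeta> x \<and> \<zeta> x < \<xi> x \<and> u (Suc (Suc j)) (\<zeta> x) = 0"
    by metis
  \<comment> \<open>The intervals from \<open>\<xi> (pv x)\<close> to \<open>\<xi> x\<close> follow
    one another without overlap, so distinct large points yield distinct zeros.\<close>
  have mono: "\<zeta> x < \<zeta> y" if "x \<in> In" "y \<in> In" "x < y" for x y
  proof -
    have x1: "x \<in> G - {Max G}" "y \<in> G" "y \<noteq> Min G" using that by (auto simp: In_def)
    have le: "x \<le> pv y" using pv(3)[of y x] x1 that by auto
    have "\<xi> x \<le> \<xi> (pv y)"
    proof (cases "x = pv y")
      case False
      then have "nx x \<le> pv y" using nx(3)[of x "pv y"] x1 le pv(1)[of y] by auto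
      then show ?thesis using \<xi>[OF x1(1)] \<xi>[OF pvM[OF that(2)]] by auto
    qed simp
    then show ?thesis using \<zeta>[OF that(1)] \<zeta>[OF that(2)] by auto
  qed
  then have inj: "inj_on \<zeta> In" by (intro linorder_inj_onI) (auto dest: mono)
  have finIn: "finite In" using G by (simp add: In_def)
  have "card In = card (\<zeta> ` In)" using inj by (simp add: card_image)
  also have "\<dots> \<le> k"
  proof (rule zeros)
    show "\<zeta> ` In \<subseteq> {-A..A}"
    proof
      fix z assume "z \<in> \<zeta> ` In"
      then obtain x where x: "x \<in> In" "z = \<zeta> x" by auto
      then have "x \<in> G - {Max G}" by (auto simp: In_def)
      then show "z \<in> {-A..A}" using \<zeta>[OF x(1)] \<xi>A[OF pvM[OF x(1)]] \<xi>A[of x] x(2) by auto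
    qed
  qed (use \<zeta> finIn in auto)
  finally have cIn: "card In \<le> k" .
  have "G \<subseteq> {x \<in> G. \<bar>u (Suc j) x\<bar> \<le> ?T} \<union> (In \<union> {Min G, Max G})" by (auto simp: In_def)
  then have "card G \<le> card ({x \<in> G. \<bar>u (Suc j) x\<bar> \<le> ?T} \<union> (In \<union> {Min G, Max G}))"
    using G finIn by (intro card_mono) auto
  also have "\<dots> \<le> card {x \<in> G. \<bar>u (Suc j) x\<bar> \<le> ?T} + (card In + card {Min G, Max G})"
    by (meson card_Un_le order_trans add_left_mono)
  also have "card {Min G, Max G} \<le> 2" by (simp add: card_insert_if)
  finally show ?thesis using cIn by linarith
qed

text \<open>The survivors are points of G itself, never the intermediate points of the mean value
  theorem, so the separation s stays the same at all n levels. Each level loses at most k + 2 of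
  them.\<close>

lemma common_point:
  assumes G: "finite G" "G \<subseteq> {-A..A}" and s: "0 < s"
    and sep: "\<And>x y. x \<in> G \<Longrightarrow> y \<in> G \<Longrightarrow> x < y \<Longrightarrow> s \<le> y - x"
    and small: "\<And>x. x \<in> G \<Longrightarrow> \<bar>u 0 x\<bar> \<le> \<eta>"
    and zeros: "\<And>j Z. finite Z \<Longrightarrow> Z \<subseteq> {-A..A} \<Longrightarrow> (\<forall>z\<in>Z. u j z = 0) \<Longrightarrow> card Z \<le> k"
    and card: "(k + 2) * n < card G"
  shows "\<exists>y\<in>G. \<forall>j\<le>n. \<bar>u j y\<bar> \<le> (2 * K\<^sup>2 / s) ^ j * \<eta>"
proof -
  let ?G = "\<lambda>n. {x \<in> G. \<forall>j\<le>n. \<bar>u j x\<bar> \<le> (2 * K\<^sup>2 / s) ^ j * \<eta>}"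
  have "card G \<le> card (?G n) + (k + 2) * n"
  proof (induction n)
    case 0
    have "?G 0 = G" using small by auto
    then show ?case by simp
  next
    case (Suc n)
    have "card (?G n) \<le> card {x \<in> ?G n. \<bar>u (Suc n) x\<bar> \<le> 2 * K\<^sup>2 / s * ((2 * K\<^sup>2 / s) ^ n * \<eta>)} + (k + 2)"
      by (rule separated_step) (use G s sep zeros in auto)
    also have "{x \<in> ?G n. \<bar>u (Suc n) x\<bar> \<le> 2 * K\<^sup>2 / s * ((2 * K\<^sup>2 / s) ^ n * \<eta>)} = ?G (Suc n)"
      by (auto simp: le_Suc_eq mult.assoc)
    finally show ?case using Suc.IH by simp
  qed
  with card have "card (?G n) \<noteq> 0" by linarith
  then have "?G n \<noteq> {}" by (metis card.empty)
  then show ?thesis by blast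
qed

text \<open>Since sigma >= 1 and tau >= 1, smallness at the common point and the a priori bound both
  fit the form B' tau^j required by \<open>growth\<close>, with B' = sigma^n eta + B.\<close>

lemma remez_bound:
  assumes G: "finite G" "G \<subseteq> {-A..A}" and s: "0 < s" "s \<le> 1"
    and sep: "\<And>x y. x \<in> G \<Longrightarrow> y \<in> G \<Longrightarrow> x < y \<Longrightarrow> s \<le> y - x"
    and small: "\<And>x. x \<in> G \<Longrightarrow> \<bar>u 0 x\<bar> \<le> \<eta>"
    and zeros: "\<And>j Z. finite Z \<Longrightarrow> Z \<subseteq> {-A..A} \<Longrightarrow> (\<forall>z\<in>Z. u j z = 0) \<Longrightarrow> card Z \<le> k"
    and card: "(k + 2) * n < card G"
    and \<tau>: "1 \<le> \<tau>" and n: "even n" and B: "0 \<le> B"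
    and top: "\<And>x. \<bar>x\<bar> \<le> r \<Longrightarrow> \<bar>u n x\<bar> \<le> B * \<tau> ^ n"
    and x: "\<bar>x\<bar> \<le> r"
  shows "\<bar>u 0 x\<bar> \<le> ((2 * K\<^sup>2 / s) ^ n * \<eta> + B) * exp (\<tau> * K\<^sup>2 * (2 * r))"
proof -
  have "\<exists>y\<in>G. \<forall>j\<le>n. \<bar>u j y\<bar> \<le> (2 * K\<^sup>2 / s) ^ j * \<eta>"
    by (rule common_point[where k = k]) (fact G s(1) sep small zeros card)+
  then obtain y where y: "y \<in> G" "\<And>j. j \<le> n \<Longrightarrow> \<bar>u j y\<bar> \<le> (2 * K\<^sup>2 / s) ^ j * \<eta>"
    by blast
  have yA: "\<bar>y\<bar> \<le> A" using y(1) G(2) by (auto simp: abs_le_iff)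
  have \<eta>: "0 \<le> \<eta>" using small[OF y(1)] by linarith
  have \<sigma>: "1 \<le> 2 * K\<^sup>2 / s"
  proof -
    have "1 \<le> K\<^sup>2" using K_ge by simp
    then show ?thesis using s by (simp add: field_simps)
  qed
  let ?B = "(2 * K\<^sup>2 / s) ^ n * \<eta> + B"
  have B0: "0 \<le> ?B" using \<sigma> \<eta> B by (intro add_nonneg_nonneg mult_nonneg_nonneg zero_le_power) auto
  have "\<bar>u 0 x\<bar> \<le> ?B * exp (\<tau> * K\<^sup>2 * \<bar>x - y\<bar>)"
  proof (rule growth[OF yA B0 _ n _ _ x])
    fix j assume j: "j \<le> n"
    have "\<bar>u j y\<bar> \<le> (2 * K\<^sup>2 / s) ^ n * \<eta>"
      using y(2)[OF j] power_increasing[OF j \<sigma>] \<eta> by (meson mult_right_mono order_trans)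
    also have "\<dots> \<le> ?B * 1" using B by simp
    also have "\<dots> \<le> ?B * \<tau> ^ j" using B0 \<tau> by (intro mult_left_mono) auto
    finally show "\<bar>u j y\<bar> \<le> ?B * \<tau> ^ j" .
  next
    fix x assume "\<bar>x\<bar> \<le> r"
    then have "\<bar>u n x\<bar> \<le> B * \<tau> ^ n" by (rule top)
    also have "\<dots> \<le> ?B * \<tau> ^ n" using \<sigma> \<eta> \<tau> by (intro mult_right_mono) auto
    finally show "\<bar>u n x\<bar> \<le> ?B * \<tau> ^ n" .
  qed (use \<tau> in simp)
  also have "\<dots> \<le> ?B * exp (\<tau> * K\<^sup>2 * (2 * r))"
  proof -
    have "\<bar>x - y\<bar> \<le> 2 * r" using x yA A_le by auto
    then have "\<tau> * K\<^sup>2 * \<bar>x - y\<bar> \<le> \<tau> * K\<^sup>2 * (2 * r)" using \<tau> by (intro mult_left_mono) auto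
    then show ?thesis using B0 by (intro mult_left_mono) auto
  qed
  finally show ?thesis .
qed

end

section \<open>Positive solutions of the zero energy equation\<close>

text \<open>A primitive in the integral sense; its integrand need not be continuous.\<close>

definition primitive :: "(real \<Rightarrow> real) \<Rightarrow> (real \<Rightarrow> real) \<Rightarrow> bool" where
  "primitive F f \<longleftrightarrow> (\<forall>a b. a \<le> b \<longrightarrow> (f has_integral (F b - F a)) {a..b})"

definition locally_bounded :: "(real \<Rightarrow> real) \<Rightarrow> bool" where
  "locally_bounded f \<longleftrightarrow> (\<forall>r. \<exists>C. \<forall>x. \<bar>x\<bar> \<le> r \<longrightarrow> \<bar>f x\<bar> \<le> C)"

section \<open>Calculus of integral primitives\<close>

lemma primitiveD: "primitive F f \<Longrightarrow> a \<le> b \<Longrightarrow> (f has_integral (F b - F a)) {a..b}"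
  by (simp add: primitive_def)

lemma primitive_add: "primitive F f \<Longrightarrow> primitive G g \<Longrightarrow> primitive (\<lambda>x. F x + G x) (\<lambda>x. f x + g x)"
  unfolding primitive_def by (metis has_integral_add add_diff_add)

lemma primitive_cmult: "primitive F f \<Longrightarrow> primitive (\<lambda>x. c * F x) (\<lambda>x. c * f x)"
  unfolding primitive_def by (metis has_integral_mult_right right_diff_distrib)

lemma primitive_diff: "primitive F f \<Longrightarrow> primitive G g \<Longrightarrow> primitive (\<lambda>x. F x - G x) (\<lambda>x. f x - g x)"
  using primitive_add[OF _ primitive_cmult[of G g "-1"], of F f] by simp

lemma primitive_sum:
  "(\<And>i. i \<in> I \<Longrightarrow> primitive (F i) (f i)) \<Longrightarrow> primitive (\<lambda>x. \<Sum>i\<in>I. F i x) (\<lambda>x. \<Sum>i\<in>I. f i x)"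
  by (induction I rule: infinite_finite_induct) (auto simp: primitive_add, auto simp: primitive_def)

lemma primitive_deriv:
  assumes "\<And>x. (F has_real_derivative f x) (at x)"
  shows "primitive F f"
  unfolding primitive_def
proof (intro allI impI fundamental_theorem_of_calculus)
  fix a b x :: real
  show "(F has_vector_derivative f x) (at x within {a..b})"
    unfolding has_real_derivative_iff_has_vector_derivative[symmetric]
    by (rule has_field_derivative_at_within[OF assms])
qed

lemma primitive_continuous:
  assumes "primitive F f" shows "continuous_on UNIV F"
proof -
  have "isCont F x" for x
  proof -
    have "f integrable_on {x-1..x+1}" using primitiveD[OF assms, of "x-1" "x+1"] by (auto simp: integrable_on_def)
    then have "continuous_on {x-1..x+1} (\<lambda>t. F (x-1) + integral {x-1..t} f)"
      by (intro continuous_intros indefinite_integral_continuous_1)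
    moreover have "F (x-1) + integral {x-1..t} f = F t" if "t \<in> {x-1..x+1}" for t
      using integral_unique[OF primitiveD[OF assms, of "x-1" t]] that by auto
    ultimately have "continuous_on {x-1..x+1} F" using continuous_on_cong[OF refl] by (metis (no_types, lifting))
    then show "isCont F x" by (rule continuous_on_interior) (simp add: interior_atLeastAtMost_real)
  qed
  then show ?thesis by (simp add: continuous_on_eq_continuous_at)
qed

lemma primitive_DERIV:
  assumes "primitive F f" "continuous_on UNIV f" shows "(F has_real_derivative f x) (at x)"
proof -
  have "((\<lambda>t. F (x-1) + integral {x-1..t} f) has_real_derivative f x) (at x within {x-1..x+1})"
    using integral_has_real_derivative[of "x-1" "x+1" f x] continuous_on_subset[OF assms(2)]
    by (auto intro!: derivative_eq_intros)
  then have "(F has_real_derivative f x) (at x within {x-1..x+1})"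
    by (rule has_field_derivative_transform_within[OF _ zero_less_one])
       (use integral_unique[OF primitiveD[OF assms(1)]] in auto)
  moreover have "at x within {x-1..x+1} = at x"
    by (rule at_within_interior) (simp add: interior_atLeastAtMost_real)
  ultimately show ?thesis by simp
qed

lemma locally_bounded_continuous:
  assumes "continuous_on UNIV f" shows "locally_bounded f"
  unfolding locally_bounded_def
proof
  fix r :: real
  have "bounded (f ` {-r..r})"
    using assms by (intro compact_imp_bounded compact_continuous_image continuous_on_subset[OF assms]) auto
  then obtain C where "\<forall>y\<in>f ` {-r..r}. norm y \<le> C" by (auto simp: bounded_iff)
  then show "\<exists>C. \<forall>x. \<bar>x\<bar> \<le> r \<longrightarrow> \<bar>f x\<bar> \<le> C" by (auto simp: abs_le_iff intro!: exI[of _ C])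
qed

lemma locally_bounded_add: "locally_bounded f \<Longrightarrow> locally_bounded g \<Longrightarrow> locally_bounded (\<lambda>x. f x + g x)"
  unfolding locally_bounded_def by (meson abs_triangle_ineq add_mono order_trans)

lemma locally_bounded_mult:
  assumes "locally_bounded f" "locally_bounded g" shows "locally_bounded (\<lambda>x. f x * g x)"
  unfolding locally_bounded_def
proof
  fix r
  obtain C D where "\<forall>x. \<bar>x\<bar> \<le> r \<longrightarrow> \<bar>f x\<bar> \<le> C" "\<forall>x. \<bar>x\<bar> \<le> r \<longrightarrow> \<bar>g x\<bar> \<le> D"
    using assms unfolding locally_bounded_def by metis
  then have "\<forall>x. \<bar>x\<bar> \<le> r \<longrightarrow> \<bar>f x * g x\<bar> \<le> C * D"
    by (auto simp: abs_mult intro!: mult_mono intro: order_trans[OF abs_ge_zero])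
  then show "\<exists>C. \<forall>x. \<bar>x\<bar> \<le> r \<longrightarrow> \<bar>f x * g x\<bar> \<le> C" by blast
qed

lemma DERIV_zero_of_quadratic:
  fixes D :: "real \<Rightarrow> real"
  assumes "\<And>y. \<bar>y - x\<bar> \<le> 1 \<Longrightarrow> \<bar>D y - D x\<bar> \<le> C * (y - x)\<^sup>2"
  shows "(D has_real_derivative 0) (at x)"
  unfolding DERIV_def
proof (rule Lim_null_comparison)
  show "\<forall>\<^sub>F h in at 0. norm ((D (x + h) - D x) / h) \<le> C * \<bar>h\<bar>"
    unfolding eventually_at
  proof (intro exI[of _ 1] conjI ballI impI)
    fix h :: real assume h: "h \<noteq> 0 \<and> dist h 0 < 1"
    then have "\<bar>D (x + h) - D x\<bar> \<le> C * h\<^sup>2" using assms[of "x + h"] by simp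
    then have "\<bar>D (x + h) - D x\<bar> / \<bar>h\<bar> \<le> C * h\<^sup>2 / \<bar>h\<bar>" by (rule divide_right_mono) simp
    also have "\<dots> = C * \<bar>h\<bar>" using h by (simp add: power2_eq_square abs_if)
    finally show "norm ((D (x + h) - D x) / h) \<le> C * \<bar>h\<bar>" by simp
  qed simp
  show "((\<lambda>h. C * \<bar>h\<bar>) \<longlongrightarrow> 0) (at 0)" by (auto intro!: tendsto_eq_intros)
qed

text \<open>For x < 0 the set {0..x} is empty and its integral is 0, so negative x need a case of
  their own.\<close>

definition prim0 :: "(real \<Rightarrow> real) \<Rightarrow> real \<Rightarrow> real" where
  "prim0 f x = (if 0 \<le> x then integral {0..x} f else - integral {x..0} f)"

lemma primitive_prim0:
  assumes "\<And>a b. f integrable_on {a..b}"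
  shows "primitive (prim0 f) f"
  unfolding primitive_def
proof (intro allI impI)
  fix a b :: real assume ab: "a \<le> b"
  have neg: "prim0 f x = - integral {x..0} f" if "x \<le> 0" for x
    using that by (cases "x = 0") (simp_all add: prim0_def)
  have pos: "prim0 f x = integral {0..x} f" if "0 \<le> x" for x using that by (simp add: prim0_def)
  consider "0 \<le> a" | "b \<le> 0" | "a \<le> 0" "0 \<le> b" by linarith
  then have "integral {a..b} f = prim0 f b - prim0 f a"
  proof cases
    case 1
    then show ?thesis
      using Henstock_Kurzweil_Integration.integral_combine[where a = 0 and c = a and b = b and f = f] assms ab pos[of a] pos[of b] by simp
  next
    case 2
    then show ?thesis
      using Henstock_Kurzweil_Integration.integral_combine[where a = a and c = b and b = 0 and f = f] assms ab neg[of a] neg[of b] by simp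
  next
    case 3
    then show ?thesis
      using Henstock_Kurzweil_Integration.integral_combine[where a = a and c = 0 and b = b and f = f] assms neg[of a] pos[of b] by simp
  qed
  then show "(f has_integral prim0 f b - prim0 f a) {a..b}"
    using assms by (metis integrable_integral)
qed

lemma has_integral_bound_abs:
  fixes f :: "real \<Rightarrow> real"
  assumes "0 \<le> B" "a \<le> b" "(f has_integral i) {a..b}" "\<And>x. a \<le> x \<Longrightarrow> x \<le> b \<Longrightarrow> \<bar>f x\<bar> \<le> B"
  shows "\<bar>i\<bar> \<le> B * (b - a)"
  using has_integral_bound_real[of B "{}" f i a b] assms by simp

text \<open>Since the integrands are locally bounded, the difference of the two sides has increments of quadratic
  order, hence derivative zero; differentiation almost everywhere is not needed.\<close>

lemma primitive_mult:
  assumes F: "primitive F f" and G: "primitive G g" and bf: "locally_bounded f" and bg: "locally_bounded g"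
  shows "primitive (\<lambda>x. F x * G x) (\<lambda>x. f x * G x + F x * g x)"
proof -
  let ?h = "\<lambda>x. f x * G x + F x * g x"
  \<comment> \<open>A continuous factor does not preserve gauge integrability in general.
    Boundedness first gives absolute integrability, which bounded measurable factors do
    preserve.\<close>
  have ai: "f absolutely_integrable_on {a..b}" if Ff: "primitive F f" "locally_bounded f" for F f and a b :: real
  proof (cases "a \<le> b")
    case True
    obtain C where C: "\<And>x. \<bar>x\<bar> \<le> max \<bar>a\<bar> \<bar>b\<bar> \<Longrightarrow> \<bar>f x\<bar> \<le> C" using Ff(2) unfolding locally_bounded_def by metis
    show ?thesis
    proof (rule absolutely_integrable_integrable_bound[where g = "\<lambda>_. C"])
      show "f integrable_on {a..b}" using primitiveD[OF Ff(1) True] by (auto simp: integrable_on_def)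
    qed (use C in auto)
  qed auto
  have prod: "(\<lambda>x. f x * G x) integrable_on {a..b}" if "primitive F f" "locally_bounded f" "continuous_on UNIV G"
    for F f G and a b :: real
  proof -
    have "(\<lambda>x. G x * f x) absolutely_integrable_on {a..b}"
    proof (rule absolutely_integrable_bounded_measurable_product_real)
      show "G \<in> borel_measurable (lebesgue_on {a..b})"
        using that(3) by (intro continuous_imp_measurable_on_sets_lebesgue) (auto intro: continuous_on_subset)
      show "bounded (G ` {a..b})"
        using that(3) by (intro compact_imp_bounded compact_continuous_image) (auto intro: continuous_on_subset)
    qed (use ai[OF that(1,2)] in auto)
    then have "(\<lambda>x. G x * f x) integrable_on {a..b}" by (rule set_lebesgue_integral_eq_integral(1))
    moreover have "(\<lambda>x. G x * f x) = (\<lambda>x. f x * G x)" by (simp add: mult.commute fun_eq_iff)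
    ultimately show ?thesis by (simp only:)
  qed
  have cF: "continuous_on UNIV F" and cG: "continuous_on UNIV G" using F G by (auto intro: primitive_continuous)
  have hint: "?h integrable_on {a..b}" for a b
  proof -
    have "(\<lambda>x. f x * G x + g x * F x) integrable_on {a..b}"
      by (rule integrable_add[OF prod[OF F bf cG] prod[OF G bg cF]])
    moreover have "(\<lambda>x. f x * G x + g x * F x) = ?h" by (simp add: mult.commute fun_eq_iff)
    ultimately show ?thesis by (simp only:)
  qed
  let ?H = "prim0 ?h"
  have H: "primitive ?H ?h" by (rule primitive_prim0[OF hint])
  let ?D = "\<lambda>x. F x * G x - ?H x"
  have "(?D has_real_derivative 0) (at x)" for x
  proof -
    obtain Cf where Cf: "\<And>t. \<bar>t\<bar> \<le> \<bar>x\<bar> + 1 \<Longrightarrow> \<bar>f t\<bar> \<le> Cf" using bf unfolding locally_bounded_def by metis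
    obtain Cg where Cg: "\<And>t. \<bar>t\<bar> \<le> \<bar>x\<bar> + 1 \<Longrightarrow> \<bar>g t\<bar> \<le> Cg" using bg unfolding locally_bounded_def by metis
    have C0: "0 \<le> Cf" "0 \<le> Cg" using Cf[of 0] Cg[of 0] by auto
    have lip: "\<bar>F t - F s\<bar> \<le> C * \<bar>t - s\<bar>"
      if F: "primitive F f" and C: "\<And>t. \<bar>t\<bar> \<le> \<bar>x\<bar> + 1 \<Longrightarrow> \<bar>f t\<bar> \<le> C" "0 \<le> C"
        and s: "\<bar>s\<bar> \<le> \<bar>x\<bar> + 1" and t: "\<bar>t\<bar> \<le> \<bar>x\<bar> + 1" for F f C s t
    proof -
      have *: "\<bar>F t - F s\<bar> \<le> C * (t - s)" if "s \<le> t" "\<bar>s\<bar> \<le> \<bar>x\<bar> + 1" "\<bar>t\<bar> \<le> \<bar>x\<bar> + 1" for s t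
        by (rule has_integral_bound_abs[OF C(2) that(1) primitiveD[OF F that(1)] C(1)]) (use that in auto)
      show ?thesis using *[of s t] *[of t s] s t by (cases "s \<le> t") (auto simp: abs_minus_commute)
    qed
    have *: "\<bar>?D b - ?D a\<bar> \<le> (2 * Cf * Cg) * (b - a)\<^sup>2"
      if ab: "a \<le> b" "\<bar>a\<bar> \<le> \<bar>x\<bar> + 1" "\<bar>b\<bar> \<le> \<bar>x\<bar> + 1" for a b :: real
    proof -
      \<comment> \<open>With G frozen at b and F frozen at a, the integrand integrates exactly to
        the increment of F G. It differs from ?h by a term of order b - a, and integrating the
        difference gives the quadratic bound.\<close>
      have "((\<lambda>t. (f t * G b + F a * g t) - ?h t) has_integral
            ((F b - F a) * G b + F a * (G b - G a)) - (?H b - ?H a)) {a..b}"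
        by (intro has_integral_diff has_integral_add has_integral_mult_left has_integral_mult_right
            primitiveD[OF F] primitiveD[OF G] primitiveD[OF H] ab)
      moreover have "((F b - F a) * G b + F a * (G b - G a)) - (?H b - ?H a) = ?D b - ?D a"
        by (simp add: algebra_simps)
      ultimately have i: "((\<lambda>t. (f t * G b + F a * g t) - ?h t) has_integral ?D b - ?D a) {a..b}" by simp
      have "norm (?D b - ?D a) \<le> (2 * Cf * Cg * (b - a)) * (b - a)"
        unfolding real_norm_def
      proof (rule has_integral_bound_abs[OF _ ab(1) i])
        show "0 \<le> 2 * Cf * Cg * (b - a)" using C0 ab by simp
        fix t assume t: "a \<le> t" "t \<le> b"
        have tx: "\<bar>t\<bar> \<le> \<bar>x\<bar> + 1" using t ab by (auto simp: abs_le_iff)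
        have "\<bar>f t * G b + F a * g t - ?h t\<bar> = \<bar>f t * (G b - G t) + g t * (F a - F t)\<bar>"
          by (simp add: algebra_simps)
        also have "\<dots> \<le> \<bar>f t\<bar> * \<bar>G b - G t\<bar> + \<bar>g t\<bar> * \<bar>F a - F t\<bar>"
          by (metis abs_mult abs_triangle_ineq)
        also have "\<dots> \<le> Cf * (Cg * (b - a)) + Cg * (Cf * (b - a))"
        proof (intro add_mono mult_mono)
          show "\<bar>G b - G t\<bar> \<le> Cg * (b - a)"
            using lip[OF G Cg C0(2) tx ab(3)] t C0 mult_left_mono[of "b - t" "b - a" Cg] by auto
          show "\<bar>F a - F t\<bar> \<le> Cf * (b - a)"
            using lip[OF F Cf C0(1) tx ab(2)] t C0 mult_left_mono[of "t - a" "b - a" Cf] by auto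
        qed (use Cf Cg tx C0 ab in auto)
        finally show "\<bar>f t * G b + F a * g t - (f t * G t + F t * g t)\<bar> \<le> 2 * Cf * Cg * (b - a)" by (simp add: algebra_simps)
      qed
      then show ?thesis by (simp add: power2_eq_square mult.assoc)
    qed
    show ?thesis
    proof (rule DERIV_zero_of_quadratic)
      fix y assume y: "\<bar>y - x\<bar> \<le> 1"
      show "\<bar>?D y - ?D x\<bar> \<le> (2 * Cf * Cg) * (y - x)\<^sup>2"
      proof (cases "x \<le> y")
        case True
        then show ?thesis using y by (intro *) auto
      next
        case False
        then have "\<bar>?D x - ?D y\<bar> \<le> (2 * Cf * Cg) * (x - y)\<^sup>2" using y by (intro *) auto
        then show ?thesis by (simp add: abs_minus_commute power2_commute)
      qed
    qed
  qed
  then have const: "?D b = ?D a" for a b by (intro DERIV_isconst_all) auto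
  show ?thesis
    unfolding primitive_def
  proof (intro allI impI)
    fix a b :: real assume "a \<le> b"
    moreover have "F b * G b - F a * G a = ?H b - ?H a" using const[of b a] by simp
    ultimately show "(?h has_integral F b * G b - F a * G a) {a..b}" using primitiveD[OF H] by simp
  qed
qed

lemma primitive_locally_integrable: "primitive F f \<Longrightarrow> f integrable_on {a..b}"
  by (cases "a \<le> b") (auto simp: integrable_on_def dest: primitiveD)

lemma continuous_locally_integrable: "continuous_on UNIV f \<Longrightarrow> f integrable_on {a..b::real}" for f :: "real \<Rightarrow> real"
  by (rule integrable_continuous_real) (auto intro: continuous_on_subset)

lemma prim0_eq: "primitive F f \<Longrightarrow> prim0 f x = F x - F 0"
  using integral_unique[OF primitiveD[of F f 0 x]] integral_unique[OF primitiveD[of F f x 0]]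
  by (auto simp: prim0_def)

lemma prim0_mono:
  assumes f: "\<And>a b. f integrable_on {a..b}" and g: "\<And>a b. g integrable_on {a..b}"
    and le: "\<And>t. \<bar>t\<bar> \<le> r \<Longrightarrow> f t \<le> g t" and x: "\<bar>x\<bar> \<le> r"
  shows "0 \<le> x \<Longrightarrow> prim0 f x \<le> prim0 g x" "x \<le> 0 \<Longrightarrow> prim0 g x \<le> prim0 f x"
proof -
  show "prim0 f x \<le> prim0 g x" if "0 \<le> x"
    using that x by (auto simp: prim0_def intro!: integral_le f g le)
  show "prim0 g x \<le> prim0 f x" if "x \<le> 0"
  proof (cases "x = 0")
    case False
    then show ?thesis using that x by (auto simp: prim0_def intro!: integral_le f g le)
  qed (simp add: prim0_def)
qed

lemma prim0_continuous: "(\<And>a b. f integrable_on {a..b}) \<Longrightarrow> continuous_on UNIV (prim0 f)"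
  by (rule primitive_continuous[OF primitive_prim0])

lemma prim0_integrable: "(\<And>a b. f integrable_on {a..b}) \<Longrightarrow> prim0 f integrable_on {a..b}"
  by (rule continuous_locally_integrable[OF prim0_continuous])

text \<open>On the negative half-line each primitive reverses the inequality, and the two reversals
  cancel.\<close>

lemma prim0_prim0_mono:
  fixes f g :: "real \<Rightarrow> real"
  assumes f: "\<And>a b. f integrable_on {a..b}" and g: "\<And>a b. g integrable_on {a..b}"
    and le: "\<And>t. \<bar>t\<bar> \<le> r \<Longrightarrow> f t \<le> g t" and x: "\<bar>x\<bar> \<le> r"
  shows "prim0 (prim0 f) x \<le> prim0 (prim0 g) x"
proof (cases "0 \<le> x")
  case True
  have "prim0 f t \<le> prim0 g t" if "t \<in> {0..x}" for t
    by (rule prim0_mono(1)[where r = r]) (use f g le x True that in auto)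
  with True show ?thesis
    unfolding prim0_def[of "prim0 _"] by (auto intro!: integral_le prim0_integrable f g)
next
  case False
  have "prim0 g t \<le> prim0 f t" if "t \<in> {x..0}" for t
    by (rule prim0_mono(2)[where r = r]) (use f g le x False that in auto)
  with False show ?thesis
    unfolding prim0_def[of "prim0 _"] by (auto intro!: integral_le prim0_integrable f g)
qed

lemma prim0_tendsto:
  assumes f: "\<And>n a b. f n integrable_on {a..b}" and h: "\<And>n t. \<bar>t\<bar> \<le> \<bar>x\<bar> \<Longrightarrow> \<bar>f n t\<bar> \<le> (h::real)"
    and lim: "\<And>t. \<bar>t\<bar> \<le> \<bar>x\<bar> \<Longrightarrow> (\<lambda>n. f n t) \<longlonglongrightarrow> g t"
  shows "(\<lambda>n. prim0 (f n) x) \<longlonglongrightarrow> prim0 g x"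
proof (cases "0 \<le> x")
  case True
  have "(\<lambda>n. integral {0..x} (f n)) \<longlonglongrightarrow> integral {0..x} g"
    by (rule dominated_convergence(2)[where h = "\<lambda>_. h"]) (use f h lim True in auto)
  with True show ?thesis by (simp add: prim0_def)
next
  case False
  have "(\<lambda>n. integral {x..0} (f n)) \<longlonglongrightarrow> integral {x..0} g"
    by (rule dominated_convergence(2)[where h = "\<lambda>_. h"]) (use f h lim False in auto)
  with False show ?thesis by (auto simp: prim0_def intro: tendsto_minus)
qed

lemma prim0_bound:
  assumes f: "\<And>a b. f integrable_on {a..b}" and h: "\<And>t. \<bar>t\<bar> \<le> r \<Longrightarrow> \<bar>f t\<bar> \<le> h" and h0: "0 \<le> h" and x: "\<bar>x\<bar> \<le> r"
  shows "\<bar>prim0 f x\<bar> \<le> h * \<bar>x\<bar>"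
  using has_integral_bound_abs[OF h0 _ integrable_integral[OF f], of 0 x]
    has_integral_bound_abs[OF h0 _ integrable_integral[OF f], of x 0] h x
  by (auto simp: prim0_def)

lemma continuous_lebesgue_measurable:
  fixes f :: "real \<Rightarrow> real"
  assumes "continuous_on UNIV f" shows "f \<in> borel_measurable lebesgue"
  using borel_measurable_continuous_onI[OF assms] by (intro measurable_completion) simp

section \<open>Picard iteration for w'' = V w\<close>

locale potential =
  fixes V :: "real \<Rightarrow> real"
  assumes V_meas: "V \<in> borel_measurable lebesgue"
    and V_nonneg: "\<And>x. 0 \<le> V x"
    and V_bdd: "locally_bounded V"
begin

lemma V_mult_integrable:
  assumes "g \<in> borel_measurable lebesgue" "locally_bounded g"
  shows "(\<lambda>x. V x * g x) integrable_on {a..b}"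
proof -
  obtain C where C: "\<And>x. \<bar>x\<bar> \<le> max \<bar>a\<bar> \<bar>b\<bar> \<Longrightarrow> \<bar>V x * g x\<bar> \<le> C"
    using locally_bounded_mult[OF V_bdd assms(2)] unfolding locally_bounded_def by metis
  have m: "(\<lambda>x. V x * g x) \<in> borel_measurable lebesgue" using V_meas assms(1) by measurable
  have "(\<lambda>x. V x * g x) absolutely_integrable_on {a..b}"
  proof (rule measurable_bounded_by_integrable_imp_absolutely_integrable[where g = "\<lambda>_. C"])
    show "(\<lambda>x. V x * g x) \<in> borel_measurable (lebesgue_on {a..b})"
      by (rule measurable_restrict_space1[OF m])
  qed (use C in auto)
  then show ?thesis by (rule set_lebesgue_integral_eq_integral(1))
qed

lemma V_cont_integrable: "continuous_on UNIV g \<Longrightarrow> (\<lambda>x. V x * g x) integrable_on {a..b}"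
  by (intro V_mult_integrable locally_bounded_continuous continuous_lebesgue_measurable)

text \<open>Iterates of the integral equation equivalent to w'' = V w, w(0) = 1, w'(0) = 0. Since V
  is nonnegative they increase, so an upper bound gives convergence in place of a contraction
  argument.\<close>

primrec picard :: "nat \<Rightarrow> real \<Rightarrow> real" where
  "picard 0 = (\<lambda>_. 1)"
| "picard (Suc n) = (\<lambda>x. 1 + prim0 (prim0 (\<lambda>t. V t * picard n t)) x)"

lemma picard_continuous: "continuous_on UNIV (picard n)"
proof (induction n)
  case (Suc n)
  then have "continuous_on UNIV (prim0 (prim0 (\<lambda>t. V t * picard n t)))"
    by (intro prim0_continuous prim0_integrable V_cont_integrable)
  then show ?case by (simp add: continuous_on_add)
qed simp

lemma picard_incseq: "picard n x \<le> picard (Suc n) x"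
proof (induction n arbitrary: x)
  case 0
  have "prim0 (prim0 (\<lambda>t. 0)) x \<le> prim0 (prim0 (\<lambda>t. V t * picard 0 t)) x"
    by (rule prim0_prim0_mono[where r = "\<bar>x\<bar>"]) (use V_nonneg V_cont_integrable[OF picard_continuous[of 0]] in auto)
  moreover have "prim0 (\<lambda>t. 0) = (\<lambda>_. 0)" by (simp add: prim0_def fun_eq_iff)
  ultimately show ?case by simp
next
  case (Suc n)
  have "prim0 (prim0 (\<lambda>t. V t * picard n t)) x \<le> prim0 (prim0 (\<lambda>t. V t * picard (Suc n) t)) x"
    by (rule prim0_prim0_mono[where r = "\<bar>x\<bar>"])
       (use V_nonneg Suc V_cont_integrable[OF picard_continuous] in \<open>auto simp del: picard.simps intro!: mult_left_mono\<close>)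
  then show ?case by (simp only: picard.simps)
qed

lemma picard_ge: "1 \<le> picard n x"
  by (induction n) (use picard_incseq order_trans in \<open>auto simp del: picard.simps(2)\<close>, blast)

text \<open>cosh(M x) solves the same integral equation with M^2 in place of V, so the comparison
  passes from one iterate to the next.\<close>

lemma picard_le_cosh:
  assumes V: "\<And>t. \<bar>t\<bar> \<le> r \<Longrightarrow> V t \<le> M\<^sup>2" and x: "\<bar>x\<bar> \<le> r"
  shows "picard n x \<le> cosh (M * x)"
  using x
proof (induction n arbitrary: x)
  case 0
  then show ?case using cosh_real_ge_1 by simp
next
  case (Suc n)
  have 1: "primitive (\<lambda>x. M * sinh (M * x)) (\<lambda>x. M\<^sup>2 * cosh (M * x))"
    by (rule primitive_deriv) (auto intro!: derivative_eq_intros simp: power2_eq_square)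
  have 2: "primitive (\<lambda>x. cosh (M * x)) (\<lambda>x. M * sinh (M * x))"
    by (rule primitive_deriv) (auto intro!: derivative_eq_intros)
  have "prim0 (prim0 (\<lambda>t. V t * picard n t)) x \<le> prim0 (prim0 (\<lambda>t. M\<^sup>2 * cosh (M * t))) x"
  proof (rule prim0_prim0_mono[where r = r])
    show "V t * picard n t \<le> M\<^sup>2 * cosh (M * t)" if "\<bar>t\<bar> \<le> r" for t
      using V[OF that] Suc.IH[OF that] V_nonneg order_trans[OF zero_le_one picard_ge[of n t]]
      by (intro mult_mono) auto
  qed (use Suc.prems primitive_locally_integrable[OF 1] V_cont_integrable[OF picard_continuous] in auto)
  also have "prim0 (\<lambda>t. M\<^sup>2 * cosh (M * t)) = (\<lambda>x. M * sinh (M * x))"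
    using prim0_eq[OF 1] by (auto simp: fun_eq_iff)
  also have "prim0 (\<lambda>x. M * sinh (M * x)) x = cosh (M * x) - 1" using prim0_eq[OF 2] by simp
  finally show ?case by simp
qed

lemma V_le_square: "\<exists>M\<ge>0. \<forall>t. \<bar>t\<bar> \<le> r \<longrightarrow> V t \<le> M\<^sup>2"
proof -
  obtain C where C: "\<And>t. \<bar>t\<bar> \<le> r \<Longrightarrow> \<bar>V t\<bar> \<le> C" using V_bdd unfolding locally_bounded_def by metis
  have "V t \<le> (sqrt \<bar>C\<bar>)\<^sup>2" if "\<bar>t\<bar> \<le> r" for t using C[OF that] by simp
  then show ?thesis by (intro exI[of _ "sqrt \<bar>C\<bar>"]) auto
qed

text \<open>The derivative of w is the integral of V w from 0, hence has the sign of x; this gives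
  the monotonicity on each half-line that becomes \<open>w_segment\<close>. The cosh bound is stated
  for all M and r because it is used at two scales: on the fixed interval for K and on [-r,r] for
  exp(M r).\<close>

theorem positive_solution:
  "\<exists>w w1. (\<forall>x. (w has_real_derivative w1 x) (at x)) \<and> primitive w1 (\<lambda>x. V x * w x) \<and> (\<forall>x. 1 \<le> w x) \<and>
     (\<forall>s t. \<bar>s\<bar> \<le> \<bar>t\<bar> \<longrightarrow> 0 \<le> s * t \<longrightarrow> w s \<le> w t) \<and>
     (\<forall>M r x. (\<forall>t. \<bar>t\<bar> \<le> r \<longrightarrow> V t \<le> M\<^sup>2) \<longrightarrow> \<bar>x\<bar> \<le> r \<longrightarrow> w x \<le> cosh (M * x))"
proof -
  have "\<exists>L. (\<lambda>n. picard n x) \<longlonglongrightarrow> L" for x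
  proof -
    obtain M where M: "\<And>t. \<bar>t\<bar> \<le> \<bar>x\<bar> \<Longrightarrow> V t \<le> M\<^sup>2" using V_le_square by metis
    have "incseq (\<lambda>n. picard n x)" by (rule incseq_SucI) (rule picard_incseq)
    moreover have "\<forall>n. picard n x \<le> cosh (M * x)" using picard_le_cosh[of "\<bar>x\<bar>" M x, OF M] by simp
    ultimately obtain L where "(\<lambda>n. picard n x) \<longlonglongrightarrow> L" by (rule incseq_convergent)
    then show ?thesis by blast
  qed
  then obtain w where w: "\<And>x. (\<lambda>n. picard n x) \<longlonglongrightarrow> w x" by metis
  have le: "w x \<le> cosh (M * x)" if "\<forall>t. \<bar>t\<bar> \<le> r \<longrightarrow> V t \<le> M\<^sup>2" "\<bar>x\<bar> \<le> r" for M r x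
    by (rule LIMSEQ_le_const2[OF w]) (use picard_le_cosh[of r M x] that in blast)
  have ge: "1 \<le> w x" for x by (rule LIMSEQ_le_const[OF w]) (use picard_ge in blast)
  have bnd: "\<exists>h\<ge>0. \<forall>n t. \<bar>t\<bar> \<le> r \<longrightarrow> \<bar>V t * picard n t\<bar> \<le> h" for r
  proof -
    obtain M where M: "\<And>t. \<bar>t\<bar> \<le> r \<Longrightarrow> V t \<le> M\<^sup>2" "0 \<le> M" using V_le_square by metis
    have "\<bar>V t * picard n t\<bar> \<le> M\<^sup>2 * cosh (M * r)" if t: "\<bar>t\<bar> \<le> r" for n t
    proof -
      have "picard n t \<le> cosh (M * t)" using picard_le_cosh[OF M(1) t] .
      also have "\<dots> = cosh (M * \<bar>t\<bar>)" by (simp add: abs_if)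
      also have "\<dots> \<le> cosh (M * r)" using t M(2) by (subst cosh_real_nonneg_le_iff) (auto intro: mult_left_mono mult_nonneg_nonneg)
      finally have "picard n t \<le> cosh (M * r)" .
      then have "V t * picard n t \<le> M\<^sup>2 * cosh (M * r)"
        using M(1)[OF t] V_nonneg[of t] order_trans[OF zero_le_one picard_ge[of n t]] by (intro mult_mono) auto
      moreover have "0 \<le> V t * picard n t" using V_nonneg[of t] order_trans[OF zero_le_one picard_ge[of n t]] by auto
      ultimately show ?thesis by simp
    qed
    then show ?thesis by (intro exI[of _ "M\<^sup>2 * cosh (M * r)"]) auto
  qed
  have lb: "locally_bounded w"
    unfolding locally_bounded_def
  proof
    fix r
    obtain M where M: "\<And>t. \<bar>t\<bar> \<le> r \<Longrightarrow> V t \<le> M\<^sup>2" "0 \<le> M" using V_le_square by metis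
    have "\<bar>w x\<bar> \<le> cosh (M * r)" if x: "\<bar>x\<bar> \<le> r" for x
    proof -
      have "w x \<le> cosh (M * x)" using le M(1) x by blast
      also have "\<dots> = cosh (M * \<bar>x\<bar>)" by (simp add: abs_if)
      also have "\<dots> \<le> cosh (M * r)" using x M(2) by (subst cosh_real_nonneg_le_iff) (auto intro: mult_left_mono mult_nonneg_nonneg)
      finally show ?thesis using ge[of x] by simp
    qed
    then show "\<exists>C. \<forall>x. \<bar>x\<bar> \<le> r \<longrightarrow> \<bar>w x\<bar> \<le> C" by blast
  qed
  have "w \<in> borel_measurable lebesgue"
    by (rule borel_measurable_LIMSEQ_real[OF w])
       (rule continuous_lebesgue_measurable[OF picard_continuous])
  then have int: "(\<lambda>t. V t * w t) integrable_on {a..b}" for a b by (rule V_mult_integrable[OF _ lb])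
  let ?w1 = "prim0 (\<lambda>t. V t * w t)"
  have int1: "(\<lambda>t. V t * picard n t) integrable_on {a..b}" for n a b
    by (rule V_cont_integrable[OF picard_continuous])
  have lim1: "(\<lambda>n. prim0 (\<lambda>t. V t * picard n t) x) \<longlonglongrightarrow> ?w1 x" for x
  proof -
    obtain h where h: "\<And>n t. \<bar>t\<bar> \<le> \<bar>x\<bar> \<Longrightarrow> \<bar>V t * picard n t\<bar> \<le> h" using bnd by metis
    show ?thesis by (rule prim0_tendsto[OF int1 h]) (auto intro!: tendsto_mult w)
  qed
  have lim2: "(\<lambda>n. prim0 (prim0 (\<lambda>t. V t * picard n t)) x) \<longlonglongrightarrow> prim0 ?w1 x" for x
  proof -
    obtain h where h: "0 \<le> h" "\<And>n t. \<bar>t\<bar> \<le> \<bar>x\<bar> \<Longrightarrow> \<bar>V t * picard n t\<bar> \<le> h" using bnd by metis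
    have "\<bar>prim0 (\<lambda>t. V t * picard n t) t\<bar> \<le> h * \<bar>x\<bar>" if t: "\<bar>t\<bar> \<le> \<bar>x\<bar>" for n t
    proof -
      have "\<bar>prim0 (\<lambda>t. V t * picard n t) t\<bar> \<le> h * \<bar>t\<bar>" by (rule prim0_bound[OF int1 h(2) h(1) t])
      also have "\<dots> \<le> h * \<bar>x\<bar>" using t h by (intro mult_left_mono) auto
      finally show ?thesis .
    qed
    then show ?thesis by (rule prim0_tendsto[OF prim0_integrable[OF int1]]) (auto intro!: lim1)
  qed
  have eq: "w x = 1 + prim0 ?w1 x" for x
  proof (rule LIMSEQ_unique)
    show "(\<lambda>n. picard (Suc n) x) \<longlonglongrightarrow> w x" using w by (rule LIMSEQ_Suc)
    show "(\<lambda>n. picard (Suc n) x) \<longlonglongrightarrow> 1 + prim0 ?w1 x"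
      by (simp only: picard.simps) (intro tendsto_intros lim2)
  qed
  have d: "(w has_real_derivative ?w1 x) (at x)" for x
  proof -
    have c: "continuous_on UNIV ?w1" by (rule prim0_continuous[OF int])
    have "(prim0 ?w1 has_real_derivative ?w1 x) (at x)"
      by (rule primitive_DERIV[OF primitive_prim0[OF continuous_locally_integrable[OF c]] c])
    then have "((\<lambda>x. 1 + prim0 ?w1 x) has_real_derivative ?w1 x) (at x)" by (auto intro!: derivative_eq_intros)
    moreover have "(\<lambda>x. 1 + prim0 ?w1 x) = w" by (rule ext) (rule eq[symmetric])
    ultimately show ?thesis by (simp only:)
  qed
  have pos: "0 \<le> V t * w t" for t using V_nonneg[of t] order_trans[OF zero_le_one ge[of t]] by auto
  have w1p: "0 \<le> ?w1 x" if "0 \<le> x" for x using integral_nonneg[OF int pos, of 0 x] that by (simp add: prim0_def)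
  have w1n: "?w1 x \<le> 0" if "x \<le> 0" for x
  proof (cases "x = 0")
    case False
    have "0 \<le> integral {x..0} (\<lambda>t. V t * w t)" by (rule integral_nonneg[OF int]) (rule pos)
    with False that show ?thesis by (simp add: prim0_def)
  qed (simp add: prim0_def)
  have mono: "w s \<le> w t" if "\<bar>s\<bar> \<le> \<bar>t\<bar>" "0 \<le> s * t" for s t
  proof (cases "0 \<le> t \<and> 0 \<le> s")
    case True
    then have st: "0 \<le> s" "s \<le> t" using that(1) by auto
    show ?thesis
    proof (rule DERIV_nonneg_imp_nondecreasing[OF st(2)])
      fix x assume "s \<le> x"
      then show "\<exists>y. (w has_real_derivative y) (at x) \<and> 0 \<le> y" using d w1p[of x] st by (intro exI[of _ "?w1 x"]) simp
    qed
  next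
    case False
    then have "s \<le> 0" "t \<le> 0" using that by (auto simp: zero_le_mult_iff)
    then have st: "s \<le> 0" "t \<le> s" using that(1) by auto
    show ?thesis
    proof (rule DERIV_nonpos_imp_nonincreasing[OF st(2)])
      fix x assume "x \<le> s"
      then show "\<exists>y. (w has_real_derivative y) (at x) \<and> y \<le> 0" using d w1n[of x] st by (intro exI[of _ "?w1 x"]) simp
    qed
  qed
  have "primitive ?w1 (\<lambda>x. V x * w x)" by (rule primitive_prim0[OF int])
  with d ge mono le show ?thesis by blast
qed

text \<open>The derivative of p/w is the Wronskian divided by w^2. In the derivative of the
  Wronskian the terms with V cancel, leaving the continuous function p_(i+1) w. So the Wronskian is
  differentiable everywhere, although p1 and w1 need not be.\<close>

lemma chain_deriv:
  assumes dw: "\<And>x. (w has_real_derivative w1 x) (at x)" and pw: "primitive w1 (\<lambda>x. V x * w x)"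
    and w_ge: "\<And>x. 1 \<le> w x"
    and dp: "\<And>j x. (p j has_real_derivative p1 j x) (at x)"
    and pp: "\<And>j. primitive (p1 j) (\<lambda>x. V x * p j x + p (Suc j) x)"
    and u: "u = (\<lambda>j x. if even j then p (j div 2) x / w x else p1 (j div 2) x * w x - p (j div 2) x * w1 x)"
  shows "(u j has_real_derivative (if even j then 1 / (w x)\<^sup>2 else (w x)\<^sup>2) * u (Suc j) x) (at x)"
proof (cases "even j")
  case True
  define i where "i = j div 2"
  have "w x \<noteq> 0" using w_ge[of x] by simp
  then have "((\<lambda>x. p i x / w x) has_real_derivative (p1 i x * w x - p i x * w1 x) / (w x * w x)) (at x)"
    by (intro DERIV_divide dp dw)
  moreover have "Suc j div 2 = i" using True by (auto simp: i_def)
  ultimately show ?thesis using True by (simp add: u i_def power2_eq_square)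
next
  case False
  define i where "i = j div 2"
  have wx: "w x \<noteq> 0" using w_ge[of x] by simp
  have cw: "continuous_on UNIV w" and cp: "continuous_on UNIV (p i)" for i
    using dw dp by (auto intro: DERIV_continuous_on has_field_derivative_at_within)
  have cw1: "continuous_on UNIV w1" and cp1: "continuous_on UNIV (p1 i)" for i
    using primitive_continuous[OF pw] primitive_continuous[OF pp] by auto
  note lb = locally_bounded_continuous
  have lbw: "locally_bounded (\<lambda>x. V x * w x)" by (intro locally_bounded_mult V_bdd lb cw)
  have lbp: "locally_bounded (\<lambda>x. V x * p i x + p (Suc i) x)"
    by (intro locally_bounded_add locally_bounded_mult V_bdd lb cp)
  have 1: "primitive (\<lambda>x. p1 i x * w x) (\<lambda>x. (V x * p i x + p (Suc i) x) * w x + p1 i x * w1 x)"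
    by (intro primitive_mult pp primitive_deriv dw lbp lb cw1)
  have 2: "primitive (\<lambda>x. p i x * w1 x) (\<lambda>x. p1 i x * w1 x + p i x * (V x * w x))"
    by (intro primitive_mult pw primitive_deriv dp lbw lb cp1)
  have "primitive (\<lambda>x. p1 i x * w x - p i x * w1 x) (\<lambda>x. p (Suc i) x * w x)"
    using primitive_diff[OF 1 2] by (simp add: algebra_simps)
  then have "((\<lambda>x. p1 i x * w x - p i x * w1 x) has_real_derivative p (Suc i) x * w x) (at x)"
    by (rule primitive_DERIV) (intro continuous_intros cp cw)
  moreover have "Suc j div 2 = Suc i" using False by (auto simp: i_def elim: oddE)
  moreover have "(w x)\<^sup>2 * (p (Suc i) x / w x) = p (Suc i) x * w x"
    using wx by (simp add: power2_eq_square)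
  ultimately show ?thesis using False by (simp add: u i_def)
qed

end

section \<open>Eigenfunctions in the energy space\<close>

lemma integrable_lebesgue_reflect:
  fixes f :: "real \<Rightarrow> real"
  assumes "integrable lebesgue f" shows "integrable lebesgue (\<lambda>x. f (- x))"
  using has_absolute_integral_reflect_real[of UNIV UNIV f "integral UNIV f"] assms
  by (auto simp: absolutely_integrable_on_def set_integrable_def)

lemma has_integral_le_lebesgue:
  fixes h :: "real \<Rightarrow> real"
  assumes "integrable lebesgue h" "\<And>x. 0 \<le> h x" "(h has_integral i) {a..b}"
  shows "i \<le> (LINT x|lebesgue. h x)"
  by (rule has_integral_subset_le[OF subset_UNIV assms(3) has_integral_integral_lebesgue[OF assms(1)]])
    (use assms in auto)

lemma integrable_not_bounded_below:
  fixes h :: "real \<Rightarrow> real"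
  assumes "integrable lebesgue h" "0 < c" "\<And>x. R \<le> x \<Longrightarrow> c \<le> \<bar>h x\<bar>"
  shows False
proof -
  let ?I = "LINT x|lebesgue. \<bar>h x\<bar>"
  have ih: "integrable lebesgue (\<lambda>x. \<bar>h x\<bar>)" using assms(1) by simp
  have "c * real n \<le> ?I" for n
  proof -
    have i: "(\<lambda>x. \<bar>h x\<bar>) integrable_on {R..R + real n}"
      using ih by (metis has_integral_integral_lebesgue has_integral_integrable integrable_on_subinterval subset_UNIV)
    have "c * real n = integral {R..R + real n} (\<lambda>_. c)" by simp
    also have "\<dots> \<le> integral {R..R + real n} (\<lambda>x. \<bar>h x\<bar>)" using i assms(3) by (intro integral_le) auto
    also have "\<dots> \<le> ?I" by (rule has_integral_le_lebesgue[OF ih _ integrable_integral[OF i]]) simp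
    finally show ?thesis .
  qed
  moreover obtain n where "?I / c < real n" using reals_Archimedean2 by blast
  ultimately show False using assms(2) by (smt (verit) mult.commute pos_divide_less_eq)
qed

lemma integral_symmetric_tendsto:
  fixes h :: "real \<Rightarrow> real"
  assumes "integrable lebesgue h"
  shows "((\<lambda>r. integral {-r..r} h) \<longlongrightarrow> (LINT x|lebesgue. h x)) at_top"
proof -
  have "((\<lambda>r. LINT x|lebesgue. indicator {-r..r} x * h x) \<longlongrightarrow> (LINT x|lebesgue. h x)) at_top"
  proof (rule integral_dominated_convergence_at_top[where w = "\<lambda>x. \<bar>h x\<bar>"])
    show "AE x in lebesgue. ((\<lambda>r. indicator {-r..r} x * h x) \<longlongrightarrow> h x) at_top"
    proof (rule AE_I2)
      fix x :: real
      have "\<forall>\<^sub>F r in at_top. indicator {-r..r} x * h x = h x"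
        using eventually_ge_at_top[of "\<bar>x\<bar>"] by eventually_elim (auto simp: abs_le_iff)
      then show "((\<lambda>r. indicator {-r..r} x * h x) \<longlongrightarrow> h x) at_top" by (rule tendsto_eventually)
    qed
    show "\<forall>\<^sub>F r in at_top. AE x in lebesgue. norm (indicator {-r..r} x * h x) \<le> \<bar>h x\<bar>"
      by (intro always_eventually allI AE_I2) (auto simp: indicator_def)
    show "h \<in> borel_measurable lebesgue" using assms by auto
    show "(\<lambda>x. indicator {-r..r} x * h x) \<in> borel_measurable lebesgue" for r :: real
      using assms by (auto intro!: borel_measurable_times borel_measurable_indicator)
  qed (use assms in auto)
  moreover have "(LINT x|lebesgue. indicator {-r..r} x * h x) = integral {-r..r} h" for r
  proof -
    have "set_integrable lebesgue {-r..r} h"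
      using assms integrable_mult_indicator[of "{-r..r}" lebesgue h] by (simp add: set_integrable_def)
    from set_lebesgue_integral_eq_integral(2)[OF this] show ?thesis by (simp add: set_lebesgue_integral_def)
  qed
  ultimately show ?thesis by simp
qed

text \<open>Integration by parts on the line, where integrability of F stands in for decay at
  infinity: if the integral were nonzero, F(r) - F(-r) would stay away from 0 for all large r,
  against integrability.\<close>

lemma primitive_integrable_zero:
  assumes F: "primitive F h" and iF: "integrable lebesgue F" and ih: "integrable lebesgue h"
  shows "(LINT x|lebesgue. h x) = 0"
proof (rule ccontr)
  let ?L = "LINT x|lebesgue. h x"
  assume L: "?L \<noteq> 0"
  have "\<forall>\<^sub>F r in at_top. dist (integral {-r..r} h) ?L < \<bar>?L\<bar> / 2"
    using integral_symmetric_tendsto[OF ih] L by (intro tendstoD) auto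
  then obtain R where R: "\<And>r. R \<le> r \<Longrightarrow> dist (integral {-r..r} h) ?L < \<bar>?L\<bar> / 2"
    by (auto simp: eventually_at_top_linorder)
  let ?g = "\<lambda>r. \<bar>F r\<bar> + \<bar>F (- r)\<bar>"
  have "integrable lebesgue ?g" using iF integrable_lebesgue_reflect[OF iF] by auto
  moreover have "0 < \<bar>?L\<bar> / 2" using L by simp
  moreover have "\<bar>?L\<bar> / 2 \<le> \<bar>?g r\<bar>" if "max R 0 \<le> r" for r
  proof -
    have "integral {-r..r} h = F r - F (- r)" using that by (intro integral_unique primitiveD[OF F]) auto
    then show ?thesis using R[of r] that by (auto simp: dist_real_def abs_if split: if_splits)
  qed
  ultimately show False by (rule integrable_not_bounded_below)
qed

lemma integrable_nonneg_bounded_integrals: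
  fixes h :: "real \<Rightarrow> real"
  assumes h: "\<And>a b. h integrable_on {a..b}" and h0: "\<And>x. 0 \<le> h x" and B: "\<And>r. integral {-r..r} h \<le> B"
  shows "integrable lebesgue h"
proof -
  let ?f = "\<lambda>k::nat. \<lambda>x. if x \<in> {-real k..real k} then h x else 0"
  have fi: "(?f k has_integral integral {-real k..real k} h) UNIV" for k
    using integrable_integral[OF h] by (simp only: has_integral_restrict_UNIV)
  have "h integrable_on UNIV \<and> (\<lambda>k. integral UNIV (?f k)) \<longlonglongrightarrow> integral UNIV h"
  proof (rule monotone_convergence_increasing)
    show "?f k integrable_on UNIV" for k using fi by (auto simp: integrable_on_def)
    show "?f k x \<le> ?f (Suc k) x" for k x using h0 by auto
    show "(\<lambda>k. ?f k x) \<longlonglongrightarrow> h x" for x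
    proof (rule tendsto_eventually)
      obtain n where "\<bar>x\<bar> \<le> real n" using real_arch_simple by blast
      then show "\<forall>\<^sub>F k in sequentially. ?f k x = h x"
        unfolding eventually_sequentially by (intro exI[of _ n]) (auto simp: abs_le_iff)
    qed
    have "0 \<le> integral {-real k..real k} h" for k using h0 h by (intro integral_nonneg) auto
    then show "bounded (range (\<lambda>k. integral UNIV (?f k)))"
      using B integral_unique[OF fi] by (auto simp: bounded_iff intro!: exI[of _ B])
  qed
  then have "h absolutely_integrable_on UNIV" using h0 by (intro nonnegative_absolutely_integrable_1) auto
  then show ?thesis by (simp add: set_integrable_def)
qed

lemma integrable_product:
  fixes f g :: "real \<Rightarrow> real"
  assumes "f \<in> borel_measurable lebesgue" "g \<in> borel_measurable lebesgue"
    "integrable lebesgue (\<lambda>x. (f x)\<^sup>2)" "integrable lebesgue (\<lambda>x. (g x)\<^sup>2)"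
  shows "integrable lebesgue (\<lambda>x. f x * g x)"
proof (rule Bochner_Integration.integrable_bound)
  show "integrable lebesgue (\<lambda>x. (f x)\<^sup>2 + (g x)\<^sup>2)" using assms by auto
  show "AE x in lebesgue. norm (f x * g x) \<le> norm ((f x)\<^sup>2 + (g x)\<^sup>2)"
  proof (rule AE_I2)
    fix x
    have "0 \<le> (\<bar>f x\<bar> - \<bar>g x\<bar>)\<^sup>2" by simp
    then have "2 * (\<bar>f x\<bar> * \<bar>g x\<bar>) \<le> (f x)\<^sup>2 + (g x)\<^sup>2" by (simp add: power2_diff)
    moreover have "0 \<le> \<bar>f x\<bar> * \<bar>g x\<bar>" by simp
    ultimately have "\<bar>f x\<bar> * \<bar>g x\<bar> \<le> (f x)\<^sup>2 + (g x)\<^sup>2" by linarith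
    then show "norm (f x * g x) \<le> norm ((f x)\<^sup>2 + (g x)\<^sup>2)" by (simp add: abs_mult)
  qed
qed (use assms in measurable)

section \<open>Real eigenfunctions and the energy form\<close>

context potential
begin

definition eig :: "real \<Rightarrow> (real \<Rightarrow> real) \<Rightarrow> (real \<Rightarrow> real) \<Rightarrow> bool" where
  "eig \<mu> v v1 \<longleftrightarrow> (\<forall>x. (v has_real_derivative v1 x) (at x)) \<and>
     primitive v1 (\<lambda>x. V x * v x - \<mu> * v x) \<and> integrable lebesgue (\<lambda>x. (v x)\<^sup>2)"

lemma eig_cont:
  assumes "eig \<mu> v v1" shows "continuous_on UNIV v" "continuous_on UNIV v1"
  using assms primitive_continuous unfolding eig_def
  by (auto intro: DERIV_continuous_on has_field_derivative_at_within)

lemma eig_meas: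
  assumes "eig \<mu> v v1" shows "v \<in> borel_measurable lebesgue" "v1 \<in> borel_measurable lebesgue"
  using eig_cont[OF assms] by (auto intro: continuous_lebesgue_measurable)

text \<open>Finite energy has to be derived from square integrability of v. The energy over [-r,r]
  is \<open>\<mu>\<close> times the mass there plus the boundary term of v v', and this boundary
  term is half the derivative of v(r)^2 + v(-r)^2, which is integrable in r.\<close>

lemma eig_energy_integrable:
  assumes e: "eig \<mu> v v1"
  shows "integrable lebesgue (\<lambda>x. (v1 x)\<^sup>2)" "integrable lebesgue (\<lambda>x. V x * (v x)\<^sup>2)"
proof -
  have d: "\<And>x. (v has_real_derivative v1 x) (at x)" and p: "primitive v1 (\<lambda>x. V x * v x - \<mu> * v x)"
    and i: "integrable lebesgue (\<lambda>x. (v x)\<^sup>2)" using e by (auto simp: eig_def)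
  note c = eig_cont[OF e]
  let ?N = "LINT x|lebesgue. (v x)\<^sup>2"
  let ?g = "\<lambda>x. (v1 x)\<^sup>2 + V x * (v x)\<^sup>2"
  have N0: "0 \<le> ?N" by simp
  have cc: "continuous_on UNIV (\<lambda>x. (v1 x)\<^sup>2)" "continuous_on UNIV (\<lambda>x. (v x)\<^sup>2)"
    using c by (auto intro: continuous_on_power)
  have gi: "?g integrable_on {a..b}" for a b
    by (intro integrable_add continuous_locally_integrable cc V_cont_integrable)
  have g0: "0 \<le> ?g x" for x using V_nonneg by simp
  have lb: "locally_bounded (\<lambda>x. V x * v x + (- \<mu>) * v x)"
    by (intro locally_bounded_add locally_bounded_mult V_bdd locally_bounded_continuous c continuous_on_const)
  have "primitive (\<lambda>x. v x * v1 x) (\<lambda>x. v1 x * v1 x + v x * (V x * v x - \<mu> * v x))"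
    by (rule primitive_mult[OF primitive_deriv[OF d] p])
       (use lb locally_bounded_continuous[OF c(2)] in auto)
  then have P: "primitive (\<lambda>x. v x * v1 x) (\<lambda>x. ?g x - \<mu> * (v x)\<^sup>2)"
    by (simp add: algebra_simps power2_eq_square)
  let ?h = "\<lambda>r. (v r)\<^sup>2 + (v (- r))\<^sup>2"
  let ?h1 = "\<lambda>r. 2 * (v r * v1 r - v (-r) * v1 (-r))"
  have hd: "(?h has_real_derivative ?h1 r) (at r)" for r
  proof -
    have "((\<lambda>r. v (- r)) has_real_derivative v1 (- r) * (- 1)) (at r)"
      by (rule DERIV_chain2[where f = v and g = "\<lambda>r. - r", OF d]) (auto intro!: derivative_eq_intros)
    with d[of r] show ?thesis by (auto intro!: derivative_eq_intros simp: algebra_simps)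
  qed
  \<comment> \<open>Otherwise the derivative of ?h would eventually be at least 2, so v could not be square integrable.\<close>
  have B: "integral {-r..r} ?g \<le> \<bar>\<mu>\<bar> * ?N + 1" for r
  proof (rule ccontr)
    assume big: "\<not> ?thesis"
    have r0: "0 \<le> r"
    proof (rule ccontr)
      assume "\<not> 0 \<le> r" then have "{-r..r} = {}" by auto
      with big N0 show False by (simp add: add_nonneg_pos)
    qed
    have h1: "2 \<le> ?h1 s" if "r \<le> s" for s
    proof -
      have ci: "(\<lambda>x. (v x)\<^sup>2) integrable_on {-s..s}" by (rule continuous_locally_integrable[OF cc(2)])
      have "integral {-r..r} ?g \<le> integral {-s..s} ?g"
        using that g0 gi by (intro integral_subset_le) auto
      moreover have "integral {-s..s} (\<lambda>x. ?g x - \<mu> * (v x)\<^sup>2) = v s * v1 s - v (-s) * v1 (-s)"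
        using that r0 by (intro integral_unique primitiveD[OF P]) auto
      moreover have "integral {-s..s} (\<lambda>x. ?g x - \<mu> * (v x)\<^sup>2) = integral {-s..s} ?g - \<mu> * integral {-s..s} (\<lambda>x. (v x)\<^sup>2)"
        by (subst Henstock_Kurzweil_Integration.integral_diff[OF gi integrable_on_mult_right[OF ci]]) simp
      moreover have "\<mu> * integral {-s..s} (\<lambda>x. (v x)\<^sup>2) \<le> \<bar>\<mu>\<bar> * ?N"
      proof (intro mult_mono)
        show "integral {-s..s} (\<lambda>x. (v x)\<^sup>2) \<le> ?N"
          by (rule has_integral_le_lebesgue[OF i _ integrable_integral[OF ci]]) simp
        show "0 \<le> integral {-s..s} (\<lambda>x. (v x)\<^sup>2)" by (rule integral_nonneg[OF ci]) simp
      qed auto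
      moreover have "2 \<le> 2 * D" if "Ir \<le> Is" "X = D" "X = Is - q" "q \<le> m" "\<not> Ir \<le> m + 1" for Ir Is X D q m :: real
        using that by linarith
      ultimately show ?thesis using big by blast
    qed
    have "2 \<le> \<bar>?h s\<bar>" if s: "r + 1 \<le> s" for s
    proof -
      have "?h r - 2 * r \<le> ?h s - 2 * s"
      proof (rule DERIV_nonneg_imp_nondecreasing[where f = "\<lambda>x. ?h x - 2 * x"])
        fix x assume x: "r \<le> x" "x \<le> s"
        have "((\<lambda>x. ?h x - 2 * x) has_real_derivative ?h1 x - 2) (at x)"
          using DERIV_diff[OF hd[of x] DERIV_cmult[where c = 2, OF DERIV_ident]] by (simp only: mult_1_right)
        moreover have "0 \<le> ?h1 x - 2" using h1[OF x(1)] by linarith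
        ultimately show "\<exists>y. ((\<lambda>x. ?h x - 2 * x) has_real_derivative y) (at x) \<and> 0 \<le> y" by blast
      qed (use s in auto)
      moreover have "0 \<le> ?h r" by simp
      ultimately have "2 \<le> ?h s" using s by linarith
      then show ?thesis by linarith
    qed
    moreover have "integrable lebesgue ?h" using i integrable_lebesgue_reflect[OF i] by auto
    ultimately show False using integrable_not_bounded_below[of ?h 2 "r + 1"] by simp
  qed
  have G: "integrable lebesgue ?g" by (rule integrable_nonneg_bounded_integrals[OF gi g0 B])
  show "integrable lebesgue (\<lambda>x. (v1 x)\<^sup>2)"
    by (rule Bochner_Integration.integrable_bound[OF G]) (use eig_meas[OF e] V_nonneg in auto)
  show "integrable lebesgue (\<lambda>x. V x * (v x)\<^sup>2)"
    by (rule Bochner_Integration.integrable_bound[OF G]) (use eig_meas[OF e] V_meas V_nonneg in auto)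
qed

lemma integrable_V_product:
  assumes "f \<in> borel_measurable lebesgue" "g \<in> borel_measurable lebesgue"
    "integrable lebesgue (\<lambda>x. V x * (f x)\<^sup>2)" "integrable lebesgue (\<lambda>x. V x * (g x)\<^sup>2)"
  shows "integrable lebesgue (\<lambda>x. V x * (f x * g x))"
proof -
  have sq: "(sqrt (V x) * h)\<^sup>2 = V x * h\<^sup>2" for x h using V_nonneg by (simp add: power_mult_distrib)
  have "integrable lebesgue (\<lambda>x. (sqrt (V x) * f x) * (sqrt (V x) * g x))"
    by (rule integrable_product) (use assms V_meas in \<open>auto simp: sq\<close>)
  moreover have "(sqrt (V x) * f x) * (sqrt (V x) * g x) = V x * (f x * g x)" for x
  proof -
    have "(sqrt (V x) * f x) * (sqrt (V x) * g x) = (sqrt (V x) * sqrt (V x)) * (f x * g x)" by (simp only: mult_ac)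
    then show ?thesis using V_nonneg[of x] by simp
  qed
  ultimately show ?thesis by simp
qed

text \<open>Only the equation for u is integrated by parts, so the eigenvalue of u appears;
  exchanging the roles of u and v in the symmetric left side then yields orthogonality. The boundary
  term u1 v is integrable as a product of two L2 functions.\<close>

lemma eig_green:
  assumes u: "eig \<mu> u u1" and v: "eig \<nu> v v1"
  shows "(LINT x|lebesgue. u1 x * v1 x + V x * (u x * v x)) = \<mu> * (LINT x|lebesgue. u x * v x)"
    and "integrable lebesgue (\<lambda>x. u1 x * v1 x)" "integrable lebesgue (\<lambda>x. V x * (u x * v x))"
      "integrable lebesgue (\<lambda>x. u x * v x)"
proof -
  note cu = eig_cont[OF u] and cv = eig_cont[OF v]
  note m = eig_meas[OF u] eig_meas[OF v]
  note iu = eig_energy_integrable[OF u] and iv = eig_energy_integrable[OF v]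
  have du: "primitive u1 (\<lambda>x. V x * u x - \<mu> * u x)" "integrable lebesgue (\<lambda>x. (u x)\<^sup>2)" using u by (auto simp: eig_def)
  have dv: "\<And>x. (v has_real_derivative v1 x) (at x)" "integrable lebesgue (\<lambda>x. (v x)\<^sup>2)" using v by (auto simp: eig_def)
  show i1: "integrable lebesgue (\<lambda>x. u1 x * v1 x)" and i2: "integrable lebesgue (\<lambda>x. V x * (u x * v x))"
      and i3: "integrable lebesgue (\<lambda>x. u x * v x)"
    using m iu iv du dv by (auto intro!: integrable_product integrable_V_product)
  have i4: "integrable lebesgue (\<lambda>x. u1 x * v x)" using m iu dv by (auto intro!: integrable_product)
  have lb: "locally_bounded (\<lambda>x. V x * u x + (- \<mu>) * u x)"
    by (intro locally_bounded_add locally_bounded_mult V_bdd locally_bounded_continuous cu continuous_on_const)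
  have "primitive (\<lambda>x. u1 x * v x) (\<lambda>x. (V x * u x - \<mu> * u x) * v x + u1 x * v1 x)"
    by (rule primitive_mult[OF du(1) primitive_deriv[OF dv(1)]])
       (use lb locally_bounded_continuous[OF cv(2)] in auto)
  then have "primitive (\<lambda>x. u1 x * v x) (\<lambda>x. (u1 x * v1 x + V x * (u x * v x)) - \<mu> * (u x * v x))"
    by (simp add: algebra_simps)
  then have "(LINT x|lebesgue. (u1 x * v1 x + V x * (u x * v x)) - \<mu> * (u x * v x)) = 0"
    by (rule primitive_integrable_zero[OF _ i4]) (use i1 i2 i3 in auto)
  moreover have "(LINT x|lebesgue. (u1 x * v1 x + V x * (u x * v x)) - \<mu> * (u x * v x)) =
      (LINT x|lebesgue. u1 x * v1 x + V x * (u x * v x)) - \<mu> * (LINT x|lebesgue. u x * v x)"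
    using i1 i2 i3 by (subst Bochner_Integration.integral_diff) auto
  ultimately show "(LINT x|lebesgue. u1 x * v1 x + V x * (u x * v x)) = \<mu> * (LINT x|lebesgue. u x * v x)" by simp
qed

lemma eig_orthogonal:
  assumes u: "eig \<mu> u u1" and v: "eig \<nu> v v1" and "\<mu> \<noteq> \<nu>"
  shows "(LINT x|lebesgue. u x * v x) = 0"
proof -
  have "\<mu> * (LINT x|lebesgue. u x * v x) = \<nu> * (LINT x|lebesgue. v x * u x)"
    unfolding eig_green(1)[OF u v, symmetric] eig_green(1)[OF v u, symmetric] by (simp add: mult.commute)
  then show ?thesis using assms(3) by (simp add: mult.commute)
qed

lemma eig_inner:
  assumes "finite F" and e: "\<And>\<mu>. \<mu> \<in> F \<Longrightarrow> eig \<mu> (v \<mu>) (v1 \<mu>)" and "\<mu> \<in> F"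
  shows "(\<Sum>\<nu>\<in>F. c \<nu> * (LINT x|lebesgue. v \<mu> x * v \<nu> x)) = c \<mu> * (LINT x|lebesgue. (v \<mu> x)\<^sup>2)"
proof -
  have "(\<Sum>\<nu>\<in>F. c \<nu> * (LINT x|lebesgue. v \<mu> x * v \<nu> x)) =
      (\<Sum>\<nu>\<in>F. if \<mu> = \<nu> then c \<mu> * (LINT x|lebesgue. (v \<mu> x)\<^sup>2) else 0)"
    using eig_orthogonal[OF e e] assms(3) by (intro sum.cong) (auto simp: power2_eq_square)
  then show ?thesis using assms by simp
qed

lemma eig_sum_norm:
  assumes F: "finite F" and e: "\<And>\<mu>. \<mu> \<in> F \<Longrightarrow> eig \<mu> (v \<mu>) (v1 \<mu>)"
  shows "integrable lebesgue (\<lambda>x. (\<Sum>\<mu>\<in>F. a \<mu> * v \<mu> x)\<^sup>2)"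
    and "(LINT x|lebesgue. (\<Sum>\<mu>\<in>F. a \<mu> * v \<mu> x)\<^sup>2) = (\<Sum>\<mu>\<in>F. (a \<mu>)\<^sup>2 * (LINT x|lebesgue. (v \<mu> x)\<^sup>2))"
proof -
  have eq: "(\<lambda>x. (\<Sum>\<mu>\<in>F. a \<mu> * v \<mu> x)\<^sup>2) = (\<lambda>x. \<Sum>\<mu>\<in>F. \<Sum>\<nu>\<in>F. a \<mu> * a \<nu> * (v \<mu> x * v \<nu> x))"
    by (auto simp: fun_eq_iff power2_eq_square sum_product mult_ac)
  have i: "integrable lebesgue (\<lambda>x. v \<mu> x * v \<nu> x)" if "\<mu> \<in> F" "\<nu> \<in> F" for \<mu> \<nu>
    using eig_green(4)[OF e e] that by blast
  show "integrable lebesgue (\<lambda>x. (\<Sum>\<mu>\<in>F. a \<mu> * v \<mu> x)\<^sup>2)"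
    unfolding eq using i by (intro Bochner_Integration.integrable_sum integrable_mult_right) auto
  have "(LINT x|lebesgue. (\<Sum>\<mu>\<in>F. \<Sum>\<nu>\<in>F. a \<mu> * a \<nu> * (v \<mu> x * v \<nu> x))) =
      (\<Sum>\<mu>\<in>F. \<Sum>\<nu>\<in>F. a \<mu> * a \<nu> * (LINT x|lebesgue. v \<mu> x * v \<nu> x))"
    using i by (subst Bochner_Integration.integral_sum) (auto intro!: sum.cong Bochner_Integration.integral_sum)
  also have "\<dots> = (\<Sum>\<mu>\<in>F. (a \<mu>)\<^sup>2 * (LINT x|lebesgue. (v \<mu> x)\<^sup>2))"
    using eig_inner[where c = "\<lambda>\<nu>. a \<mu> * a \<nu>" and \<mu> = \<mu> for \<mu>, OF F e]
    by (intro sum.cong) (auto simp: power2_eq_square)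
  finally show "(LINT x|lebesgue. (\<Sum>\<mu>\<in>F. a \<mu> * v \<mu> x)\<^sup>2) = (\<Sum>\<mu>\<in>F. (a \<mu>)\<^sup>2 * (LINT x|lebesgue. (v \<mu> x)\<^sup>2))"
    unfolding eq .
qed

lemma eig_sum_energy:
  assumes F: "finite F" and e: "\<And>\<mu>. \<mu> \<in> F \<Longrightarrow> eig \<mu> (v \<mu>) (v1 \<mu>)"
  shows "integrable lebesgue (\<lambda>x. (\<Sum>\<mu>\<in>F. a \<mu> * v1 \<mu> x)\<^sup>2 + V x * (\<Sum>\<mu>\<in>F. a \<mu> * v \<mu> x)\<^sup>2)"
    and "(LINT x|lebesgue. (\<Sum>\<mu>\<in>F. a \<mu> * v1 \<mu> x)\<^sup>2 + V x * (\<Sum>\<mu>\<in>F. a \<mu> * v \<mu> x)\<^sup>2) =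
      (\<Sum>\<mu>\<in>F. \<mu> * ((a \<mu>)\<^sup>2 * (LINT x|lebesgue. (v \<mu> x)\<^sup>2)))"
proof -
  let ?b = "\<lambda>\<mu> \<nu> x. v1 \<mu> x * v1 \<nu> x + V x * (v \<mu> x * v \<nu> x)"
  have eq: "(\<lambda>x. (\<Sum>\<mu>\<in>F. a \<mu> * v1 \<mu> x)\<^sup>2 + V x * (\<Sum>\<mu>\<in>F. a \<mu> * v \<mu> x)\<^sup>2) =
      (\<lambda>x. \<Sum>\<mu>\<in>F. \<Sum>\<nu>\<in>F. a \<mu> * a \<nu> * ?b \<mu> \<nu> x)"
    by (auto simp: fun_eq_iff power2_eq_square sum_product sum_distrib_left sum.distrib[symmetric] algebra_simps
        intro!: sum.cong)
  have i: "integrable lebesgue (?b \<mu> \<nu>)" if "\<mu> \<in> F" "\<nu> \<in> F" for \<mu> \<nu>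
    using eig_green(2,3)[OF e e] that by (intro Bochner_Integration.integrable_add) blast+
  show "integrable lebesgue (\<lambda>x. (\<Sum>\<mu>\<in>F. a \<mu> * v1 \<mu> x)\<^sup>2 + V x * (\<Sum>\<mu>\<in>F. a \<mu> * v \<mu> x)\<^sup>2)"
    unfolding eq using i by (intro Bochner_Integration.integrable_sum integrable_mult_right) auto
  have "(LINT x|lebesgue. (\<Sum>\<mu>\<in>F. \<Sum>\<nu>\<in>F. a \<mu> * a \<nu> * ?b \<mu> \<nu> x)) =
      (\<Sum>\<mu>\<in>F. (LINT x|lebesgue. (\<Sum>\<nu>\<in>F. a \<mu> * a \<nu> * ?b \<mu> \<nu> x)))"
    using i by (intro Bochner_Integration.integral_sum Bochner_Integration.integrable_sum integrable_mult_right)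
  also have "\<dots> = (\<Sum>\<mu>\<in>F. \<Sum>\<nu>\<in>F. (LINT x|lebesgue. a \<mu> * a \<nu> * ?b \<mu> \<nu> x))"
    using i by (intro sum.cong refl Bochner_Integration.integral_sum integrable_mult_right)
  also have "\<dots> = (\<Sum>\<mu>\<in>F. \<Sum>\<nu>\<in>F. (\<mu> * a \<mu> * a \<nu>) * (LINT x|lebesgue. v \<mu> x * v \<nu> x))"
  proof (intro sum.cong refl)
    fix \<mu> \<nu> assume "\<mu> \<in> F" "\<nu> \<in> F"
    then show "(LINT x|lebesgue. a \<mu> * a \<nu> * ?b \<mu> \<nu> x) = (\<mu> * a \<mu> * a \<nu>) * (LINT x|lebesgue. v \<mu> x * v \<nu> x)"
      by (subst Bochner_Integration.integral_mult_right_zero) (simp only: eig_green(1)[OF e e] mult_ac)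
  qed
  also have "\<dots> = (\<Sum>\<mu>\<in>F. \<mu> * ((a \<mu>)\<^sup>2 * (LINT x|lebesgue. (v \<mu> x)\<^sup>2)))"
    using eig_inner[where c = "\<lambda>\<nu>. \<mu> * a \<mu> * a \<nu>" and \<mu> = \<mu> for \<mu>, OF F e]
    by (intro sum.cong) (auto simp: power2_eq_square)
  finally show "(LINT x|lebesgue. (\<Sum>\<mu>\<in>F. a \<mu> * v1 \<mu> x)\<^sup>2 + V x * (\<Sum>\<mu>\<in>F. a \<mu> * v \<mu> x)\<^sup>2) =
      (\<Sum>\<mu>\<in>F. \<mu> * ((a \<mu>)\<^sup>2 * (LINT x|lebesgue. (v \<mu> x)\<^sup>2)))"
    unfolding eq .
qed

text \<open>One-dimensional Sobolev bound: compare the squares of p at x and at y by |2 p p'| <= p^2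
  + p'^2 and average over y in [x,x+1]. The comparison and the average contribute one copy of the
  mass each.\<close>

lemma sup_le_energy:
  assumes d: "\<And>x. (p has_real_derivative p1 x) (at x)" and c1: "continuous_on UNIV p1"
    and ip: "integrable lebesgue (\<lambda>x. (p x)\<^sup>2)" and ip1: "integrable lebesgue (\<lambda>x. (p1 x)\<^sup>2)"
  shows "(p x)\<^sup>2 \<le> 2 * (LINT x|lebesgue. (p x)\<^sup>2) + (LINT x|lebesgue. (p1 x)\<^sup>2)"
proof -
  let ?P = "LINT x|lebesgue. (p x)\<^sup>2" and ?Q = "LINT x|lebesgue. (p1 x)\<^sup>2"
  have cp: "continuous_on UNIV p" using d by (auto intro: DERIV_continuous_on has_field_derivative_at_within)
  have c2: "continuous_on UNIV (\<lambda>x. (p x)\<^sup>2)" "continuous_on UNIV (\<lambda>x. (p1 x)\<^sup>2)"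
    using cp c1 by (auto intro: continuous_on_power)
  have isum: "integrable lebesgue (\<lambda>x. (p x)\<^sup>2 + (p1 x)\<^sup>2)" using ip ip1 by auto
  have "(p x)\<^sup>2 \<le> (p y)\<^sup>2 + (?P + ?Q)" if y: "y \<in> {x..x+1}" for y
  proof -
    have cs: "continuous_on UNIV (\<lambda>x. (p x)\<^sup>2 + (p1 x)\<^sup>2)" by (intro continuous_on_add c2)
    have P: "primitive (\<lambda>x. - (p x)\<^sup>2) (\<lambda>x. - (2 * p x * p1 x))"
      by (rule primitive_deriv) (auto intro!: derivative_eq_intros d)
    have "- (p y)\<^sup>2 - - (p x)\<^sup>2 \<le> integral {x..y} (\<lambda>x. (p x)\<^sup>2 + (p1 x)\<^sup>2)"
    proof (rule has_integral_le[OF primitiveD[OF P] integrable_integral[OF continuous_locally_integrable[OF cs]]])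
      fix t show "- (2 * p t * p1 t) \<le> (p t)\<^sup>2 + (p1 t)\<^sup>2"
        using zero_le_power2[of "p t + p1 t"] by (simp add: power2_sum)
    qed (use y in auto)
    also have "\<dots> \<le> (LINT x|lebesgue. (p x)\<^sup>2 + (p1 x)\<^sup>2)"
      by (rule has_integral_le_lebesgue[OF isum _ integrable_integral[OF continuous_locally_integrable[OF cs]]]) simp
    also have "\<dots> = ?P + ?Q" using ip ip1 by simp
    finally show ?thesis by simp
  qed
  then have "integral {x..x+1} (\<lambda>_. (p x)\<^sup>2) \<le> integral {x..x+1} (\<lambda>y. (p y)\<^sup>2 + (?P + ?Q))"
    by (intro integral_le continuous_locally_integrable continuous_intros c2) auto
  also have "\<dots> = integral {x..x+1} (\<lambda>y. (p y)\<^sup>2) + (?P + ?Q)"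
    by (subst Henstock_Kurzweil_Integration.integral_add) (auto intro: continuous_locally_integrable c2)
  also have "integral {x..x+1} (\<lambda>y. (p y)\<^sup>2) \<le> ?P"
    by (rule has_integral_le_lebesgue[OF ip _ integrable_integral[OF continuous_locally_integrable[OF c2(1)]]]) simp
  finally show ?thesis by simp
qed

text \<open>Where V >= 2E one has p^2 <= V p^2 / (2E), whose integral is at most half of the mass.
  The other half must come from [-r,r], of length 2r.\<close>

lemma mass_localized:
  assumes pm: "p \<in> borel_measurable lebesgue" and ip: "integrable lebesgue (\<lambda>x. (p x)\<^sup>2)"
    and iV: "integrable lebesgue (\<lambda>x. V x * (p x)\<^sup>2)"
    and en: "(LINT x|lebesgue. V x * (p x)\<^sup>2) \<le> E * (LINT x|lebesgue. (p x)\<^sup>2)"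
    and E: "0 < E" and far: "\<And>x. r < \<bar>x\<bar> \<Longrightarrow> 2 * E \<le> V x" and r: "0 \<le> r"
    and S: "\<And>x. \<bar>x\<bar> \<le> r \<Longrightarrow> \<bar>p x\<bar> \<le> S"
  shows "(LINT x|lebesgue. (p x)\<^sup>2) \<le> 4 * r * S\<^sup>2"
proof -
  let ?P = "LINT x|lebesgue. (p x)\<^sup>2"
  have ind: "integrable lebesgue (\<lambda>x. indicat_real {-r..r} x * S\<^sup>2)"
    by (intro integrable_mult_left integrable_real_indicator) (auto simp: emeasure_lborel_Icc_eq)
  have "?P \<le> (LINT x|lebesgue. indicat_real {-r..r} x * S\<^sup>2 + (1 / (2 * E)) * (V x * (p x)\<^sup>2))"
  proof (rule integral_mono[OF ip])
    show "integrable lebesgue (\<lambda>x. indicat_real {-r..r} x * S\<^sup>2 + (1 / (2 * E)) * (V x * (p x)\<^sup>2))"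
      using ind iV by auto
    fix x
    show "(p x)\<^sup>2 \<le> indicat_real {-r..r} x * S\<^sup>2 + (1 / (2 * E)) * (V x * (p x)\<^sup>2)"
    proof (cases "\<bar>x\<bar> \<le> r")
      case True
      have "(p x)\<^sup>2 \<le> S\<^sup>2" using S[OF True] by (simp add: abs_le_square_iff[symmetric])
      moreover have "0 \<le> (1 / (2 * E)) * (V x * (p x)\<^sup>2)" using E V_nonneg by simp
      moreover have "x \<in> {-r..r}" using True by (auto simp: abs_le_iff)
      ultimately show ?thesis by simp
    next
      case False
      have "2 * E * (p x)\<^sup>2 \<le> V x * (p x)\<^sup>2" using far[of x] False by (intro mult_right_mono) auto
      then have "(p x)\<^sup>2 \<le> (1 / (2 * E)) * (V x * (p x)\<^sup>2)" using E by (simp add: field_simps)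
      moreover have "indicat_real {-r..r} x = 0" using False by (auto simp: indicator_def)
      ultimately show ?thesis by simp
    qed
  qed
  also have "\<dots> = 2 * r * S\<^sup>2 + (1 / (2 * E)) * (LINT x|lebesgue. V x * (p x)\<^sup>2)"
    using ind iV r by (subst Bochner_Integration.integral_add) auto
  also have "\<dots> \<le> 2 * r * S\<^sup>2 + (1 / (2 * E)) * (E * ?P)"
    using en E by (intro add_left_mono mult_left_mono) auto
  also have "(1 / (2 * E)) * (E * ?P) = ?P / 2" using E by simp
  finally show ?thesis by simp
qed

end

section \<open>Remez inequality for spectral sums\<close>

text \<open>There is one function per eigenvalue, with its coefficient included, so orthogonality
  follows from the eigenvalues being distinct. Their positivity makes H injective on the
  span.\<close>

locale spectral_sum = potential +
  fixes E :: real and F :: "real set" and v v1 :: "real \<Rightarrow> real \<Rightarrow> real"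
  assumes E_pos: "0 < E" and F_finite: "finite F" and F_range: "\<And>\<mu>. \<mu> \<in> F \<Longrightarrow> 0 < \<mu> \<and> \<mu> \<le> E"
    and v_eig: "\<And>\<mu>. \<mu> \<in> F \<Longrightarrow> eig \<mu> (v \<mu>) (v1 \<mu>)"
begin

text \<open>The function p j is (-H)^j applied to the sum p 0.\<close>

definition p :: "nat \<Rightarrow> real \<Rightarrow> real" where "p j x = (\<Sum>\<mu>\<in>F. (- \<mu>) ^ j * v \<mu> x)"
definition p1 :: "nat \<Rightarrow> real \<Rightarrow> real" where "p1 j x = (\<Sum>\<mu>\<in>F. (- \<mu>) ^ j * v1 \<mu> x)"
definition mass :: "nat \<Rightarrow> real" where "mass j = (LINT x|lebesgue. (p j x)\<^sup>2)"

lemma p_deriv: "(p j has_real_derivative p1 j x) (at x)"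
proof -
  have "((\<lambda>x. \<Sum>\<mu>\<in>F. (- \<mu>) ^ j * v \<mu> x) has_real_derivative (\<Sum>\<mu>\<in>F. (- \<mu>) ^ j * v1 \<mu> x)) (at x)"
    using v_eig by (intro DERIV_sum DERIV_cmult) (auto simp: eig_def)
  then show ?thesis unfolding p_def[abs_def] p1_def[abs_def] .
qed

lemma p1_primitive: "primitive (p1 j) (\<lambda>x. V x * p j x + p (Suc j) x)"
proof -
  have "primitive (\<lambda>x. \<Sum>\<mu>\<in>F. (- \<mu>) ^ j * v1 \<mu> x) (\<lambda>x. \<Sum>\<mu>\<in>F. (- \<mu>) ^ j * (V x * v \<mu> x - \<mu> * v \<mu> x))"
    using v_eig by (intro primitive_sum primitive_cmult) (auto simp: eig_def)
  moreover have "(\<Sum>\<mu>\<in>F. (- \<mu>) ^ j * (V x * v \<mu> x - \<mu> * v \<mu> x)) = V x * p j x + p (Suc j) x" for x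
    by (simp add: p_def sum_distrib_left sum.distrib[symmetric] algebra_simps)
  ultimately show ?thesis by (simp add: p1_def[abs_def])
qed

lemma p_cont: "continuous_on UNIV (p j)" "continuous_on UNIV (p1 j)"
  using p_deriv primitive_continuous[OF p1_primitive]
  by (auto intro: DERIV_continuous_on has_field_derivative_at_within)

lemma p_meas: "p j \<in> borel_measurable lebesgue" "p1 j \<in> borel_measurable lebesgue"
  by (intro continuous_lebesgue_measurable p_cont)+

lemma p_integrable: "integrable lebesgue (\<lambda>x. (p j x)\<^sup>2)"
  unfolding p_def by (rule eig_sum_norm(1)[OF F_finite v_eig])

lemma mass_eq: "mass j = (\<Sum>\<mu>\<in>F. ((- \<mu>) ^ j)\<^sup>2 * (LINT x|lebesgue. (v \<mu> x)\<^sup>2))"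
  unfolding mass_def p_def by (rule eig_sum_norm(2)[OF F_finite v_eig])

lemma mass_nonneg: "0 \<le> mass j"
  by (simp add: mass_def)

lemma energy_integrable: "integrable lebesgue (\<lambda>x. (p1 j x)\<^sup>2)" "integrable lebesgue (\<lambda>x. V x * (p j x)\<^sup>2)"
proof -
  have i: "integrable lebesgue (\<lambda>x. (p1 j x)\<^sup>2 + V x * (p j x)\<^sup>2)"
    unfolding p_def p1_def by (rule eig_sum_energy(1)[OF F_finite v_eig])
  show "integrable lebesgue (\<lambda>x. (p1 j x)\<^sup>2)"
    by (rule Bochner_Integration.integrable_bound[OF i]) (use p_meas V_nonneg in auto)
  show "integrable lebesgue (\<lambda>x. V x * (p j x)\<^sup>2)"
    by (rule Bochner_Integration.integrable_bound[OF i]) (use p_meas V_meas V_nonneg in auto)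
qed

lemma energy_le: "(LINT x|lebesgue. (p1 j x)\<^sup>2) + (LINT x|lebesgue. V x * (p j x)\<^sup>2) \<le> E * mass j"
proof -
  have "(LINT x|lebesgue. (p1 j x)\<^sup>2) + (LINT x|lebesgue. V x * (p j x)\<^sup>2) =
      (LINT x|lebesgue. (p1 j x)\<^sup>2 + V x * (p j x)\<^sup>2)"
    using energy_integrable by simp
  also have "\<dots> = (\<Sum>\<mu>\<in>F. \<mu> * (((- \<mu>) ^ j)\<^sup>2 * (LINT x|lebesgue. (v \<mu> x)\<^sup>2)))"
    unfolding p_def p1_def by (rule eig_sum_energy(2)[OF F_finite v_eig])
  also have "\<dots> \<le> (\<Sum>\<mu>\<in>F. E * (((- \<mu>) ^ j)\<^sup>2 * (LINT x|lebesgue. (v \<mu> x)\<^sup>2)))"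
    using F_range by (intro sum_mono mult_right_mono) auto
  finally show ?thesis by (simp add: mass_eq sum_distrib_left)
qed

lemma mass_growth: "mass (i + j) \<le> (E ^ j)\<^sup>2 * mass i"
proof -
  have "mass (i + j) = (\<Sum>\<mu>\<in>F. (\<mu> ^ j)\<^sup>2 * (((- \<mu>) ^ i)\<^sup>2 * (LINT x|lebesgue. (v \<mu> x)\<^sup>2)))"
  proof (unfold mass_eq, intro sum.cong refl)
    fix \<mu> :: real
    have "((- \<mu>) ^ j)\<^sup>2 = (\<mu> ^ j)\<^sup>2"
      by (simp only: power2_eq_square power_mult_distrib[symmetric] minus_mult_minus)
    then show "((- \<mu>) ^ (i + j))\<^sup>2 * (LINT x|lebesgue. (v \<mu> x)\<^sup>2) =
        (\<mu> ^ j)\<^sup>2 * (((- \<mu>) ^ i)\<^sup>2 * (LINT x|lebesgue. (v \<mu> x)\<^sup>2))"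
      by (simp only: power_add power_mult_distrib mult_ac)
  qed
  also have "\<dots> \<le> (\<Sum>\<mu>\<in>F. (E ^ j)\<^sup>2 * (((- \<mu>) ^ i)\<^sup>2 * (LINT x|lebesgue. (v \<mu> x)\<^sup>2)))"
    using F_range by (intro sum_mono mult_right_mono power_mono) (auto simp: less_imp_le)
  finally show ?thesis by (simp add: mass_eq sum_distrib_left)
qed

text \<open>Guarantees that with psi no (-H)^i psi vanishes, so that zeros can be counted at every
  level of the chain.\<close>

lemma mass_zero:
  assumes "mass i = 0" shows "mass 0 = 0"
proof -
  have "(LINT x|lebesgue. (v \<mu> x)\<^sup>2) = 0" if "\<mu> \<in> F" for \<mu>
  proof -
    have "((- \<mu>) ^ i)\<^sup>2 * (LINT x|lebesgue. (v \<mu> x)\<^sup>2) = 0"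
      using assms that unfolding mass_eq by (subst (asm) sum_nonneg_eq_0_iff[OF F_finite]) auto
    then show ?thesis using F_range[OF that] by simp
  qed
  then show ?thesis by (simp add: mass_eq)
qed

text \<open>The base index i is kept apart because zeros of (-H)^i psi are counted relative to its
  own norm. The factor 2 + E comes from the Sobolev bound, with the derivative controlled by the
  energy.\<close>

lemma p_sup: "\<bar>p (i + j) x\<bar> \<le> sqrt ((2 + E) * mass i) * E ^ j"
proof -
  have "(p (i + j) x)\<^sup>2 \<le> 2 * mass (i + j) + (LINT x|lebesgue. (p1 (i + j) x)\<^sup>2)"
    unfolding mass_def by (rule sup_le_energy[OF p_deriv p_cont(2) p_integrable energy_integrable(1)])
  also have "(LINT x|lebesgue. (p1 (i + j) x)\<^sup>2) \<le> E * mass (i + j)"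
  proof -
    have "0 \<le> (LINT x|lebesgue. V x * (p (i + j) x)\<^sup>2)" using V_nonneg by (intro Bochner_Integration.integral_nonneg) simp
    then show ?thesis using energy_le[of "i + j"] by linarith
  qed
  also have "2 * mass (i + j) + E * mass (i + j) = (2 + E) * mass (i + j)" by (simp add: algebra_simps)
  also have "\<dots> \<le> (2 + E) * ((E ^ j)\<^sup>2 * mass i)" using E_pos by (intro mult_left_mono mass_growth) auto
  finally have "(p (i + j) x)\<^sup>2 \<le> (sqrt ((2 + E) * mass i) * E ^ j)\<^sup>2"
    using E_pos mass_nonneg[of i] by (simp add: power_mult_distrib mult_ac)
  moreover have "0 \<le> sqrt ((2 + E) * mass i) * E ^ j" using E_pos mass_nonneg[of i] by simp
  ultimately show ?thesis by (metis abs_le_square_iff abs_of_nonneg)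
qed

lemma mass_le_sup:
  assumes "\<And>x. r < \<bar>x\<bar> \<Longrightarrow> 2 * E \<le> V x" "0 \<le> r" "\<And>x. \<bar>x\<bar> \<le> r \<Longrightarrow> \<bar>p i x\<bar> \<le> S"
  shows "mass i \<le> 4 * r * S\<^sup>2"
  unfolding mass_def
proof (rule mass_localized[OF p_meas(1) p_integrable energy_integrable(2) _ E_pos assms])
  have "0 \<le> (LINT x|lebesgue. (p1 i x)\<^sup>2)" by (intro Bochner_Integration.integral_nonneg) simp
  then show "(LINT x|lebesgue. V x * (p i x)\<^sup>2) \<le> E * (LINT x|lebesgue. (p i x)\<^sup>2)"
    using energy_le[of i] unfolding mass_def by linarith
qed auto

text \<open>The hypothesis \<open>hn\<close> makes e^(-n) outweigh all losses of propagation and of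
  passing from the supremum to the mass. The bound on q makes the cells of
  \<open>cluster_pigeonhole\<close> short enough for \<open>clustered_zeros_small\<close>. The bound
  on \<open>card G\<close> is the loss k + 2 over n levels, with k = (q + 1) n.\<close>

theorem mass_le_points:
  fixes A r M MA K s \<tau> \<eta> :: real and n q :: nat
  assumes A: "0 < A" "A \<le> r" and M: "0 \<le> M" "\<And>t. \<bar>t\<bar> \<le> r \<Longrightarrow> V t \<le> M\<^sup>2"
    and MA: "0 \<le> MA" "\<And>t. \<bar>t\<bar> \<le> A \<Longrightarrow> V t \<le> MA\<^sup>2" and K: "K = cosh (MA * A)"
    and far: "\<And>x. r < \<bar>x\<bar> \<Longrightarrow> 2 * E \<le> V x"
    and n: "even n" "0 < n" and \<tau>: "1 \<le> \<tau>" "exp 1 * sqrt E \<le> \<tau>"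
    and hn: "2 * sqrt (4 * r * (2 + E)) * exp (M * r + \<tau> * K\<^sup>2 * (2 * r)) \<le> exp (real n)"
    and q: "0 < q" "2 * A * K\<^sup>2 * \<tau> \<le> real q"
    and G: "finite G" "G \<subseteq> {-A..A}" and s: "0 < s" "s \<le> 1"
    and sep: "\<And>x y. x \<in> G \<Longrightarrow> y \<in> G \<Longrightarrow> x < y \<Longrightarrow> s \<le> y - x"
    and small: "\<And>x. x \<in> G \<Longrightarrow> \<bar>p 0 x\<bar> \<le> \<eta>"
    and card: "((q + 1) * n + 2) * n < card G"
  shows "sqrt (mass 0) \<le> exp (real n) * (2 * K\<^sup>2 / s) ^ n * \<eta>"
proof (cases "mass 0 = 0")
  case True
  have "G \<noteq> {}" using card by auto
  then obtain x where "x \<in> G" by blast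
  then have "0 \<le> \<eta>" using small[of x] abs_ge_zero[of "p 0 x"] by linarith
  then show ?thesis using True s by simp
next
  case False
  obtain w w1 where dw: "\<And>x. (w has_real_derivative w1 x) (at x)" and pw: "primitive w1 (\<lambda>x. V x * w x)"
    and w_ge: "\<And>x. 1 \<le> w x" and w_mono: "\<And>s t. \<bar>s\<bar> \<le> \<bar>t\<bar> \<Longrightarrow> 0 \<le> s * t \<Longrightarrow> w s \<le> w t"
    and w_cosh: "\<And>M r x. (\<And>t. \<bar>t\<bar> \<le> r \<Longrightarrow> V t \<le> M\<^sup>2) \<Longrightarrow> \<bar>x\<bar> \<le> r \<Longrightarrow> w x \<le> cosh (M * x)"
    using positive_solution by blast
  \<comment> \<open>The chain started at (-H)^i psi. Its function of index 0 is the one of index 2i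
    in the chain of psi, so one argument at the start of a chain counts the zeros at all even
    levels.\<close>
  define u where "u i = (\<lambda>j x. if even j then p (i + j div 2) x / w x else p1 (i + j div 2) x * w x - p (i + j div 2) x * w1 x)" for i :: nat
  have r0: "0 < r" using A by simp
  have K1: "1 \<le> K" by (simp add: K cosh_real_ge_1)
  have w_K: "w x \<le> K" if "\<bar>x\<bar> \<le> A" for x
  proof -
    have "w x \<le> cosh (MA * x)" using w_cosh[OF MA(2) that] .
    also have "\<dots> = cosh (MA * \<bar>x\<bar>)" by (simp add: abs_if)
    also have "\<dots> \<le> K" unfolding K using that MA(1) A(1)
      by (subst cosh_real_nonneg_le_iff) (auto intro: mult_left_mono mult_nonneg_nonneg)
    finally show ?thesis .
  qed
  have w_exp: "w x \<le> exp (M * r)" if "\<bar>x\<bar> \<le> r" for x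
  proof -
    have "w x \<le> cosh (M * x)" using w_cosh[OF M(2) that] .
    also have "\<dots> = cosh (M * \<bar>x\<bar>)" by (simp add: abs_if)
    also have "\<dots> \<le> exp (M * \<bar>x\<bar>)" using M(1) by (simp add: cosh_def)
    also have "\<dots> \<le> exp (M * r)" using that M(1) by (simp add: mult_left_mono)
    finally show ?thesis .
  qed
  \<comment> \<open>A point of the segment outside [-A,A] lies between the origin and x, where
    monotonicity applies; inside, the bound K and w >= 1 suffice.\<close>
  have w_seg: "w t \<le> K * w x" if "\<bar>y\<bar> \<le> A" "t \<in> closed_segment y x" for x y t
  proof (cases "\<bar>t\<bar> \<le> A")
    case True
    then have "w t \<le> K * 1" using w_K by simp
    also have "\<dots> \<le> K * w x" using K1 w_ge[of x] by (intro mult_left_mono) auto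
    finally show ?thesis .
  next
    case False
    have "w t \<le> w x"
    proof (rule w_mono)
      show "\<bar>t\<bar> \<le> \<bar>x\<bar>" using False that by (auto simp: closed_segment_eq_real_ivl split: if_splits)
      show "0 \<le> t * x" using False that by (auto simp: closed_segment_eq_real_ivl zero_le_mult_iff split: if_splits)
    qed
    also have "\<dots> \<le> K * w x" using K1 w_ge[of x] by (simp add: mult_le_cancel_right1)
    finally show ?thesis .
  qed
  have chain: "weighted_chain w (u i) r A K" for i
  proof
    show "(u i j has_real_derivative (if even j then 1 / (w x)\<^sup>2 else (w x)\<^sup>2) * u i (Suc j) x) (at x)" for j x
      by (rule chain_deriv[OF dw pw w_ge, where p = "\<lambda>j. p (i + j)" and ?p1.0 = "\<lambda>j. p1 (i + j)"])
         (use p_deriv p1_primitive[of "i + j" for j] in \<open>auto simp: u_def\<close>)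
  qed (use A K1 w_ge w_K w_seg in auto)
  define T where "T = \<tau> * K\<^sup>2 * (2 * r)"
  \<comment> \<open>The factor e^(-n) is what remains of (sqrt(E) / tau)^n, as tau is at least e
    sqrt(E).\<close>
  define B where "B i = sqrt ((2 + E) * mass i) * exp (- real n)" for i
  have B0: "0 \<le> B i" for i using E_pos mass_nonneg[of i] by (simp add: B_def)
  have top: "\<bar>u i n x\<bar> \<le> B i * \<tau> ^ n" for i x
  proof -
    have "\<bar>u i n x\<bar> = \<bar>p (i + n div 2) x\<bar> / w x" using n(1) w_ge[of x] by (simp add: u_def)
    also have "\<dots> \<le> \<bar>p (i + n div 2) x\<bar> / 1" using w_ge[of x] by (intro divide_left_mono) auto
    also have "\<dots> \<le> sqrt ((2 + E) * mass i) * E ^ (n div 2)" using p_sup by simp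
    also have "E ^ (n div 2) = (sqrt E) ^ n" using n(1) E_pos by (auto elim!: evenE simp: power_mult)
    also have "sqrt ((2 + E) * mass i) * (sqrt E) ^ n \<le> sqrt ((2 + E) * mass i) * (\<tau> * exp (- 1)) ^ n"
    proof (intro mult_left_mono power_mono)
      have "exp 1 * sqrt E * exp (- 1) \<le> \<tau> * exp (- 1)" using \<tau>(2) by (intro mult_right_mono) auto
      then show "sqrt E \<le> \<tau> * exp (- 1)" by (simp add: mult_ac exp_minus)
    qed (use E_pos mass_nonneg[of i] in auto)
    also have "(\<tau> * exp (- 1)) ^ n = exp (- real n) * \<tau> ^ n"
      by (simp add: power_mult_distrib exp_of_nat_mult[symmetric])
    finally show ?thesis by (simp only: B_def mult.assoc)
  qed
  have half: "sqrt (4 * r) * exp (M * r + T) * B i \<le> sqrt (mass i) / 2" for i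
  proof -
    have "2 * (sqrt (4 * r) * exp (M * r + T) * B i) =
        (2 * sqrt (4 * r * (2 + E)) * exp (M * r + T)) * (exp (- real n) * sqrt (mass i))"
      by (simp only: B_def real_sqrt_mult mult_ac)
    also have "\<dots> \<le> exp (real n) * (exp (- real n) * sqrt (mass i))"
      using hn mass_nonneg[of i] unfolding T_def by (intro mult_right_mono) auto
    also have "\<dots> = sqrt (mass i)" by (simp add: exp_minus)
    finally show ?thesis by simp
  qed
  have mass_bound: "sqrt (mass i) \<le> sqrt (4 * r) * (exp (M * r) * D)"
    if D: "\<And>x. \<bar>x\<bar> \<le> r \<Longrightarrow> \<bar>u i 0 x\<bar> \<le> D" "0 \<le> D" for i D
  proof -
    have "mass i \<le> 4 * r * (exp (M * r) * D)\<^sup>2"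
    proof (rule mass_le_sup[OF far])
      fix x assume x: "\<bar>x\<bar> \<le> r"
      have "p i x = w x * u i 0 x" using w_ge[of x] by (simp add: u_def)
      then have "\<bar>p i x\<bar> = w x * \<bar>u i 0 x\<bar>" using w_ge[of x] by (simp add: abs_mult)
      also have "\<dots> \<le> exp (M * r) * D" using w_exp[OF x] D(1)[OF x] w_ge[of x] by (intro mult_mono) auto
      finally show "\<bar>p i x\<bar> \<le> exp (M * r) * D" .
    qed (use r0 in auto)
    then have "sqrt (mass i) \<le> sqrt (4 * r * (exp (M * r) * D)\<^sup>2)" by simp
    then show ?thesis using D(2) by (simp add: real_sqrt_mult)
  qed
  have mass_pos: "0 < mass i" for i using False mass_zero[of i] mass_nonneg[of i] by force
  \<comment> \<open>Otherwise n zeros share a cell, and the norm of (-H)^i psi would be at most half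
    of itself although it is positive.\<close>
  have even_zeros: "card Z < (q + 1) * n"
    if Z: "finite Z" "Z \<subseteq> {-A..A}" "\<forall>z\<in>Z. p i z = 0" for i Z
  proof (rule ccontr)
    assume "\<not> ?thesis"
    then obtain a b where ab: "-A \<le> a" "a \<le> b" "b \<le> A" "b - a \<le> 2 * A / real q" "n \<le> card (Z \<inter> {a..b})"
      using cluster_pigeonhole[OF Z(1,2) A(1) q(1) _ n(2)] by force
    have len: "(b - a) * K\<^sup>2 * \<tau> \<le> 1"
    proof -
      have "(b - a) * K\<^sup>2 * \<tau> \<le> (2 * A / real q) * K\<^sup>2 * \<tau>" using ab \<tau> by (intro mult_right_mono) auto
      also have "\<dots> \<le> 1" using q by (simp add: field_simps)
      finally show ?thesis .
    qed
    have "\<bar>u i 0 x\<bar> \<le> B i * exp T" if "\<bar>x\<bar> \<le> r" for x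
      unfolding T_def
      by (rule weighted_chain.clustered_zeros_small[OF chain, where Z = "Z \<inter> {a..b}" and n = n and a = a and b = b])
         (use Z ab len \<tau> n B0 top that in \<open>auto simp: u_def\<close>)
    then have "sqrt (mass i) \<le> sqrt (4 * r) * (exp (M * r) * (B i * exp T))"
      using B0 by (intro mass_bound) auto
    also have "\<dots> = sqrt (4 * r) * exp (M * r + T) * B i" by (simp add: exp_add mult_ac)
    also have "\<dots> \<le> sqrt (mass i) / 2" by (rule half)
    finally show False using mass_pos[of i] by simp
  qed
  have u_even: "u 0 j z = 0 \<longleftrightarrow> p (j div 2) z = 0" if "even j" for j z
    using that w_ge[of z] by (simp add: u_def)
  have zeros: "card Z \<le> (q + 1) * n"
    if Z: "finite Z" "Z \<subseteq> {-A..A}" "\<forall>z\<in>Z. u 0 j z = 0" for j Z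
  proof (cases "even j")
    case True
    then show ?thesis using even_zeros[OF Z(1,2), of "j div 2"] Z(3) u_even[OF True] by auto
  next
    case odd: False
    show ?thesis
    proof (cases "card Z")
      case (Suc m)
      \<comment> \<open>Rolle's theorem loses one zero on the way to the next even level; the strict
        inequality in \<open>even_zeros\<close> makes up for it.\<close>
      obtain Z' where Z': "finite Z'" "card Z' = m" "Z' \<subseteq> {-A..A}" "\<forall>z\<in>Z'. u 0 (Suc j) z = 0"
        using weighted_chain.zeros_step[OF chain Z(1) Suc Z(2), of 0 j] Z(3) A by auto
      have "card Z' < (q + 1) * n"
        using even_zeros[OF Z'(1,3), of "Suc j div 2"] Z'(4) u_even[of "Suc j"] odd by auto
      then show ?thesis using Z'(2) Suc by simp
    qed simp
  qed
  let ?\<sigma> = "2 * K\<^sup>2 / s"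
  have \<eta>: "0 \<le> \<eta>"
  proof -
    have "G \<noteq> {}" using card by auto
    then obtain x where "x \<in> G" by blast
    then show ?thesis using small[of x] abs_ge_zero[of "p 0 x"] by linarith
  qed
  have \<sigma>0: "0 \<le> ?\<sigma> ^ n" using s by simp
  have small_u: "\<bar>u 0 0 x\<bar> \<le> \<eta>" if "x \<in> G" for x
  proof -
    have "\<bar>u 0 0 x\<bar> = \<bar>p 0 x\<bar> / w x" using w_ge[of x] by (simp add: u_def)
    also have "\<dots> \<le> \<bar>p 0 x\<bar> / 1" using w_ge[of x] by (intro divide_left_mono) auto
    finally show ?thesis using small[OF that] by simp
  qed
  have "\<bar>u 0 0 x\<bar> \<le> (?\<sigma> ^ n * \<eta> + B 0) * exp T" if "\<bar>x\<bar> \<le> r" for x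
    unfolding T_def
    by (rule weighted_chain.remez_bound[OF chain G s, where k = "(q + 1) * n"])
       (use sep small_u zeros card \<tau>(1) n(1) B0 top that in auto)
  then have "sqrt (mass 0) \<le> sqrt (4 * r) * (exp (M * r) * ((?\<sigma> ^ n * \<eta> + B 0) * exp T))"
    using B0 \<eta> \<sigma>0 by (intro mass_bound) auto
  also have "\<dots> = sqrt (4 * r) * exp (M * r + T) * (?\<sigma> ^ n * \<eta>) + sqrt (4 * r) * exp (M * r + T) * B 0"
    by (simp add: exp_add algebra_simps)
  also have "\<dots> \<le> sqrt (4 * r) * exp (M * r + T) * (?\<sigma> ^ n * \<eta>) + sqrt (mass 0) / 2"
    by (rule add_left_mono[OF half])
  finally have "sqrt (mass 0) \<le> (2 * sqrt (4 * r) * exp (M * r + T)) * (?\<sigma> ^ n * \<eta>)" by linarith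
  also have "\<dots> \<le> exp (real n) * (?\<sigma> ^ n * \<eta>)"
  proof (rule mult_right_mono)
    have "4 * r * 1 \<le> 4 * r * (2 + E)" using r0 E_pos by (intro mult_left_mono) auto
    then have "sqrt (4 * r) \<le> sqrt (4 * r * (2 + E))" by simp
    then have "2 * sqrt (4 * r) * exp (M * r + T) \<le> 2 * sqrt (4 * r * (2 + E)) * exp (M * r + T)"
      by (intro mult_right_mono mult_left_mono) auto
    with hn show "2 * sqrt (4 * r) * exp (M * r + T) \<le> exp (real n)" unfolding T_def by linarith
  qed (use \<eta> \<sigma>0 in simp)
  finally show ?thesis by (simp only: mult.assoc)
qed

end

section \<open>Observation sets and reduction to real eigenfunctions\<close>

text \<open>Greedy choice: the s-neighbourhoods of m chosen points have total length at most 2 s m,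
  so as long as this is below the measure of W another point is available.\<close>

lemma separated_points:
  assumes W: "W \<in> lmeasurable" and s: "0 < s" and m: "2 * s * real m < measure lebesgue W"
  shows "\<exists>G. finite G \<and> G \<subseteq> W \<and> card G = m \<and> (\<forall>x\<in>G. \<forall>y\<in>G. x < y \<longrightarrow> s \<le> y - (x::real))"
  using m
proof (induction m)
  case 0
  then show ?case by (intro exI[of _ "{}"]) auto
next
  case (Suc m)
  have "2 * s * real m \<le> 2 * s * real (Suc m)" using s by simp
  then obtain G where G: "finite G" "G \<subseteq> W" "card G = m" "\<forall>x\<in>G. \<forall>y\<in>G. x < y \<longrightarrow> s \<le> y - x"
    using Suc by fastforce
  let ?U = "\<Union>g\<in>G. {g - s<..<g + s}"
  have U: "?U \<in> lmeasurable" using G(1)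
  proof (intro fmeasurable.finite_UN)
    show "{g - s<..<g + s} \<in> lmeasurable" for g using lmeasurable_box[of "g - s" "g + s"] by simp
  qed
  have "measure lebesgue ?U \<le> (\<Sum>g\<in>G. measure lebesgue {g - s<..<g + s})"
    using G(1) by (intro measure_UNION_le) auto
  also have "\<dots> = 2 * s * real m" using s G(3) by simp
  finally have "measure lebesgue ?U < measure lebesgue W" using Suc.prems \<open>2 * s * real m \<le> 2 * s * real (Suc m)\<close> by linarith
  then have "\<not> W \<subseteq> ?U" using measure_mono_fmeasurable[of W ?U lebesgue] W U by (auto dest: fmeasurableD)
  then obtain x where x: "x \<in> W" "x \<notin> ?U" by blast
  then have sep: "s \<le> \<bar>x - g\<bar>" if "g \<in> G" for g using that by (auto simp: abs_if split: if_splits)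
  have "x \<notin> G" using sep s by force
  then show ?case
    using G x(1) sep by (intro exI[of _ "insert x G"]) (fastforce simp: abs_if split: if_splits)
qed

text \<open>Chebyshev's inequality: the part of W where |f| exceeds the level occupies at most half
  of W.\<close>

lemma sublevel_measure:
  fixes f :: "real \<Rightarrow> real"
  assumes f: "f \<in> borel_measurable lebesgue" "integrable lebesgue (\<lambda>x. (f x)\<^sup>2)"
    and W: "W \<in> lmeasurable" "W \<subseteq> \<omega>" "\<omega> \<in> sets lebesgue" and \<eta>: "0 < \<eta>"
    and le: "(LINT x|lebesgue. indicator \<omega> x * (f x)\<^sup>2) \<le> \<eta>\<^sup>2 * (measure lebesgue W / 2)"
  shows "{x \<in> W. \<bar>f x\<bar> \<le> \<eta>} \<in> lmeasurable" "measure lebesgue W / 2 \<le> measure lebesgue {x \<in> W. \<bar>f x\<bar> \<le> \<eta>}"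
proof -
  let ?S = "{x. \<bar>f x\<bar> \<le> \<eta>}"
  have S: "?S \<in> sets lebesgue"
  proof -
    have "{x \<in> space lebesgue. \<bar>f x\<bar> \<le> \<eta>} \<in> sets lebesgue" using f(1) by measurable
    then show ?thesis by simp
  qed
  have eq: "{x \<in> W. \<bar>f x\<bar> \<le> \<eta>} = W \<inter> ?S" by auto
  show G: "{x \<in> W. \<bar>f x\<bar> \<le> \<eta>} \<in> lmeasurable" unfolding eq by (rule fmeasurable_Int_fmeasurable[OF W(1) S])
  let ?B = "W - ?S"
  have B: "?B \<in> lmeasurable" by (rule fmeasurable_Diff[OF W(1) S])
  have iw: "integrable lebesgue (\<lambda>x. indicator \<omega> x * (f x)\<^sup>2)"
    using integrable_mult_indicator[OF W(3) f(2)] by simp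
  have "\<eta>\<^sup>2 * measure lebesgue ?B = (LINT x|lebesgue. \<eta>\<^sup>2 * indicator ?B x)" using B by simp
  also have "\<dots> \<le> (LINT x|lebesgue. indicator \<omega> x * (f x)\<^sup>2)"
  proof (rule integral_mono[OF _ iw])
    show "integrable lebesgue (\<lambda>x. \<eta>\<^sup>2 * indicator ?B x)"
      using B by (intro integrable_mult_right integrable_real_indicator) (auto simp: fmeasurable_def)
    fix x
    show "\<eta>\<^sup>2 * indicator ?B x \<le> indicator \<omega> x * (f x)\<^sup>2"
    proof (cases "x \<in> ?B")
      case True
      then have "\<eta>\<^sup>2 \<le> \<bar>f x\<bar>\<^sup>2" using \<eta> by (intro power_mono) auto
      moreover have "x \<in> \<omega>" using True W(2) by auto
      ultimately show ?thesis using True by simp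
    qed simp
  qed
  also have "\<dots> \<le> \<eta>\<^sup>2 * (measure lebesgue W / 2)" by (rule le)
  finally have "measure lebesgue ?B \<le> measure lebesgue W / 2" using \<eta> by simp
  moreover have "measure lebesgue W = measure lebesgue (W \<inter> ?S) + measure lebesgue ?B"
  proof -
    have "measure lebesgue (W - W \<inter> ?S) = measure lebesgue W - measure lebesgue (W \<inter> ?S)"
      using W(1) G[unfolded eq] by (intro measure_Diff) (auto simp: fmeasurable_def)
    moreover have "W - W \<inter> ?S = ?B" by blast
    ultimately show ?thesis by simp
  qed
  ultimately show "measure lebesgue W / 2 \<le> measure lebesgue {x \<in> W. \<bar>f x\<bar> \<le> \<eta>}" unfolding eq by linarith
qed

context spectral_sum
begin

theorem mass_le_observed:
  fixes A r M MA K \<tau> \<delta> :: real and n q m :: nat and \<omega> :: "real set"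
  assumes A: "0 < A" "A \<le> r" and M: "0 \<le> M" "\<And>t. \<bar>t\<bar> \<le> r \<Longrightarrow> V t \<le> M\<^sup>2"
    and MA: "0 \<le> MA" "\<And>t. \<bar>t\<bar> \<le> A \<Longrightarrow> V t \<le> MA\<^sup>2" and K: "K = cosh (MA * A)"
    and far: "\<And>x. r < \<bar>x\<bar> \<Longrightarrow> 2 * E \<le> V x"
    and n: "even n" "0 < n" and \<tau>: "1 \<le> \<tau>" "exp 1 * sqrt E \<le> \<tau>"
    and hn: "2 * sqrt (4 * r * (2 + E)) * exp (M * r + \<tau> * K\<^sup>2 * (2 * r)) \<le> exp (real n)"
    and q: "0 < q" "2 * A * K\<^sup>2 * \<tau> \<le> real q"
    and m: "((q + 1) * n + 2) * n < m"
    and \<omega>: "\<omega> \<in> sets lebesgue" and \<delta>: "\<delta> = measure lebesgue (\<omega> \<inter> {-A..A})" "0 < \<delta>"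
  shows "sqrt (mass 0) \<le> exp (real n) * (16 * K\<^sup>2 * (A + 1) * real m / \<delta>) ^ n *
    (sqrt (2 / \<delta>) * sqrt (LINT x|lebesgue. indicator \<omega> x * (p 0 x)\<^sup>2))"
proof -
  let ?W = "\<omega> \<inter> {-A..A}"
  let ?N = "LINT x|lebesgue. indicator \<omega> x * (p 0 x)\<^sup>2"
  let ?\<eta>0 = "sqrt (2 / \<delta>) * sqrt ?N"
  let ?D = "exp (real n) * (16 * K\<^sup>2 * (A + 1) * real m / \<delta>) ^ n"
  \<comment> \<open>With this spacing the greedy choice of m points uses less than the measure
    \<open>\<delta>\<close> / 2 left by Chebyshev's inequality. As \<open>\<delta>\<close> is at
    most 2A, s is at most 1, and 2 K^2 / s is the base of the n-th power in the claim.\<close>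
  define s where "s = \<delta> / (8 * (A + 1) * real m)"
  have m0: "0 < real m" using m by simp
  have K0: "0 < K" by (simp add: K)
  have D0: "0 < ?D"
    using m0 K0 A(1) \<delta>(2) by (intro mult_pos_pos zero_less_power divide_pos_pos exp_gt_zero) auto
  have N0: "0 \<le> ?N" by (rule Bochner_Integration.integral_nonneg) simp
  have Am: "{-A..A} \<in> lmeasurable" using lmeasurable_cbox[of "-A" A] by simp
  have Wm: "?W \<in> lmeasurable" using fmeasurable_Int_fmeasurable[OF Am \<omega>] by (simp only: Int_commute)
  have \<delta>A: "\<delta> \<le> 2 * A"
    using measure_mono_fmeasurable[OF Int_lower2 fmeasurableD[OF Wm] Am] A unfolding \<delta>(1) by simp
  have s0: "0 < s" using \<delta> A m0 by (simp add: s_def)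
  have s1: "s \<le> 1"
  proof -
    have "\<delta> \<le> 8 * (A + 1) * 1" using \<delta>A A by simp
    also have "\<dots> \<le> 8 * (A + 1) * real m" using A m by (intro mult_left_mono) auto
    finally show ?thesis using A m0 by (simp add: s_def)
  qed
  have sm: "2 * s * real m < \<delta> / 2"
  proof -
    have "2 * (\<delta> / (8 * a * b)) * b = \<delta> / (4 * a)" if "0 < a" "0 < b" for a b :: real
      using that by (simp add: field_simps)
    from this[of "A + 1" "real m"] have "2 * s * real m = \<delta> / (4 * (A + 1))" using m0 A by (simp add: s_def)
    also have "\<dots> < \<delta> / 2" using \<delta>(2) A by (intro divide_strict_left_mono) auto
    finally show ?thesis .
  qed
  \<comment> \<open>The level must be positive while the observed norm might be 0, so every level
    strictly above ?\<eta>0 is treated and then lowered to it in the limit.\<close>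
  have *: "sqrt (mass 0) \<le> ?D * \<eta>" if \<eta>: "?\<eta>0 < \<eta>" for \<eta>
  proof -
    have \<eta>p: "0 < \<eta>" using \<eta> N0 \<delta>(2) by (meson le_less_trans mult_nonneg_nonneg real_sqrt_ge_zero divide_nonneg_pos zero_le_numeral)
    have "?N \<le> \<eta>\<^sup>2 * (\<delta> / 2)"
    proof -
      have "?\<eta>0\<^sup>2 \<le> \<eta>\<^sup>2" using \<eta> N0 \<delta>(2) by (intro power_mono) auto
      moreover have "?\<eta>0\<^sup>2 = 2 / \<delta> * ?N" using N0 \<delta>(2) by (simp add: power_mult_distrib)
      ultimately show ?thesis using \<delta>(2) by (simp add: field_simps)
    qed
    then have W: "{x \<in> ?W. \<bar>p 0 x\<bar> \<le> \<eta>} \<in> lmeasurable" "\<delta> / 2 \<le> measure lebesgue {x \<in> ?W. \<bar>p 0 x\<bar> \<le> \<eta>}"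
      using sublevel_measure[OF p_meas(1) p_integrable Wm Int_lower1 \<omega> \<eta>p, of 0] unfolding \<delta>(1) by blast+
    obtain G where G: "finite G" "G \<subseteq> {x \<in> ?W. \<bar>p 0 x\<bar> \<le> \<eta>}" "card G = m"
        "\<forall>x\<in>G. \<forall>y\<in>G. x < y \<longrightarrow> s \<le> y - x"
      using separated_points[OF W(1) s0 less_le_trans[OF sm W(2)]] by blast
    have "sqrt (mass 0) \<le> exp (real n) * (2 * K\<^sup>2 / s) ^ n * \<eta>"
      by (rule mass_le_points[OF A M MA K far n \<tau> hn q G(1) _ s0 s1]) (use G m in auto)
    moreover have "2 * K\<^sup>2 / s = 16 * K\<^sup>2 * (A + 1) * real m / \<delta>" by (simp add: s_def)
    ultimately show ?thesis by simp
  qed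
  show ?thesis
  proof (rule field_le_epsilon)
    fix e :: real assume e: "0 < e"
    have "sqrt (mass 0) \<le> ?D * (?\<eta>0 + e / ?D)" using e D0 by (intro *) simp
    also have "\<dots> = ?D * ?\<eta>0 + e"
    proof -
      have "d * (h + e / d) = d * h + e" if "0 < d" for d h :: real using that by (simp add: distrib_left)
      from this[OF D0] show ?thesis .
    qed
    finally show "sqrt (mass 0) \<le> ?D * ?\<eta>0 + e" .
  qed
qed

end

section \<open>Reduction of complex spectral sums to real eigenfunctions\<close>

context potential
begin

lemma eig_zero: "eig \<mu> (\<lambda>_. 0) (\<lambda>_. 0)"
  by (auto simp: eig_def primitive_def)

lemma eig_add:
  assumes u: "eig \<mu> u u1" and v: "eig \<mu> v v1"
  shows "eig \<mu> (\<lambda>x. u x + v x) (\<lambda>x. u1 x + v1 x)"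
  unfolding eig_def
proof (intro conjI allI)
  show "((\<lambda>x. u x + v x) has_real_derivative u1 x + v1 x) (at x)" for x
    using u v by (auto simp: eig_def intro!: derivative_eq_intros)
  have "primitive (\<lambda>x. u1 x + v1 x) (\<lambda>x. (V x * u x - \<mu> * u x) + (V x * v x - \<mu> * v x))"
    using u v by (intro primitive_add) (auto simp: eig_def)
  then show "primitive (\<lambda>x. u1 x + v1 x) (\<lambda>x. V x * (u x + v x) - \<mu> * (u x + v x))"
    by (simp add: algebra_simps)
  have "integrable lebesgue (\<lambda>x. (u x)\<^sup>2 + (v x)\<^sup>2 + 2 * (u x * v x))"
    using u v eig_green(4)[OF u v] by (auto simp: eig_def)
  then show "integrable lebesgue (\<lambda>x. (u x + v x)\<^sup>2)" by (simp add: power2_sum mult.assoc)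
qed

lemma eig_cmult:
  assumes v: "eig \<mu> v v1" shows "eig \<mu> (\<lambda>x. c * v x) (\<lambda>x. c * v1 x)"
  unfolding eig_def
proof (intro conjI allI)
  show "((\<lambda>x. c * v x) has_real_derivative c * v1 x) (at x)" for x
    using v by (auto simp: eig_def intro!: derivative_eq_intros)
  have "primitive (\<lambda>x. c * v1 x) (\<lambda>x. c * (V x * v x - \<mu> * v x))"
    using v by (intro primitive_cmult) (auto simp: eig_def)
  then show "primitive (\<lambda>x. c * v1 x) (\<lambda>x. V x * (c * v x) - \<mu> * (c * v x))"
    by (simp add: algebra_simps)
  show "integrable lebesgue (\<lambda>x. (c * v x)\<^sup>2)" using v by (auto simp: eig_def power_mult_distrib)
qed

text \<open>c times the mass is at most the energy, which equals \<open>\<mu>\<close> times the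
  mass. This supplies the positive eigenvalues demanded by \<open>spectral_sum\<close>.\<close>

lemma eig_eq_zero:
  assumes v: "eig \<mu> v v1" and c: "0 < c" "\<And>x. c \<le> V x" and \<mu>: "\<mu> \<le> 0"
  shows "AE x in lebesgue. v x = 0"
proof -
  note i = eig_energy_integrable[OF v]
  have iv: "integrable lebesgue (\<lambda>x. (v x)\<^sup>2)" using v by (simp add: eig_def)
  have "c * (LINT x|lebesgue. (v x)\<^sup>2) = (LINT x|lebesgue. c * (v x)\<^sup>2)" by simp
  also have "\<dots> \<le> (LINT x|lebesgue. v1 x * v1 x + V x * (v x * v x))"
  proof (rule integral_mono)
    show "integrable lebesgue (\<lambda>x. v1 x * v1 x + V x * (v x * v x))"
      using i by (auto simp: power2_eq_square)
    fix x show "c * (v x)\<^sup>2 \<le> v1 x * v1 x + V x * (v x * v x)"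
      using mult_right_mono[OF c(2)[of x], of "(v x)\<^sup>2"] by (simp add: power2_eq_square add_increasing)
  qed (use iv in auto)
  also have "\<dots> = \<mu> * (LINT x|lebesgue. v x * v x)" by (rule eig_green(1)[OF v v])
  also have "\<dots> \<le> 0" using \<mu> by (intro mult_nonpos_nonneg Bochner_Integration.integral_nonneg) auto
  finally have "(LINT x|lebesgue. (v x)\<^sup>2) \<le> 0" using c(1) by (simp add: mult_le_0_iff)
  moreover have "0 \<le> (LINT x|lebesgue. (v x)\<^sup>2)" by simp
  ultimately have "(LINT x|lebesgue. (v x)\<^sup>2) = 0" by linarith
  then have "AE x in lebesgue. (v x)\<^sup>2 = 0"
    by (subst (asm) integral_nonneg_eq_0_iff_AE[OF iv]) auto
  then show ?thesis by simp
qed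

lemma loc_abs_cont_primitive:
  assumes "loc_abs_cont_deriv u v" and L: "bounded_linear (L :: complex \<Rightarrow> real)"
  shows "primitive (\<lambda>x. L (u x)) (\<lambda>x. L (v x))"
  unfolding primitive_def
proof (intro allI impI)
  fix a b :: real assume "a \<le> b"
  with assms(1) have i: "set_integrable lebesgue {a..b} v" and e: "u b - u a = (LINT x:{a..b}|lebesgue. v x)"
    by (auto simp: loc_abs_cont_deriv_def)
  have "(v has_integral (u b - u a)) {a..b}" unfolding e by (rule has_integral_set_lebesgue[OF i])
  from has_integral_linear[OF this L] show "((\<lambda>x. L (v x)) has_integral L (u b) - L (u a)) {a..b}"
    by (simp add: o_def linear_diff[OF bounded_linear.linear[OF L]])
qed

text \<open>L stands for Re or Im: as V and \<open>\<mu>\<close> are real, both parts satisfy the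
  equation separately. It holds only almost everywhere, which the integral form of
  \<open>primitive\<close> does not see.\<close>

lemma eig_of_eigenfunction:
  fixes L :: "complex \<Rightarrow> real"
  assumes L: "bounded_linear L" "\<And>a z. L (complex_of_real a * z) = a * L z" "\<And>z. \<bar>L z\<bar> \<le> cmod z"
    and l1: "loc_abs_cont_deriv u0 u1" and l2: "loc_abs_cont_deriv u1 u2"
    and \<phi>: "\<phi> \<in> L2_fun" "AE x in lebesgue. \<phi> x = u0 x"
    and ode: "AE x in lebesgue. complex_of_real \<mu> * \<phi> x = - u2 x + complex_of_real (V x) * \<phi> x"
  shows "eig \<mu> (\<lambda>x. L (u0 x)) (\<lambda>x. L (u1 x))"
  unfolding eig_def
proof (intro conjI allI)
  have p1: "primitive (\<lambda>x. L (u0 x)) (\<lambda>x. L (u1 x))" and p2: "primitive (\<lambda>x. L (u1 x)) (\<lambda>x. L (u2 x))"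
    using loc_abs_cont_primitive[OF _ L(1)] l1 l2 by auto
  show "((\<lambda>x. L (u0 x)) has_real_derivative L (u1 x)) (at x)" for x
    by (rule primitive_DERIV[OF p1 primitive_continuous[OF p2]])
  have "AE x in lebesgue. L (u2 x) = V x * L (u0 x) - \<mu> * L (u0 x)"
    using \<phi>(2) ode
  proof eventually_elim
    case (elim x)
    then have "u2 x = complex_of_real (V x) * u0 x - complex_of_real \<mu> * u0 x" by (simp add: algebra_simps)
    then show ?case by (simp add: L(2) linear_diff[OF bounded_linear.linear[OF L(1)]])
  qed
  then have ae: "AE x in lborel. L (u2 x) = V x * L (u0 x) - \<mu> * L (u0 x)" by (simp add: AE_completion_iff)
  show "primitive (\<lambda>x. L (u1 x)) (\<lambda>x. V x * L (u0 x) - \<mu> * L (u0 x))"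
    unfolding primitive_def
  proof (intro allI impI)
    fix a b :: real assume ab: "a \<le> b"
    show "((\<lambda>x. V x * L (u0 x) - \<mu> * L (u0 x)) has_integral L (u1 b) - L (u1 a)) {a..b}"
      using primitiveD[OF p2 ab] ae
      by (subst has_integral_AE[where g = "\<lambda>x. L (u2 x)"]) (auto elim: eventually_mono)
  qed
  show "integrable lebesgue (\<lambda>x. (L (u0 x))\<^sup>2)"
  proof (rule Bochner_Integration.integrable_bound)
    show "integrable lebesgue (\<lambda>x. (cmod (\<phi> x))\<^sup>2)" using \<phi>(1) by (simp add: L2_fun_def)
    have "(\<lambda>x. L (u0 x)) \<in> borel_measurable lebesgue"
      by (rule continuous_lebesgue_measurable[OF primitive_continuous[OF p1]])
    then show "(\<lambda>x. (L (u0 x))\<^sup>2) \<in> borel_measurable lebesgue" by measurable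
    show "AE x in lebesgue. norm ((L (u0 x))\<^sup>2) \<le> norm ((cmod (\<phi> x))\<^sup>2)"
      using \<phi>(2)
    proof eventually_elim
      case (elim x)
      have "\<bar>L (u0 x)\<bar>\<^sup>2 \<le> (cmod (u0 x))\<^sup>2" by (intro power_mono L(3)) simp
      then show ?case using elim by simp
    qed
  qed
qed

text \<open>The real and the imaginary part share one set of eigenvalues; a part absent at some
  eigenvalue is represented there by the zero function.\<close>

definition spectral_pair :: "real \<Rightarrow> (real \<Rightarrow> real) \<Rightarrow> (real \<Rightarrow> real) \<Rightarrow> bool" where
  "spectral_pair E f g \<longleftrightarrow> (\<exists>F v v1 y y1. finite F \<and> (\<forall>\<mu>\<in>F. 0 < \<mu> \<and> \<mu> \<le> E) \<and>
     (\<forall>\<mu>\<in>F. eig \<mu> (v \<mu>) (v1 \<mu>) \<and> eig \<mu> (y \<mu>) (y1 \<mu>)) \<and>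
     f = (\<lambda>x. \<Sum>\<mu>\<in>F. v \<mu> x) \<and> g = (\<lambda>x. \<Sum>\<mu>\<in>F. y \<mu> x))"

lemma spectral_pair_insert:
  assumes "spectral_pair E f g" "eig \<mu> a a1" "eig \<mu> b b1" "0 < \<mu>" "\<mu> \<le> E"
  shows "spectral_pair E (\<lambda>x. a x + f x) (\<lambda>x. b x + g x)"
proof -
  obtain F v v1 y y1 where F: "finite F" "\<forall>\<mu>\<in>F. 0 < \<mu> \<and> \<mu> \<le> E"
    and e: "\<forall>\<mu>\<in>F. eig \<mu> (v \<mu>) (v1 \<mu>) \<and> eig \<mu> (y \<mu>) (y1 \<mu>)"
    and fg: "f = (\<lambda>x. \<Sum>\<mu>\<in>F. v \<mu> x)" "g = (\<lambda>x. \<Sum>\<mu>\<in>F. y \<mu> x)"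
    using assms(1) unfolding spectral_pair_def by blast
  \<comment> \<open>The new eigenvalue may already belong to F. Then both summands contribute, and
    the new function is merged into the old one instead of producing a second entry for the same
    eigenvalue.\<close>
  define ext where "ext = (\<lambda>(w :: real \<Rightarrow> real \<Rightarrow> real) c \<nu> x. (if \<nu> = \<mu> then c x else 0) + (if \<nu> \<in> F then w \<nu> x else 0))"
  have ext_eig: "eig \<nu> (ext w c \<nu>) (ext w1 c1 \<nu>)"
    if "eig \<mu> c c1" "\<forall>\<nu>\<in>F. eig \<nu> (w \<nu>) (w1 \<nu>)" for w w1 c c1 \<nu>
  proof -
    have "eig \<nu> (\<lambda>x. if \<nu> = \<mu> then c x else 0) (\<lambda>x. if \<nu> = \<mu> then c1 x else 0)"
      using that(1) eig_zero by (cases "\<nu> = \<mu>") auto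
    moreover have "eig \<nu> (\<lambda>x. if \<nu> \<in> F then w \<nu> x else 0) (\<lambda>x. if \<nu> \<in> F then w1 \<nu> x else 0)"
      using that(2) eig_zero by (cases "\<nu> \<in> F") auto
    ultimately show ?thesis unfolding ext_def by (rule eig_add)
  qed
  have ext_sum: "c x + (\<Sum>\<nu>\<in>F. w \<nu> x) = (\<Sum>\<nu>\<in>insert \<mu> F. ext w c \<nu> x)" for w c x
  proof -
    have "(\<Sum>\<nu>\<in>insert \<mu> F. if \<nu> \<in> F then w \<nu> x else 0) = (\<Sum>\<nu>\<in>F. w \<nu> x)"
      using F(1) by (intro sum.mono_neutral_cong_right) auto
    moreover have "(\<Sum>\<nu>\<in>insert \<mu> F. if \<nu> = \<mu> then c x else 0) = c x" using F(1) by simp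
    ultimately show ?thesis by (simp only: ext_def sum.distrib)
  qed
  have eigs: "\<forall>\<nu>\<in>insert \<mu> F. eig \<nu> (ext v a \<nu>) (ext v1 a1 \<nu>) \<and> eig \<nu> (ext y b \<nu>) (ext y1 b1 \<nu>)"
    using ext_eig[OF assms(2), of v v1] ext_eig[OF assms(3), of y y1] e by blast
  show ?thesis
    unfolding spectral_pair_def
    by (rule exI[of _ "insert \<mu> F"], rule exI[of _ "ext v a"], rule exI[of _ "ext v1 a1"],
        rule exI[of _ "ext y b"], rule exI[of _ "ext y1 b1"])
      (use F assms(4,5) eigs in \<open>simp add: fg ext_sum\<close>)
qed

lemma spectral_range_pair:
  assumes c: "0 < c" "\<And>x. c \<le> V x" and \<phi>: "\<phi> \<in> spectral_range V E"
  shows "\<exists>f g. spectral_pair E f g \<and> (AE x in lebesgue. \<phi> x = Complex (f x) (g x))"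
  using \<phi> unfolding spectral_range_def
proof (induction rule: cfun.span_induct_alt)
  case base
  have "spectral_pair E (\<lambda>_. 0) (\<lambda>_. 0)" unfolding spectral_pair_def by (rule exI[of _ "{}"]) auto
  then show ?case by (intro exI[of _ "\<lambda>_. 0"]) (auto simp: zero_complex.code)
next
  case (step k \<psi> \<phi>)
  obtain f g where fg: "spectral_pair E f g" "AE x in lebesgue. \<phi> x = Complex (f x) (g x)" using step by blast
  obtain \<mu> where \<mu>: "\<mu> \<le> E" "eigenfunction V \<mu> \<psi>" using step by blast
  then have nz: "\<not> (AE x in lebesgue. \<psi> x = 0)" and so: "schrodinger_op V \<psi> (\<lambda>x. complex_of_real \<mu> * \<psi> x)"
    by (auto simp: eigenfunction_def)
  obtain u0 u1 u2 where u: "\<psi> \<in> L2_fun" "AE x in lebesgue. \<psi> x = u0 x"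
    "loc_abs_cont_deriv u0 u1" "loc_abs_cont_deriv u1 u2"
    "AE x in lebesgue. complex_of_real \<mu> * \<psi> x = - u2 x + complex_of_real (V x) * \<psi> x"
    using so unfolding schrodinger_op_def by blast
  have re: "eig \<mu> (\<lambda>x. Re (u0 x)) (\<lambda>x. Re (u1 x))"
    by (rule eig_of_eigenfunction[OF bounded_linear_Re _ _ u(3,4,1,2,5)]) (auto simp: abs_Re_le_cmod)
  have im: "eig \<mu> (\<lambda>x. Im (u0 x)) (\<lambda>x. Im (u1 x))"
    by (rule eig_of_eigenfunction[OF bounded_linear_Im _ _ u(3,4,1,2,5)]) (auto simp: abs_Im_le_cmod)
  have \<mu>0: "0 < \<mu>"
  proof (rule ccontr)
    assume "\<not> 0 < \<mu>"
    then have "\<mu> \<le> 0" by simp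
    from eig_eq_zero[OF re c this] eig_eq_zero[OF im c this] u(2)
    have "AE x in lebesgue. \<psi> x = 0" by eventually_elim (simp add: complex_eq_iff)
    with nz show False by simp
  qed
  let ?a = "\<lambda>x. Re k * Re (u0 x) + (- Im k) * Im (u0 x)"
  let ?b = "\<lambda>x. Re k * Im (u0 x) + Im k * Re (u0 x)"
  have "spectral_pair E (\<lambda>x. ?a x + f x) (\<lambda>x. ?b x + g x)"
    by (rule spectral_pair_insert[OF fg(1) eig_add[OF eig_cmult[OF re] eig_cmult[OF im]]
        eig_add[OF eig_cmult[OF im] eig_cmult[OF re]] \<mu>0 \<mu>(1)])
  moreover have "AE x in lebesgue. ((\<lambda>x. k * \<psi> x) + \<phi>) x = Complex (?a x + f x) (?b x + g x)"
    using u(2) fg(2) by eventually_elim (simp add: complex_eq_iff)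
  ultimately show ?case by blast
qed

end

section \<open>Tracking the constants\<close>

text \<open>The bound is required on the whole half-line from c and not just for large E, because
  the final constant is uniform in E. It is used with c = c1, below which there are no nonzero
  spectral sums.\<close>

definition power_bounded :: "real \<Rightarrow> real \<Rightarrow> (real \<Rightarrow> real) \<Rightarrow> bool" where
  "power_bounded c q f \<longleftrightarrow> (\<exists>C\<ge>0. \<forall>E\<ge>c. \<bar>f E\<bar> \<le> C * E powr q)"

lemma power_boundedI: "0 \<le> C \<Longrightarrow> (\<And>E. c \<le> E \<Longrightarrow> \<bar>f E\<bar> \<le> C * E powr q) \<Longrightarrow> power_bounded c q f"
  unfolding power_bounded_def by blast

lemma power_bounded_powr: "power_bounded c q (\<lambda>E. E powr q)"
  by (rule power_boundedI[of 1]) auto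

lemma power_bounded_mono:
  assumes "0 < c" "power_bounded c p f" "p \<le> q" shows "power_bounded c q f"
proof -
  obtain C where C: "0 \<le> C" "\<And>E. c \<le> E \<Longrightarrow> \<bar>f E\<bar> \<le> C * E powr p" using assms(2) unfolding power_bounded_def by blast
  show ?thesis
  proof (rule power_boundedI[of "C * c powr (p - q)"])
    fix E assume E: "c \<le> E"
    have "\<bar>f E\<bar> \<le> C * E powr p" by (rule C(2)[OF E])
    also have "E powr p = E powr (p - q) * E powr q" by (simp add: powr_add[symmetric])
    also have "C * (E powr (p - q) * E powr q) \<le> C * (c powr (p - q) * E powr q)"
      using assms(1,3) E C(1) by (intro mult_left_mono mult_right_mono powr_mono2') auto
    finally show "\<bar>f E\<bar> \<le> C * c powr (p - q) * E powr q" by (simp only: mult.assoc)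
  qed (use C in simp)
qed

lemma power_bounded_const: "0 < c \<Longrightarrow> 0 \<le> q \<Longrightarrow> power_bounded c q (\<lambda>_. k)"
  by (rule power_bounded_mono[of c 0]) (auto intro!: power_boundedI[of "\<bar>k\<bar>"])

lemma power_bounded_add:
  assumes "power_bounded c q f" "power_bounded c q g" shows "power_bounded c q (\<lambda>E. f E + g E)"
proof -
  obtain C D where C: "0 \<le> C" "\<And>E. c \<le> E \<Longrightarrow> \<bar>f E\<bar> \<le> C * E powr q"
    and D: "0 \<le> D" "\<And>E. c \<le> E \<Longrightarrow> \<bar>g E\<bar> \<le> D * E powr q" using assms unfolding power_bounded_def by metis
  show ?thesis
  proof (rule power_boundedI[of "C + D"])
    fix E assume "c \<le> E"
    then show "\<bar>f E + g E\<bar> \<le> (C + D) * E powr q"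
      using C(2)[of E] D(2)[of E] abs_triangle_ineq[of "f E" "g E"] by (simp add: distrib_right)
  qed (use C D in simp)
qed

lemma power_bounded_mult:
  assumes "power_bounded c p f" "power_bounded c q g" shows "power_bounded c (p + q) (\<lambda>E. f E * g E)"
proof -
  obtain C D where C: "0 \<le> C" "\<And>E. c \<le> E \<Longrightarrow> \<bar>f E\<bar> \<le> C * E powr p"
    and D: "0 \<le> D" "\<And>E. c \<le> E \<Longrightarrow> \<bar>g E\<bar> \<le> D * E powr q" using assms unfolding power_bounded_def by metis
  show ?thesis
  proof (rule power_boundedI[of "C * D"])
    fix E assume E: "c \<le> E"
    have "\<bar>f E * g E\<bar> \<le> (C * E powr p) * (D * E powr q)"
      unfolding abs_mult using C D E by (intro mult_mono) auto
    also have "\<dots> = C * D * E powr (p + q)" by (simp add: powr_add mult_ac)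
    finally show "\<bar>f E * g E\<bar> \<le> C * D * E powr (p + q)" .
  qed (use C D in simp)
qed

lemma power_bounded_cmult:
  assumes "power_bounded c q f" shows "power_bounded c q (\<lambda>E. k * f E)"
proof -
  obtain C where C: "0 \<le> C" "\<And>E. c \<le> E \<Longrightarrow> \<bar>f E\<bar> \<le> C * E powr q" using assms unfolding power_bounded_def by blast
  show ?thesis
    by (rule power_boundedI[of "\<bar>k\<bar> * C"]) (use C in \<open>auto simp: abs_mult mult.assoc intro: mult_left_mono\<close>)
qed

lemma power_bounded_le:
  assumes "power_bounded c q f" "\<And>E. c \<le> E \<Longrightarrow> \<bar>g E\<bar> \<le> \<bar>f E\<bar>" shows "power_bounded c q g"
  using assms unfolding power_bounded_def by (meson order_trans)

lemma power_bounded_powr_comp: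
  assumes "power_bounded c q f" "0 \<le> a" "0 < c"
  shows "power_bounded c (q * a) (\<lambda>E. \<bar>f E\<bar> powr a)"
proof -
  obtain C where C: "0 \<le> C" "\<And>E. c \<le> E \<Longrightarrow> \<bar>f E\<bar> \<le> C * E powr q" using assms(1) unfolding power_bounded_def by blast
  show ?thesis
  proof (rule power_boundedI[of "C powr a"])
    fix E assume E: "c \<le> E"
    have "\<bar>f E\<bar> powr a \<le> (C * E powr q) powr a" using C(2)[OF E] assms(2) by (intro powr_mono2) auto
    also have "\<dots> = C powr a * E powr (q * a)" using C(1) by (simp add: powr_mult powr_powr)
    finally show "\<bar>\<bar>f E\<bar> powr a\<bar> \<le> C powr a * E powr (q * a)" by simp
  qed simp
qed

text \<open>On the range considered ln(E + 1) is at least ln(c + 1) > 0, so it absorbs constants as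
  well as |ln E|. Applied to sigma, this produces the logarithm of the theorem.\<close>

lemma power_bounded_ln:
  assumes f: "power_bounded c q f" and c: "0 < c" and pos: "\<And>E. c \<le> E \<Longrightarrow> 0 < f E"
  shows "\<exists>C\<ge>0. \<forall>E\<ge>c. ln (f E) \<le> C * ln (E + 1)"
proof -
  obtain C where C: "0 \<le> C" "\<And>E. c \<le> E \<Longrightarrow> \<bar>f E\<bar> \<le> C * E powr q" using f unfolding power_bounded_def by blast
  let ?D = "\<bar>ln C\<bar> / ln (c + 1) + \<bar>q\<bar> * (1 + \<bar>ln c\<bar> / ln (c + 1))"
  have lc: "0 < ln (c + 1)" using c by simp
  show ?thesis
  proof (intro exI[of _ ?D] conjI allI impI)
    fix E assume E: "c \<le> E"
    have E0: "0 < E" using c E by simp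
    have lE: "ln (c + 1) \<le> ln (E + 1)" using c E by simp
    have scale: "x \<le> x / ln (c + 1) * ln (E + 1)" if "0 \<le> x" for x
    proof -
      have "x = x / ln (c + 1) * ln (c + 1)" using lc by simp
      also have "\<dots> \<le> x / ln (c + 1) * ln (E + 1)" using that lc lE by (intro mult_left_mono) auto
      finally show ?thesis .
    qed
    have fE: "f E \<le> C * E powr q" using C(2)[OF E] pos[OF E] by simp
    with pos[OF E] have C0: "0 < C" using C(1) by (cases "C = 0") auto
    have "ln (f E) \<le> ln (C * E powr q)" using fE pos[OF E] by simp
    also have "\<dots> = ln C + q * ln E" using C0 E0 by (simp add: ln_mult ln_powr)
    also have "\<dots> \<le> \<bar>ln C\<bar> + \<bar>q\<bar> * \<bar>ln E\<bar>"
      by (intro add_mono) (auto simp: abs_mult[symmetric])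
    also have "\<dots> \<le> \<bar>ln C\<bar> + \<bar>q\<bar> * (ln (E + 1) + \<bar>ln c\<bar>)"
    proof (intro add_left_mono mult_left_mono)
      have "ln E \<le> ln (E + 1)" "ln c \<le> ln E" "0 \<le> ln (E + 1)" using E0 c E by auto
      then show "\<bar>ln E\<bar> \<le> ln (E + 1) + \<bar>ln c\<bar>" by (auto simp: abs_if)
    qed simp
    also have "\<dots> \<le>
        \<bar>ln C\<bar> / ln (c + 1) * ln (E + 1) + \<bar>q\<bar> * (ln (E + 1) + \<bar>ln c\<bar> / ln (c + 1) * ln (E + 1))"
      by (intro add_mono mult_left_mono order_refl scale) auto
    also have "\<dots> = ?D * ln (E + 1)" by (simp add: distrib_left distrib_right mult.assoc)
    finally show "ln (f E) \<le> ?D * ln (E + 1)" .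
  qed (use lc in auto)
qed

text \<open>Moves the algebraic prefactor of \<open>hn\<close> into the exponent, where r and
  sqrt(E) are dominated by the terms already present.\<close>

lemma two_sqrt_le_exp:
  assumes "0 \<le> r" "0 \<le> E" shows "2 * sqrt (4 * r * (2 + E)) \<le> exp (3 + r + sqrt E)"
proof -
  have a: "sqrt r \<le> exp r"
  proof -
    have "r \<le> (1 + r)\<^sup>2" using assms by (simp add: power2_eq_square algebra_simps)
    then have "sqrt r \<le> 1 + r" using assms by (simp add: real_le_lsqrt)
    then show ?thesis using exp_ge_add_one_self[of r] by linarith
  qed
  have b: "sqrt (2 + E) \<le> exp (1 + sqrt E)"
  proof -
    have "2 + E \<le> (2 + sqrt E)\<^sup>2" using assms by (simp add: power2_eq_square algebra_simps)
    then have "sqrt (2 + E) \<le> 2 + sqrt E" using assms by (simp add: real_le_lsqrt)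
    then show ?thesis using exp_ge_add_one_self[of "1 + sqrt E"] by linarith
  qed
  have d: "4 \<le> exp (2::real)"
  proof -
    have "2 * 2 \<le> exp (1::real) * exp 1" using exp_ge_add_one_self[of 1] by (intro mult_mono) auto
    then show ?thesis by (simp add: exp_add[symmetric])
  qed
  have "2 * sqrt (4 * r * (2 + E)) = 4 * (sqrt r * sqrt (2 + E))" by (simp add: real_sqrt_mult)
  also have "\<dots> \<le> exp 2 * (exp r * exp (1 + sqrt E))"
    using a b d assms by (intro mult_mono) auto
  also have "\<dots> = exp (3 + r + sqrt E)" by (simp add: exp_add[symmetric])
  finally show ?thesis .
qed

text \<open>Origin of A, which depends on \<open>\<omega>\<close> alone; consequently K depends only
  on c2, \<open>\<beta>2\<close> and \<open>\<omega>\<close>.\<close>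

lemma positive_measure_interval:
  fixes \<omega> :: "real set"
  assumes "\<omega> \<in> sets lebesgue" "emeasure lebesgue \<omega> > 0"
  shows "\<exists>A\<ge>1. 0 < measure lebesgue (\<omega> \<inter> {-A..A})"
proof (rule ccontr)
  assume no: "\<not> ?thesis"
  let ?S = "\<lambda>n. \<omega> \<inter> {- real (Suc n)..real (Suc n)}"
  have "?S n \<in> null_sets lebesgue" for n
  proof -
    have m: "?S n \<in> lmeasurable"
      using fmeasurable_Int_fmeasurable[OF _ assms(1), of "{- real (Suc n)..real (Suc n)}"]
        lmeasurable_cbox[of "- real (Suc n)" "real (Suc n)"] by (simp only: Int_commute box_real)
    have "1 \<le> real (Suc n)" by simp
    with no have "\<not> 0 < measure lebesgue (?S n)" by blast
    then have "measure lebesgue (?S n) = 0" using measure_nonneg[of lebesgue "?S n"] by linarith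
    then have "emeasure lebesgue (?S n) = 0" using emeasure_eq_measure2[OF m] by (simp only: ennreal_0)
    then show ?thesis by (rule null_setsI[OF _ fmeasurableD[OF m]])
  qed
  then have "(\<Union>n. ?S n) \<in> null_sets lebesgue" by (rule null_sets_UN)
  moreover have "(\<Union>n. ?S n) = \<omega>"
  proof -
    have "\<exists>n. \<bar>x\<bar> \<le> real (Suc n)" for x :: real
    proof -
      obtain n where "\<bar>x\<bar> \<le> real n" using real_arch_simple by blast
      then have "\<bar>x\<bar> \<le> real (Suc n)" by simp
      then show ?thesis ..
    qed
    then have "\<exists>n. x \<in> {- real (Suc n)..real (Suc n)}" for x
      by (metis abs_le_iff atLeastAtMost_iff minus_le_iff)
    then show ?thesis by blast
  qed
  ultimately show False using assms(2) by auto
qed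

lemma (in spectral_sum) p_0: "p 0 x = (\<Sum>\<mu>\<in>F. v \<mu> x)"
  by (simp add: p_def)

lemma real_spectral_inequality:
  fixes c1 c2 \<beta>1 \<beta>2 :: real and \<omega> :: "real set"
  assumes c: "0 < c1" "0 < c2" and \<beta>: "0 < \<beta>1" "0 < \<beta>2" "\<beta>1 \<le> \<beta>2"
    and \<omega>: "\<omega> \<in> sets lebesgue" "emeasure lebesgue \<omega> > 0"
  shows "\<exists>C\<ge>0. \<forall>V E F v v1. (\<forall>x. c1 * (\<bar>x\<bar> + 1) powr \<beta>1 \<le> V x \<and> V x \<le> c2 * (\<bar>x\<bar> + 1) powr \<beta>2) \<longrightarrow>
     c1 \<le> E \<longrightarrow> spectral_sum V E F v v1 \<longrightarrow>
     sqrt (LINT x|lebesgue. (\<Sum>\<mu>\<in>F. v \<mu> x)\<^sup>2) \<le>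
       exp (C * E powr (1 / \<beta>1 + \<beta>2 / (2 * \<beta>1)) * ln (E + 1)) *
       sqrt (LINT x|lebesgue. indicator \<omega> x * (\<Sum>\<mu>\<in>F. v \<mu> x)\<^sup>2)"
proof -
  obtain A where A: "1 \<le> A" "0 < measure lebesgue (\<omega> \<inter> {-A..A})"
    using positive_measure_interval[OF \<omega>] by blast
  define \<delta> where "\<delta> = measure lebesgue (\<omega> \<inter> {-A..A})"
  define \<gamma> where "\<gamma> = 1 / \<beta>1 + \<beta>2 / (2 * \<beta>1)"
  define MA where "MA = sqrt c2 * (A + 1) powr (\<beta>2 / 2)"
  define K where "K = cosh (MA * A)"
  \<comment> \<open>The first summand solves c1 r^\<beta>1 = 2E, so V is at least 2E outside [-r,r];
    adding A keeps the sampling interval inside. M and MA are square roots of the upper bound of V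
    on [-r,r] and [-A,A].\<close>
  define r where "r E = (2 * E / c1) powr (1 / \<beta>1) + A" for E
  define M where "M E = sqrt c2 * (r E + 1) powr (\<beta>2 / 2)" for E
  define \<tau> where "\<tau> E = 1 + exp 1 * sqrt E" for E
  \<comment> \<open>The exponent demanded by \<open>hn\<close> once the prefactor has been moved
    into it. Doubling its ceiling below makes n even and keeps it at least X.\<close>
  define X where "X E = M E * r E + \<tau> E * K\<^sup>2 * (2 * r E) + (3 + r E + sqrt E)" for E
  define n where "n E = 2 * nat \<lceil>X E\<rceil>" for E
  define q where "q E = nat \<lceil>2 * A * K\<^sup>2 * \<tau> E\<rceil>" for E
  define m where "m E = ((q E + 1) * n E + 2) * n E + 1" for E
  define \<sigma> where "\<sigma> E = 16 * K\<^sup>2 * (A + 1) * real (m E) / \<delta>" for E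
  have \<delta>0: "0 < \<delta>" using A by (simp add: \<delta>_def)
  have K1: "1 \<le> K" by (simp add: K_def cosh_real_ge_1)
  have r_ge: "A \<le> r E" for E by (simp add: r_def)
  have r0: "0 \<le> r E" for E using r_ge[of E] A by simp
  have M0: "0 \<le> M E" for E using c by (simp add: M_def)
  have MA0: "0 \<le> MA" using c by (simp add: MA_def)
  have \<tau>1: "1 \<le> \<tau> E" if "0 \<le> E" for E using that by (simp add: \<tau>_def)
  have X3: "3 \<le> X E" if "0 \<le> E" for E
    using M0[of E] r0[of E] \<tau>1[OF that] that by (simp add: X_def)
  have m0: "0 < real (m E)" for E
  proof -
    have "0 < m E" unfolding m_def by (rule trans_less_add2) (rule zero_less_one)
    then show ?thesis by simp
  qed
  have \<sigma>0: "0 < \<sigma> E" for E using m0[of E] K1 A \<delta>0 by (simp add: \<sigma>_def)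
  have sq: "(sqrt c2 * y powr (\<beta>2 / 2))\<^sup>2 = c2 * y powr \<beta>2" for y
  proof -
    have "(y powr (\<beta>2 / 2))\<^sup>2 = y powr \<beta>2"
      by (simp only: power2_eq_square powr_add[symmetric] field_sum_of_halves)
    then show ?thesis using c by (simp add: power_mult_distrib)
  qed
  have main: "sqrt (LINT x|lebesgue. (\<Sum>\<mu>\<in>F. v \<mu> x)\<^sup>2) \<le> exp (real (n E)) * (\<sigma> E) ^ n E *
      (sqrt (2 / \<delta>) * sqrt (LINT x|lebesgue. indicator \<omega> x * (\<Sum>\<mu>\<in>F. v \<mu> x)\<^sup>2))"
    if V: "\<forall>x. c1 * (\<bar>x\<bar> + 1) powr \<beta>1 \<le> V x \<and> V x \<le> c2 * (\<bar>x\<bar> + 1) powr \<beta>2"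
      and E: "c1 \<le> E" and ss: "spectral_sum V E F v v1" for V E F v v1
  proof -
    interpret spectral_sum V E F v v1 by (rule ss)
    have E0: "0 \<le> E" using E c by simp
    have Vle: "V t \<le> (sqrt c2 * (R + 1) powr (\<beta>2 / 2))\<^sup>2" if "\<bar>t\<bar> \<le> R" for t R
    proof -
      have "V t \<le> c2 * (\<bar>t\<bar> + 1) powr \<beta>2" using V by blast
      also have "\<dots> \<le> c2 * (R + 1) powr \<beta>2" using that c \<beta> by (intro mult_left_mono powr_mono2) auto
      finally show ?thesis by (simp only: sq)
    qed
    have far: "2 * E \<le> V x" if "r E < \<bar>x\<bar>" for x
    proof -
      have "(2 * E / c1) powr (1 / \<beta>1) \<le> \<bar>x\<bar> + 1" using that A by (simp add: r_def)
      then have "((2 * E / c1) powr (1 / \<beta>1)) powr \<beta>1 \<le> (\<bar>x\<bar> + 1) powr \<beta>1" using \<beta> by (intro powr_mono2) auto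
      then have "2 * E / c1 \<le> (\<bar>x\<bar> + 1) powr \<beta>1" using \<beta> E c by (simp add: powr_powr)
      then have "2 * E \<le> c1 * (\<bar>x\<bar> + 1) powr \<beta>1" using c by (simp add: field_simps)
      then show ?thesis using V order_trans by blast
    qed
    have nX: "X E \<le> real (n E)"
    proof -
      have "X E \<le> real (nat \<lceil>X E\<rceil>)" by (rule real_nat_ceiling_ge)
      then show ?thesis by (simp add: n_def)
    qed
    have n0: "0 < n E" using nX X3[OF E0] by (cases "n E") auto
    have hn: "2 * sqrt (4 * r E * (2 + E)) * exp (M E * r E + \<tau> E * K\<^sup>2 * (2 * r E)) \<le> exp (real (n E))"
    proof -
      have "2 * sqrt (4 * r E * (2 + E)) * exp (M E * r E + \<tau> E * K\<^sup>2 * (2 * r E)) \<le>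
          exp (3 + r E + sqrt E) * exp (M E * r E + \<tau> E * K\<^sup>2 * (2 * r E))"
        using two_sqrt_le_exp[OF r0 E0] by (intro mult_right_mono) auto
      also have "\<dots> = exp (X E)" by (simp add: exp_add[symmetric] X_def add_ac)
      finally show ?thesis using nX by (meson exp_le_cancel_iff order_trans)
    qed
    have q1: "2 * A * K\<^sup>2 * \<tau> E \<le> real (q E)" unfolding q_def by (rule real_nat_ceiling_ge)
    have "0 < 2 * A * K\<^sup>2 * \<tau> E" using A K1 \<tau>1[OF E0] by (intro mult_pos_pos) auto
    with q1 have q0: "0 < q E" by (metis of_nat_0_less_iff less_le_trans)
    have A0: "0 < A" using A by simp
    have ev: "even (n E)" by (simp add: n_def)
    have mlt: "((q E + 1) * n E + 2) * n E < m E" by (simp add: m_def)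
    have \<tau>e: "exp 1 * sqrt E \<le> \<tau> E" by (simp add: \<tau>_def)
    show ?thesis
      using mass_le_observed[OF A0 r_ge M0 _ MA0 _ K_def far ev n0 \<tau>1[OF E0] \<tau>e hn q0 q1 mlt \<omega>(1) \<delta>_def \<delta>0]
        Vle unfolding mass_def p_0 \<sigma>_def M_def MA_def by blast
  qed
  have \<gamma>0: "0 \<le> \<gamma>" using \<beta> by (simp add: \<gamma>_def)
  note pbI = power_bounded_add power_bounded_cmult power_bounded_const
  \<comment> \<open>Here \<open>\<beta>1 \<le> \<beta>2\<close> enters: tau r, of order E^(1/2 +
    1/\<beta>1), is no larger than M r.\<close>
  have e1: "1 / 2 \<le> \<beta>2 / (2 * \<beta>1)" using \<beta> by (simp add: field_simps)
  have le1: "1 / \<beta>1 \<le> \<gamma>" "1 / 2 + 1 / \<beta>1 \<le> \<gamma>" "1 / 2 \<le> \<gamma>" "\<beta>2 / (2 * \<beta>1) + 1 / \<beta>1 \<le> \<gamma>"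
    using e1 \<beta> by (auto simp: \<gamma>_def intro: add_increasing)
  have pb_r: "power_bounded c1 (1 / \<beta>1) r"
  proof -
    have "power_bounded c1 (1 / \<beta>1) (\<lambda>E. (2 / c1) powr (1 / \<beta>1) * E powr (1 / \<beta>1) + A)"
      using c \<beta> by (intro pbI power_bounded_powr) auto
    then show ?thesis
      by (rule power_bounded_le) (use c in \<open>auto simp: r_def powr_mult[symmetric]\<close>)
  qed
  have pb_M: "power_bounded c1 (\<beta>2 / (2 * \<beta>1)) M"
  proof -
    have "power_bounded c1 (1 / \<beta>1 * (\<beta>2 / 2)) (\<lambda>E. \<bar>r E + 1\<bar> powr (\<beta>2 / 2))"
      using c \<beta> by (intro power_bounded_powr_comp pbI pb_r) auto
    then have "power_bounded c1 (\<beta>2 / (2 * \<beta>1)) (\<lambda>E. sqrt c2 * \<bar>r E + 1\<bar> powr (\<beta>2 / 2))"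
      by (intro power_bounded_cmult) (simp add: mult.commute)
    then show ?thesis by (rule power_bounded_le) (use r0 in \<open>auto simp: M_def\<close>)
  qed
  have pb_sqrt: "power_bounded c1 (1 / 2) sqrt"
    by (rule power_bounded_le[OF power_bounded_powr]) (use c in \<open>auto simp: powr_half_sqrt\<close>)
  have pb_\<tau>: "power_bounded c1 (1 / 2) \<tau>"
    unfolding \<tau>_def[abs_def] using c by (intro pbI pb_sqrt) auto
  have pb_X: "power_bounded c1 \<gamma> X"
  proof -
    have 1: "power_bounded c1 \<gamma> (\<lambda>E. M E * r E)"
      by (rule power_bounded_mono[OF c(1) power_bounded_mult[OF pb_M pb_r] le1(4)])
    have "power_bounded c1 \<gamma> (\<lambda>E. \<tau> E * r E)"
      by (rule power_bounded_mono[OF c(1) power_bounded_mult[OF pb_\<tau> pb_r] le1(2)])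
    then have "power_bounded c1 \<gamma> (\<lambda>E. 2 * K\<^sup>2 * (\<tau> E * r E))" by (rule power_bounded_cmult)
    then have 2: "power_bounded c1 \<gamma> (\<lambda>E. \<tau> E * K\<^sup>2 * (2 * r E))" by (simp add: mult_ac)
    show ?thesis
      unfolding X_def[abs_def]
      by (intro pbI 1 2 c \<gamma>0 power_bounded_mono[OF c(1) pb_r le1(1)] power_bounded_mono[OF c(1) pb_sqrt le1(3)])
  qed
  have pb_n: "power_bounded c1 \<gamma> (\<lambda>E. real (n E))"
  proof -
    have "power_bounded c1 \<gamma> (\<lambda>E. 2 * (X E + 1))" by (intro pbI pb_X c \<gamma>0)
    then show ?thesis
    proof (rule power_bounded_le)
      fix E assume "c1 \<le> E"
      then have "3 \<le> X E" using c X3 by simp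
      then have k: "real (nat \<lceil>X E\<rceil>) \<le> X E + 1" by linarith
      have "real (n E) = 2 * real (nat \<lceil>X E\<rceil>)" by (simp only: n_def of_nat_mult of_nat_numeral)
      also have "\<dots> \<le> 2 * (X E + 1)" by (rule mult_left_mono[OF k]) simp
      finally have "real (n E) \<le> 2 * (X E + 1)" .
      then show "\<bar>real (n E)\<bar> \<le> \<bar>2 * (X E + 1)\<bar>" using abs_ge_self[of "2 * (X E + 1)"] by simp
    qed
  qed
  have pb_q: "power_bounded c1 (1 / 2) (\<lambda>E. real (q E))"
  proof -
    have "power_bounded c1 (1 / 2) (\<lambda>E. 2 * A * K\<^sup>2 * \<tau> E + 1)" by (intro pbI pb_\<tau> c) auto
    then show ?thesis
    proof (rule power_bounded_le)
      fix E assume "c1 \<le> E"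
      then have "0 \<le> 2 * A * K\<^sup>2 * \<tau> E" using c \<tau>1[of E] A by simp
      then show "\<bar>real (q E)\<bar> \<le> \<bar>2 * A * K\<^sup>2 * \<tau> E + 1\<bar>" unfolding q_def by linarith
    qed
  qed
  have pb_\<sigma>: "power_bounded c1 (1 / 2 + \<gamma> + \<gamma>) \<sigma>"
  proof -
    have h: "0 \<le> 1 / 2 + \<gamma> + \<gamma>" "0 \<le> 1 / 2 + \<gamma>" using \<gamma>0 by auto
    have "power_bounded c1 (1 / 2 + \<gamma> + \<gamma>) (\<lambda>E. ((real (q E) + 1) * real (n E) + 2) * real (n E) + 1)"
      by (intro pbI power_bounded_mult pb_q pb_n c h) auto
    then have "power_bounded c1 (1 / 2 + \<gamma> + \<gamma>) (\<lambda>E. (16 * K\<^sup>2 * (A + 1) / \<delta>) * (((real (q E) + 1) * real (n E) + 2) * real (n E) + 1))"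
      by (rule power_bounded_cmult)
    moreover have "real (m E) = ((real (q E) + 1) * real (n E) + 2) * real (n E) + 1" for E
      by (simp only: m_def of_nat_add of_nat_mult of_nat_1 of_nat_numeral)
    ultimately show ?thesis by (simp add: \<sigma>_def[abs_def])
  qed
  obtain Cn where Cn: "0 \<le> Cn" "\<And>E. c1 \<le> E \<Longrightarrow> \<bar>real (n E)\<bar> \<le> Cn * E powr \<gamma>"
    using pb_n unfolding power_bounded_def by blast
  obtain Cl where Cl: "0 \<le> Cl" "\<And>E. c1 \<le> E \<Longrightarrow> ln (\<sigma> E) \<le> Cl * ln (E + 1)"
    using power_bounded_ln[OF pb_\<sigma> c(1)] \<sigma>0 by blast
  let ?l = "ln (c1 + 1)"
  let ?k = "\<bar>ln (sqrt (2 / \<delta>))\<bar>"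
  have l0: "0 < ?l" using c by simp
  \<comment> \<open>The first summand bounds n (1 + ln sigma), where 1 is at most ln(E + 1) / ?l;
    the second absorbs the prefactor sqrt(2 / \<delta>) left by Chebyshev's inequality.\<close>
  let ?C = "Cn * (1 / ?l + Cl) + ?k / (c1 powr \<gamma> * ?l)"
  show ?thesis
  proof (intro exI[of _ ?C] conjI allI impI)
    show "0 \<le> ?C" using Cn(1) Cl(1) l0 c by (intro add_nonneg_nonneg mult_nonneg_nonneg divide_nonneg_nonneg) auto
    fix V E F v v1
    assume V: "\<forall>x. c1 * (\<bar>x\<bar> + 1) powr \<beta>1 \<le> V x \<and> V x \<le> c2 * (\<bar>x\<bar> + 1) powr \<beta>2"
      and E: "c1 \<le> E" and ss: "spectral_sum V E F v v1"
    let ?N = "sqrt (LINT x|lebesgue. indicator \<omega> x * (\<Sum>\<mu>\<in>F. v \<mu> x)\<^sup>2)"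
    let ?L = "ln (E + 1)"
    have L: "?l \<le> ?L" using E c by simp
    have P: "c1 powr \<gamma> \<le> E powr \<gamma>" using E c \<gamma>0 by (intro powr_mono2) auto
    have "exp (real (n E)) * (\<sigma> E) ^ n E * sqrt (2 / \<delta>) =
        exp (real (n E) * (1 + ln (\<sigma> E)) + ln (sqrt (2 / \<delta>)))"
      using \<sigma>0[of E] \<delta>0 by (simp add: exp_add distrib_left exp_of_nat_mult)
    also have "\<dots> \<le> exp (?C * E powr \<gamma> * ?L)"
    proof -
      have one: "1 \<le> 1 / ?l * ?L" using L l0 by simp
      have "real (n E) * (1 + ln (\<sigma> E)) \<le> real (n E) * (1 / ?l * ?L + Cl * ?L)"
        using one Cl(2)[OF E] by (intro mult_left_mono add_mono) auto
      also have "\<dots> \<le> (Cn * E powr \<gamma>) * (1 / ?l * ?L + Cl * ?L)"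
        using Cn(2)[OF E] Cl(1) l0 L by (intro mult_right_mono add_nonneg_nonneg mult_nonneg_nonneg) auto
      finally have a: "real (n E) * (1 + ln (\<sigma> E)) \<le> Cn * (1 / ?l + Cl) * E powr \<gamma> * ?L"
        by (simp add: algebra_simps)
      have "ln (sqrt (2 / \<delta>)) \<le> ?k / (c1 powr \<gamma> * ?l) * (c1 powr \<gamma> * ?l)" using l0 c by simp
      also have "\<dots> \<le> ?k / (c1 powr \<gamma> * ?l) * (E powr \<gamma> * ?L)"
        using P L l0 c by (intro mult_left_mono mult_mono divide_nonneg_nonneg mult_nonneg_nonneg) auto
      finally have b: "ln (sqrt (2 / \<delta>)) \<le> ?k / (c1 powr \<gamma> * ?l) * E powr \<gamma> * ?L" by (simp only: mult.assoc)
      have "real (n E) * (1 + ln (\<sigma> E)) + ln (sqrt (2 / \<delta>)) \<le>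
          Cn * (1 / ?l + Cl) * E powr \<gamma> * ?L + ?k / (c1 powr \<gamma> * ?l) * E powr \<gamma> * ?L"
        by (rule add_mono[OF a b])
      also have "\<dots> = ?C * E powr \<gamma> * ?L" by (simp only: distrib_right)
      finally show ?thesis by simp
    qed
    finally have D: "exp (real (n E)) * (\<sigma> E) ^ n E * sqrt (2 / \<delta>) \<le> exp (?C * E powr \<gamma> * ?L)" .
    have "sqrt (LINT x|lebesgue. (\<Sum>\<mu>\<in>F. v \<mu> x)\<^sup>2) \<le> (exp (real (n E)) * (\<sigma> E) ^ n E * sqrt (2 / \<delta>)) * ?N"
      using main[OF V E ss] by (simp only: mult.assoc)
    also have "\<dots> \<le> exp (?C * E powr \<gamma> * ?L) * ?N"
      by (rule mult_right_mono[OF D]) (auto intro!: Bochner_Integration.integral_nonneg)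
    finally show "sqrt (LINT x|lebesgue. (\<Sum>\<mu>\<in>F. v \<mu> x)\<^sup>2) \<le>
       exp (?C * E powr (1 / \<beta>1 + \<beta>2 / (2 * \<beta>1)) * ?L) * ?N" unfolding \<gamma>_def .
  qed
qed

section \<open>Incompatible exponents, small energies and complex values\<close>

text \<open>If \<open>\<beta>1 > \<beta>2\<close>, the lower bound for V eventually exceeds the
  upper one, no potential is admissible, and the theorem holds vacuously.\<close>

lemma growth_exponents_le:
  fixes c1 c2 \<beta>1 \<beta>2 :: real
  assumes c: "0 < c1" "0 < c2"
    and le: "\<And>x::real. c1 * (\<bar>x\<bar> + 1) powr \<beta>1 \<le> c2 * (\<bar>x\<bar> + 1) powr \<beta>2"
  shows "\<beta>1 \<le> \<beta>2"
proof (rule ccontr)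
  assume "\<not> \<beta>1 \<le> \<beta>2"
  then have d: "0 < \<beta>1 - \<beta>2" by simp
  \<comment> \<open>Chosen so that t to the power \<open>\<beta>1 - \<beta>2\<close> is c2/c1 + 1,
    just beyond the admissible c2/c1; as t >= 1, it is of the form |x| + 1.\<close>
  define t where "t = (c2 / c1 + 1) powr (1 / (\<beta>1 - \<beta>2))"
  have t1: "1 \<le> t" unfolding t_def using c d by (intro ge_one_powr_ge_zero) auto
  have "c1 * t powr \<beta>1 \<le> c2 * t powr \<beta>2" using le[of "t - 1"] t1 by simp
  moreover have "t powr \<beta>1 = t powr (\<beta>1 - \<beta>2) * t powr \<beta>2" by (simp add: powr_add[symmetric])
  moreover have "0 < t powr \<beta>2" using t1 by simp
  ultimately have "c1 * t powr (\<beta>1 - \<beta>2) \<le> c2" by (simp add: mult.assoc[symmetric])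
  moreover have "t powr (\<beta>1 - \<beta>2) = c2 / c1 + 1" using c d by (simp add: t_def powr_powr)
  ultimately show False using c by (simp add: distrib_left)
qed

text \<open>The quadratic form is at least c times the mass and at most E times it. This settles E <
  c1, where ln(E + 1) may be arbitrarily small and cannot absorb constants.\<close>

lemma (in spectral_sum) mass_eq_zero:
  assumes "\<And>x. c \<le> V x" "E < c" shows "mass 0 = 0"
proof -
  have "c * mass 0 = (LINT x|lebesgue. c * (p 0 x)\<^sup>2)" by (simp add: mass_def)
  also have "\<dots> \<le> (LINT x|lebesgue. V x * (p 0 x)\<^sup>2)"
    using assms(1) p_integrable[of 0] energy_integrable(2)[of 0] by (intro integral_mono) (auto intro: mult_right_mono)
  also have "\<dots> \<le> E * mass 0"
  proof -
    have "0 \<le> (LINT x|lebesgue. (p1 0 x)\<^sup>2)" by simp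
    then show ?thesis using energy_le[of 0] by linarith
  qed
  finally have "(c - E) * mass 0 \<le> 0" by (simp add: left_diff_distrib)
  then show ?thesis using assms(2) mass_nonneg[of 0] by (simp add: mult_le_0_iff)
qed

lemma spectral_range_measurable:
  assumes "\<phi> \<in> spectral_range V E" shows "\<phi> \<in> borel_measurable lebesgue"
  using assms unfolding spectral_range_def
proof (induction rule: cfun.span_induct_alt)
  case base
  then show ?case by (simp add: zero_fun_def)
next
  case (step k \<psi> \<phi>)
  then have "\<psi> \<in> borel_measurable lebesgue" by (auto simp: eigenfunction_def schrodinger_op_def L2_fun_def)
  with step show ?case unfolding plus_fun_def by measurable
qed

lemma L2_norm_on_Complex:
  fixes f g :: "real \<Rightarrow> real"
  assumes \<omega>: "\<omega> \<in> sets lebesgue" and \<phi>: "\<phi> \<in> borel_measurable lebesgue" "AE x in lebesgue. \<phi> x = Complex (f x) (g x)"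
    and f: "integrable lebesgue (\<lambda>x. (f x)\<^sup>2)" and g: "integrable lebesgue (\<lambda>x. (g x)\<^sup>2)"
  shows "L2_norm_on \<omega> \<phi> =
    sqrt ((LINT x|lebesgue. indicator \<omega> x * (f x)\<^sup>2) + (LINT x|lebesgue. indicator \<omega> x * (g x)\<^sup>2))"
proof -
  have i: "integrable lebesgue (\<lambda>x. indicator \<omega> x * (f x)\<^sup>2)" "integrable lebesgue (\<lambda>x. indicator \<omega> x * (g x)\<^sup>2)"
    using integrable_mult_indicator[OF \<omega> f] integrable_mult_indicator[OF \<omega> g] by simp_all
  have "(LINT x:\<omega>|lebesgue. (cmod (\<phi> x))\<^sup>2) =
      (LINT x|lebesgue. indicator \<omega> x * (f x)\<^sup>2 + indicator \<omega> x * (g x)\<^sup>2)"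
    unfolding set_lebesgue_integral_def
  proof (rule integral_cong_AE)
    show "AE x in lebesgue. indicator \<omega> x *\<^sub>R (cmod (\<phi> x))\<^sup>2 = indicator \<omega> x * (f x)\<^sup>2 + indicator \<omega> x * (g x)\<^sup>2"
      using \<phi>(2) by eventually_elim (simp add: cmod_power2 distrib_left)
    show "(\<lambda>x. indicator \<omega> x *\<^sub>R (cmod (\<phi> x))\<^sup>2) \<in> borel_measurable lebesgue"
      using \<omega> \<phi>(1) by measurable
  qed (use i in auto)
  then show ?thesis using i by (simp add: L2_norm_on_def)
qed

theorem theorem3:
  fixes c1 c2 \<beta>1 \<beta>2 :: real and \<omega> :: "real set"
  assumes "c1 > 0" and "c2 > 0" and "\<beta>1 > 0" and "\<beta>2 > 0"
    and "\<omega> \<in> sets lebesgue" and "emeasure lebesgue \<omega> > 0"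
  shows "\<exists>C::real. \<forall>V::real \<Rightarrow> real.
    V \<in> borel_measurable lebesgue \<longrightarrow>
    (\<forall>x. c1 * (\<bar>x\<bar> + 1) powr \<beta>1 \<le> V x \<and> V x \<le> c2 * (\<bar>x\<bar> + 1) powr \<beta>2) \<longrightarrow>
    (\<forall>E>0. \<forall>\<phi>\<in>spectral_range V E.
       L2_norm_on UNIV \<phi> \<le>
         exp (C * E powr (1 / \<beta>1 + \<beta>2 / (2 * \<beta>1)) * ln (E + 1)) * L2_norm_on \<omega> \<phi>)"
proof (cases "\<beta>1 \<le> \<beta>2")
  case False
  then show ?thesis using growth_exponents_le[OF assms(1,2), of \<beta>1 \<beta>2] order_trans by blast
next
  case True
  obtain C where C: "\<And>V E F v v1. \<forall>x. c1 * (\<bar>x\<bar> + 1) powr \<beta>1 \<le> V x \<and> V x \<le> c2 * (\<bar>x\<bar> + 1) powr \<beta>2 \<Longrightarrow>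
     c1 \<le> E \<Longrightarrow> spectral_sum V E F v v1 \<Longrightarrow>
     sqrt (LINT x|lebesgue. (\<Sum>\<mu>\<in>F. v \<mu> x)\<^sup>2) \<le>
       exp (C * E powr (1 / \<beta>1 + \<beta>2 / (2 * \<beta>1)) * ln (E + 1)) *
       sqrt (LINT x|lebesgue. indicator \<omega> x * (\<Sum>\<mu>\<in>F. v \<mu> x)\<^sup>2)"
    using real_spectral_inequality[OF assms(1-4) True assms(5,6)] by blast
  show ?thesis
  proof (intro exI[of _ C] allI impI ballI)
    fix V :: "real \<Rightarrow> real" and E :: real and \<phi>
    assume Vm: "V \<in> borel_measurable lebesgue"
      and V: "\<forall>x. c1 * (\<bar>x\<bar> + 1) powr \<beta>1 \<le> V x \<and> V x \<le> c2 * (\<bar>x\<bar> + 1) powr \<beta>2"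
      and E: "0 < E" and \<phi>: "\<phi> \<in> spectral_range V E"
    let ?D = "exp (C * E powr (1 / \<beta>1 + \<beta>2 / (2 * \<beta>1)) * ln (E + 1))"
    have Vc: "c1 \<le> V x" for x
    proof -
      have "c1 * 1 \<le> c1 * (\<bar>x\<bar> + 1) powr \<beta>1"
        using assms(1,3) by (intro mult_left_mono ge_one_powr_ge_zero) auto
      then show ?thesis using V order_trans by fastforce
    qed
    interpret potential V
    proof
      show "0 \<le> V x" for x using Vc[of x] assms(1) by linarith
      show "locally_bounded V"
        unfolding locally_bounded_def
      proof (intro allI exI impI)
        fix R x :: real assume "\<bar>x\<bar> \<le> R"
        then have "c2 * (\<bar>x\<bar> + 1) powr \<beta>2 \<le> c2 * (R + 1) powr \<beta>2"
          using assms(2,4) by (intro mult_left_mono powr_mono2) auto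
        then have "V x \<le> c2 * (R + 1) powr \<beta>2" using V order_trans by blast
        then show "\<bar>V x\<bar> \<le> c2 * (R + 1) powr \<beta>2" using Vc[of x] assms(1) by linarith
      qed
    qed (rule Vm)
    obtain f g where fg: "spectral_pair E f g" "AE x in lebesgue. \<phi> x = Complex (f x) (g x)"
      using spectral_range_pair[OF assms(1) Vc \<phi>] by blast
    obtain F v v1 y y1 where F: "finite F" "\<forall>\<mu>\<in>F. 0 < \<mu> \<and> \<mu> \<le> E"
      and e: "\<forall>\<mu>\<in>F. eig \<mu> (v \<mu>) (v1 \<mu>) \<and> eig \<mu> (y \<mu>) (y1 \<mu>)"
      and fe: "f = (\<lambda>x. \<Sum>\<mu>\<in>F. v \<mu> x)" and ge: "g = (\<lambda>x. \<Sum>\<mu>\<in>F. y \<mu> x)"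
      using fg(1) unfolding spectral_pair_def by blast
    \<comment> \<open>The squared inequality has the same factor for the real and the imaginary
      part, so the two can be added.\<close>
    have ineq: "integrable lebesgue (\<lambda>x. (\<Sum>\<mu>\<in>F. z \<mu> x)\<^sup>2) \<and>
        (LINT x|lebesgue. (\<Sum>\<mu>\<in>F. z \<mu> x)\<^sup>2) \<le> ?D\<^sup>2 * (LINT x|lebesgue. indicator \<omega> x * (\<Sum>\<mu>\<in>F. z \<mu> x)\<^sup>2)"
      if "\<forall>\<mu>\<in>F. eig \<mu> (z \<mu>) (z1 \<mu>)" for z z1
    proof -
      have ss: "spectral_sum V E F z z1"
        by unfold_locales (use E F that in auto)
      then interpret ss: spectral_sum V E F z z1 .
      let ?I = "LINT x|lebesgue. indicator \<omega> x * (\<Sum>\<mu>\<in>F. z \<mu> x)\<^sup>2"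
      have I0: "0 \<le> ?I" by (rule Bochner_Integration.integral_nonneg) simp
      have "(LINT x|lebesgue. (\<Sum>\<mu>\<in>F. z \<mu> x)\<^sup>2) \<le> ?D\<^sup>2 * ?I"
      proof (cases "c1 \<le> E")
        case True
        have "(sqrt (LINT x|lebesgue. (\<Sum>\<mu>\<in>F. z \<mu> x)\<^sup>2))\<^sup>2 \<le> (?D * sqrt ?I)\<^sup>2"
          by (rule power_mono[OF C[OF V True ss]]) simp
        then show ?thesis using I0 by (simp add: power_mult_distrib)
      next
        case False
        then have "ss.mass 0 = 0" using ss.mass_eq_zero[OF Vc] by simp
        then show ?thesis using I0 by (simp add: ss.mass_def ss.p_0)
      qed
      moreover have "integrable lebesgue (\<lambda>x. (\<Sum>\<mu>\<in>F. z \<mu> x)\<^sup>2)" using ss.p_integrable[of 0] by (simp add: ss.p_0)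
      ultimately show ?thesis by blast
    qed
    have f: "integrable lebesgue (\<lambda>x. (f x)\<^sup>2)"
        "(LINT x|lebesgue. (f x)\<^sup>2) \<le> ?D\<^sup>2 * (LINT x|lebesgue. indicator \<omega> x * (f x)\<^sup>2)"
      using ineq[of v v1] e unfolding fe by blast+
    have g: "integrable lebesgue (\<lambda>x. (g x)\<^sup>2)"
        "(LINT x|lebesgue. (g x)\<^sup>2) \<le> ?D\<^sup>2 * (LINT x|lebesgue. indicator \<omega> x * (g x)\<^sup>2)"
      using ineq[of y y1] e unfolding ge by blast+
    note norm = L2_norm_on_Complex[OF _ spectral_range_measurable[OF \<phi>] fg(2) f(1) g(1)]
    have "L2_norm_on UNIV \<phi> = sqrt ((LINT x|lebesgue. (f x)\<^sup>2) + (LINT x|lebesgue. (g x)\<^sup>2))"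
      by (subst norm) simp_all
    also have "\<dots> \<le> sqrt (?D\<^sup>2 * ((LINT x|lebesgue. indicator \<omega> x * (f x)\<^sup>2) + (LINT x|lebesgue. indicator \<omega> x * (g x)\<^sup>2)))"
      using f(2) g(2) by (intro real_sqrt_le_mono) (simp only: distrib_left add_mono)
    also have "\<dots> = ?D * L2_norm_on \<omega> \<phi>" by (simp add: norm[OF assms(5)] real_sqrt_mult)
    finally show "L2_norm_on UNIV \<phi> \<le> ?D * L2_norm_on \<omega> \<phi>" .
  qed
qed

end
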